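(* For $h>0$ and $t\ge 0$ set $F_h(t)=E_h(t)P_h-E(t)$. Then there are constants $h_0>0$ and $C>0$ such that for all $h\le h_0$, all $\beta$ with $1\le\beta\le r$, and all $t\ge 0$, $$\|F_h(t)v\|\le C h^{\beta}\,|v|_{\beta}\quad\text{for all } v\in\dot H^{\beta},$$ $$\Big(\int_0^t\|F_h(\tau)v\|^2\,\mathrm d\tau\Big)^{1/2}\le C|\log h|\,h^{\beta}\,|v|_{\beta-2}\quad\text{for all } v\in\dot H^{\beta-2}.$$
   Context: $\mathcal D\subset\mathbf R^d$, $d\le 3$, is a bounded domain with sufficiently smooth boundary. $H=L_2(\mathcal D)$ with norm $\|\cdot\|$ and inner product $(\cdot,\cdot)$; $H^s=H^s(\mathcal D)$ are the usual Sobolev spaces. $\dot H=\{v\in H:(v,1)=0\}$ and $P:H\to\dot H$ is the orthogonal projector. $A=-\Delta$ with domain $D(A)=\{v\in H^2:\partial v/\partial n=0\text{ on }\partial\mathcal D\}$ ($\partial/\partial n$ is the outward normal derivative). $A$ is selfadjoint and positive definite on $\dot H$ with compact inverse; on $H$ it has an orthonormal eigenbasis $\{\varphi_j\}_{j\ge0}$ with eigenvalues $0=\lambda_0<\lambda_1\le\lambda_2\le\cdots\to\infty$, and $\varphi_0=|\mathcal D|^{-1/2}$ is constant. For $s\in\mathbf R$, $|v|_s=\|A^{s/2}Pv\|=\big(\sum_{j\ge1}\lambda_j^s(v,\varphi_j)^2\big)^{1/2}$. For $s\ge0$, $\dot H^s=\{v\in\dot H:|v|_s<\infty\}$; for $s<0$,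 $\dot H^s$ is the closure (completion) of $\dot H$ with respect to $|\cdot|_s$. One has $\dot H^0=\dot H$ and $\dot H^1=H^1\cap\dot H$. $E(t)=\mathrm e^{-tA^2}$ is the analytic semigroup generated by $-A^2$: $E(t)v=\sum_{j\ge0}\mathrm e^{-t\lambda_j^2}(v,\varphi_j)\varphi_j$. $\{S_h\}_{h>0}$ is a family of finite-dimensional subspaces of $H^1$ containing the constants; $P_h:H\to S_h$ is the $H$-orthogonal projector, extended to $\dot H^{-1}$ by duality; $\dot S_h=\{\chi\in S_h:(\chi,1)=0\}$. The discrete Laplacian $A_h:S_h\to\dot S_h$ is defined by $(A_h\chi,\eta)=(\nabla\chi,\nabla\eta)$ for all $\chi\in S_h$, $\eta\in\dot S_h$; it is selfadjoint, positive definite on $\dot S_h$ and positive semidefinite on $S_h$, with orthonormal eigenbasis $\{\varphi_{h,j}\}_{j=0}^{N_h}$ and eigenvalues $0=\lambda_{h,0}<\lambda_{h,1}\le\cdots\le\lambda_{h,N_h}$, $\varphi_{h,0}=\varphi_0$. $E_h(t)=\mathrm e^{-tA_h^2}$ on $S_h$, i.e. $E_h(t)v_h=\sum_{j=1}^{N_h}\mathrm e^{-t\lambda_{h,j}^2}(v_h,\varphi_{h,j})\varphi_{h,j}+(v_h,\varphi_0)\varphi_0$. The Ritz projector $R_h:\dot H^1\to\dot S_h$ is defined by $(\nabla R_hv,\nabla\chi)=(\nabla v,\nabla\chi)$ for all $\chi\in\dot S_h$. Standing assumption: for some integer $r\ge2$ there is a constant $C$ (independent of $h$, $\beta$, $v$)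 such that $\|R_hv-v\|\le Ch^{\beta}|v|_{\beta}$ for all $v\in\dot H^{\beta}$, $1\le\beta\le r$. *)

theory Defs
  imports "HOL-Analysis.Analysis"
begin

text \<open>
  Elements of \<open>L\<^sub>2(D)\<close> are represented by functions; two representatives denote the same element
  iff they agree almost everywhere on \<open>D\<close>.  Operators with values in \<open>L\<^sub>2(D)\<close> that are
  determined only almost everywhere pick a representative with \<open>SOME\<close>.
\<close>

section \<open>Smoothness\<close>

text \<open>Class \<open>C\<^sup>k\<close> on an open set \<open>U\<close>; \<open>f'\<close> is the gradient of \<open>f\<close>.\<close>

primrec Ck_on :: "nat \<Rightarrow> 'a::euclidean_space set \<Rightarrow> ('a \<Rightarrow> real) \<Rightarrow> bool" where
  "Ck_on 0 U f \<longleftrightarrow> continuous_on U f"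
| "Ck_on (Suc k) U f \<longleftrightarrow>
     (\<exists>f'. (\<forall>x\<in>U. (f has_derivative (\<lambda>v. f' x \<bullet> v)) (at x)) \<and>
           (\<forall>b\<in>Basis. Ck_on k U (\<lambda>x. f' x \<bullet> b)))"

definition Ck_boundary :: "nat \<Rightarrow> 'a::euclidean_space set \<Rightarrow> bool" where
  "Ck_boundary k D \<longleftrightarrow>
     (\<forall>p\<in>frontier D. \<exists>U \<psi>. open U \<and> p \<in> U \<and> Ck_on k U \<psi> \<and>
        (\<forall>x\<in>U. frechet_derivative \<psi> (at x) \<noteq> (\<lambda>v. 0)) \<and>
        D \<inter> U = {x \<in> U. \<psi> x < 0})"

definition test_functions :: "'a::euclidean_space set \<Rightarrow> ('a \<Rightarrow> real) set" where
  "test_functions D =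
     {\<psi>. (\<forall>k. Ck_on k UNIV \<psi>) \<and> compact (closure {x. \<psi> x \<noteq> 0}) \<and> closure {x. \<psi> x \<noteq> 0} \<subseteq> D}"

section \<open>Lebesgue and Sobolev spaces\<close>

definition L2 :: "'a::euclidean_space set \<Rightarrow> ('a \<Rightarrow> real) set" where
  "L2 D = {f. f \<in> borel_measurable (lebesgue_on D) \<and> integrable (lebesgue_on D) (\<lambda>x. (f x)\<^sup>2)}"

definition ip :: "'a::euclidean_space set \<Rightarrow> ('a \<Rightarrow> real) \<Rightarrow> ('a \<Rightarrow> real) \<Rightarrow> real" where
  "ip D f g = (\<integral>x. f x * g x \<partial>lebesgue_on D)"

definition nrm :: "'a::euclidean_space set \<Rightarrow> ('a \<Rightarrow> real) \<Rightarrow> real" where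
  "nrm D f = sqrt (ip D f f)"

definition ae_eq :: "'a::euclidean_space set \<Rightarrow> ('a \<Rightarrow> real) \<Rightarrow> ('a \<Rightarrow> real) \<Rightarrow> bool" where
  "ae_eq D f g \<longleftrightarrow> (AE x in lebesgue_on D. f x = g x)"

definition has_weak_deriv ::
    "'a::euclidean_space set \<Rightarrow> 'a \<Rightarrow> ('a \<Rightarrow> real) \<Rightarrow> ('a \<Rightarrow> real) \<Rightarrow> bool" where
  "has_weak_deriv D b f g \<longleftrightarrow> g \<in> L2 D \<and>
     (\<forall>\<psi>\<in>test_functions D. ip D f (\<lambda>x. frechet_derivative \<psi> (at x) b) = - ip D g \<psi>)"

definition wderiv :: "'a::euclidean_space set \<Rightarrow> 'a \<Rightarrow> ('a \<Rightarrow> real) \<Rightarrow> 'a \<Rightarrow> real" where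
  "wderiv D b f = (SOME g. has_weak_deriv D b f g)"

text \<open>The Sobolev spaces \<open>H\<^sup>m(D)\<close> of integer order.\<close>

primrec sobolev :: "'a::euclidean_space set \<Rightarrow> nat \<Rightarrow> ('a \<Rightarrow> real) set" where
  "sobolev D 0 = L2 D"
| "sobolev D (Suc m) = {f \<in> L2 D. \<forall>b\<in>Basis. \<exists>g\<in>sobolev D m. has_weak_deriv D b f g}"

definition grad :: "'a::euclidean_space set \<Rightarrow> ('a \<Rightarrow> real) \<Rightarrow> 'a \<Rightarrow> 'a" where
  "grad D f x = (\<Sum>b\<in>Basis. wderiv D b f x *\<^sub>R b)"

definition grad_ip :: "'a::euclidean_space set \<Rightarrow> ('a \<Rightarrow> real) \<Rightarrow> ('a \<Rightarrow> real) \<Rightarrow> real" where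
  "grad_ip D f g = (\<integral>x. grad D f x \<bullet> grad D g x \<partial>lebesgue_on D)"

definition laplacian :: "'a::euclidean_space set \<Rightarrow> ('a \<Rightarrow> real) \<Rightarrow> 'a \<Rightarrow> real" where
  "laplacian D f x = (\<Sum>b\<in>Basis. wderiv D b (wderiv D b f) x)"

definition L2_zero_mean :: "'a::euclidean_space set \<Rightarrow> ('a \<Rightarrow> real) set" where
  "L2_zero_mean D = {v \<in> L2 D. ip D v (\<lambda>x. 1) = 0}"

section \<open>The Neumann Laplacian\<close>

text \<open>
  The normal derivative of \<open>v \<in> H\<^sup>2(D)\<close> as an element of \<open>H\<^sup>-\<^sup>1\<^sup>/\<^sup>2(\<partial>D)\<close>, i.e. the functional
  \<open>\<eta> \<mapsto> \<integral>\<^sub>\<partial>\<^sub>D (\<partial>v/\<partial>n) \<eta> ds\<close> on traces of \<open>\<eta> \<in> H\<^sup>1(D)\<close>, which by the usual definition of the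
  generalized normal trace is \<open>(\<Delta>v, \<eta>) + (\<nabla>v, \<nabla>\<eta>)\<close>.  The boundary condition
  \<open>\<partial>v/\<partial>n = 0\<close> on \<open>\<partial>D\<close> says that it vanishes.
\<close>

definition normal_deriv :: "'a::euclidean_space set \<Rightarrow> ('a \<Rightarrow> real) \<Rightarrow> ('a \<Rightarrow> real) \<Rightarrow> real" where
  "normal_deriv D v \<eta> = ip D (laplacian D v) \<eta> + grad_ip D v \<eta>"

definition dom_A :: "'a::euclidean_space set \<Rightarrow> ('a \<Rightarrow> real) set" where
  "dom_A D = {v \<in> sobolev D 2. \<forall>\<eta>\<in>sobolev D 1. normal_deriv D v \<eta> = 0}"

definition op_A :: "'a::euclidean_space set \<Rightarrow> ('a \<Rightarrow> real) \<Rightarrow> 'a \<Rightarrow> real" where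
  "op_A D v x = - laplacian D v x"

definition neumann_eigenbasis ::
    "'a::euclidean_space set \<Rightarrow> (nat \<Rightarrow> real) \<Rightarrow> (nat \<Rightarrow> 'a \<Rightarrow> real) \<Rightarrow> bool" where
  "neumann_eigenbasis D lam \<phi> \<longleftrightarrow>
     (\<forall>j. \<phi> j \<in> dom_A D \<and> ae_eq D (op_A D (\<phi> j)) (\<lambda>x. lam j * \<phi> j x)) \<and>
     (\<forall>i j. ip D (\<phi> i) (\<phi> j) = (if i = j then 1 else 0)) \<and>
     (\<forall>f\<in>L2 D. (\<lambda>n. nrm D (\<lambda>x. f x - (\<Sum>j<n. ip D f (\<phi> j) * \<phi> j x))) \<longlonglongrightarrow> 0) \<and>
     lam 0 = 0 \<and> 0 < lam 1 \<and> (\<forall>j\<ge>1. lam j \<le> lam (Suc j)) \<and> filterlim lam at_top sequentially \<and>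
     ae_eq D (\<phi> 0) (\<lambda>x. measure lebesgue D powr (- (1 / 2)))"

section \<open>The spaces \<open>\<dot>H\<^sup>s\<close>\<close>

text \<open>Here and below the index \<open>Suc j\<close> expresses summation over \<open>j \<ge> 1\<close>.\<close>

definition snorm ::
    "'a::euclidean_space set \<Rightarrow> (nat \<Rightarrow> real) \<Rightarrow> (nat \<Rightarrow> 'a \<Rightarrow> real) \<Rightarrow> real \<Rightarrow> ('a \<Rightarrow> real) \<Rightarrow> real" where
  "snorm D lam \<phi> s v = sqrt (\<Sum>j. lam (Suc j) powr s * (ip D v (\<phi> (Suc j)))\<^sup>2)"

text \<open>\<open>\<dot>H\<^sup>s\<close> for \<open>s \<ge> 0\<close>.\<close>

definition Hdot ::
    "'a::euclidean_space set \<Rightarrow> (nat \<Rightarrow> real) \<Rightarrow> (nat \<Rightarrow> 'a \<Rightarrow> real) \<Rightarrow> real \<Rightarrow> ('a \<Rightarrow> real) set" where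
  "Hdot D lam \<phi> s = {v \<in> L2_zero_mean D. summable (\<lambda>j. lam (Suc j) powr s * (ip D v (\<phi> (Suc j)))\<^sup>2)}"

text \<open>
  \<open>\<dot>H\<^sup>s\<close> for \<open>s < 0\<close>: the completion of \<open>\<dot>H\<close> with respect to the norm \<open>|\<cdot>|\<^sub>s\<close>.
  Its elements are represented by the Cauchy sequences in \<open>\<dot>H\<close>, with norm \<open>lim |x\<^sub>n|\<^sub>s\<close>; the
  pairing \<open>\<langle>x, \<xi>\<rangle>\<close>, for \<open>\<xi> \<in> H\<^sup>1\<close> and \<open>s \<ge> -1\<close>, extends the inner product \<open>(\<cdot>, \<xi>)\<close> by continuity.
\<close>

definition Hdot_compl ::
    "'a::euclidean_space set \<Rightarrow> (nat \<Rightarrow> real) \<Rightarrow> (nat \<Rightarrow> 'a \<Rightarrow> real) \<Rightarrow> real \<Rightarrow> (nat \<Rightarrow> 'a \<Rightarrow> real) set" where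
  "Hdot_compl D lam \<phi> s =
     {x. (\<forall>n. x n \<in> L2_zero_mean D) \<and>
         (\<forall>e>0. \<exists>M. \<forall>m\<ge>M. \<forall>n\<ge>M. snorm D lam \<phi> s (\<lambda>y. x m y - x n y) < e)}"

definition snorm_compl ::
    "'a::euclidean_space set \<Rightarrow> (nat \<Rightarrow> real) \<Rightarrow> (nat \<Rightarrow> 'a \<Rightarrow> real) \<Rightarrow> real \<Rightarrow> (nat \<Rightarrow> 'a \<Rightarrow> real) \<Rightarrow> real" where
  "snorm_compl D lam \<phi> s x = lim (\<lambda>n. snorm D lam \<phi> s (x n))"

definition pairing ::
    "'a::euclidean_space set \<Rightarrow> (nat \<Rightarrow> 'a \<Rightarrow> real) \<Rightarrow> ('a \<Rightarrow> real) \<Rightarrow> real" where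
  "pairing D x \<xi> = lim (\<lambda>n. ip D (x n) \<xi>)"

section \<open>The semigroup\<close>

text \<open>
  \<open>E(t)\<close> and \<open>P\<^sub>h\<close> depend on their argument \<open>v\<close> only through the numbers \<open>(v, \<xi>)\<close>.  They are
  therefore defined on functionals \<open>l\<close>, with \<open>l = ip D v\<close> for \<open>v \<in> L\<^sub>2(D)\<close> and
  \<open>l = pairing D x\<close> for an element \<open>x\<close> of a completion.
\<close>

definition semigroup_E ::
    "'a::euclidean_space set \<Rightarrow> (nat \<Rightarrow> real) \<Rightarrow> (nat \<Rightarrow> 'a \<Rightarrow> real) \<Rightarrow> real \<Rightarrow> (('a \<Rightarrow> real) \<Rightarrow> real)
       \<Rightarrow> 'a \<Rightarrow> real" where
  "semigroup_E D lam \<phi> t l =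
     (SOME w. w \<in> L2 D \<and>
        (\<lambda>n. nrm D (\<lambda>x. w x - (\<Sum>j<n. exp (- t * (lam j)\<^sup>2) * l (\<phi> j) * \<phi> j x))) \<longlonglongrightarrow> 0)"

section \<open>Finite-dimensional approximation\<close>

text \<open>\<open>V\<close> is the span of a finite set, closed under almost everywhere equality.\<close>

definition fin_dim_subspace :: "'a::euclidean_space set \<Rightarrow> ('a \<Rightarrow> real) set \<Rightarrow> bool" where
  "fin_dim_subspace D V \<longleftrightarrow>
     (\<exists>B. finite B \<and> B \<subseteq> L2 D \<and> V = {f \<in> L2 D. \<exists>c. ae_eq D f (\<lambda>x. \<Sum>b\<in>B. c b * b x)})"

definition zero_mean :: "'a::euclidean_space set \<Rightarrow> ('a \<Rightarrow> real) set \<Rightarrow> ('a \<Rightarrow> real) set" where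
  "zero_mean D V = {\<xi> \<in> V. ip D \<xi> (\<lambda>x. 1) = 0}"

definition proj ::
    "'a::euclidean_space set \<Rightarrow> ('a \<Rightarrow> real) set \<Rightarrow> (('a \<Rightarrow> real) \<Rightarrow> real) \<Rightarrow> 'a \<Rightarrow> real" where
  "proj D V l = (SOME w. w \<in> V \<and> (\<forall>\<xi>\<in>V. ip D w \<xi> = l \<xi>))"

definition ritz :: "'a::euclidean_space set \<Rightarrow> ('a \<Rightarrow> real) set \<Rightarrow> ('a \<Rightarrow> real) \<Rightarrow> 'a \<Rightarrow> real" where
  "ritz D V v = (SOME w. w \<in> zero_mean D V \<and> (\<forall>\<xi>\<in>zero_mean D V. grad_ip D w \<xi> = grad_ip D v \<xi>))"

definition disc_A :: "'a::euclidean_space set \<Rightarrow> ('a \<Rightarrow> real) set \<Rightarrow> ('a \<Rightarrow> real) \<Rightarrow> 'a \<Rightarrow> real" where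
  "disc_A D V \<xi> = (SOME w. w \<in> zero_mean D V \<and> (\<forall>\<eta>\<in>zero_mean D V. ip D w \<eta> = grad_ip D \<xi> \<eta>))"

definition disc_eigenbasis ::
    "'a::euclidean_space set \<Rightarrow> ('a \<Rightarrow> real) set \<Rightarrow> nat \<Rightarrow> (nat \<Rightarrow> real) \<Rightarrow> (nat \<Rightarrow> 'a \<Rightarrow> real) \<Rightarrow> bool" where
  "disc_eigenbasis D V N lam \<phi> \<longleftrightarrow>
     (\<forall>j\<le>N. \<phi> j \<in> V \<and> ae_eq D (disc_A D V (\<phi> j)) (\<lambda>x. lam j * \<phi> j x)) \<and>
     (\<forall>i\<le>N. \<forall>j\<le>N. ip D (\<phi> i) (\<phi> j) = (if i = j then 1 else 0)) \<and>
     (\<forall>\<xi>\<in>V. ae_eq D \<xi> (\<lambda>x. \<Sum>j\<le>N. ip D \<xi> (\<phi> j) * \<phi> j x)) \<and>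
     lam 0 = 0 \<and> (1 \<le> N \<longrightarrow> 0 < lam 1) \<and> (\<forall>i j. 1 \<le> i \<and> i \<le> j \<and> j \<le> N \<longrightarrow> lam i \<le> lam j)"

definition disc_E ::
    "'a::euclidean_space set \<Rightarrow> nat \<Rightarrow> (nat \<Rightarrow> real) \<Rightarrow> (nat \<Rightarrow> 'a \<Rightarrow> real) \<Rightarrow> real \<Rightarrow> ('a \<Rightarrow> real)
       \<Rightarrow> 'a \<Rightarrow> real" where
  "disc_E D N lam \<phi> t v x = (\<Sum>j\<le>N. exp (- t * (lam j)\<^sup>2) * ip D v (\<phi> j) * \<phi> j x)"

definition error_F ::
    "'a::euclidean_space set \<Rightarrow> (nat \<Rightarrow> real) \<Rightarrow> (nat \<Rightarrow> 'a \<Rightarrow> real) \<Rightarrow>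
     ('a \<Rightarrow> real) set \<Rightarrow> nat \<Rightarrow> (nat \<Rightarrow> real) \<Rightarrow> (nat \<Rightarrow> 'a \<Rightarrow> real) \<Rightarrow>
     real \<Rightarrow> (('a \<Rightarrow> real) \<Rightarrow> real) \<Rightarrow> 'a \<Rightarrow> real" where
  "error_F D lam \<phi> V N lamh \<phi>h t l x =
     disc_E D N lamh \<phi>h t (proj D V l) x - semigroup_E D lam \<phi> t l x"

end

theory Submission
  imports Defs "HOL-Computational_Algebra.Polynomial"
begin

text \<open>
  The error is estimated in the coordinates of the two eigenbases. Write \<open>\<psi>\<^sub>i\<close>, \<open>\<mu>\<^sub>i\<close> for the
  discrete eigenpairs, \<open>m\<^sub>i\<^sub>j = (\<psi>\<^sub>i, \<phi>\<^sub>j)\<close>, and take \<open>v\<close> to be a finite combination of eigenfunctions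
  \<open>\<phi>\<^sub>j\<close> with \<open>j \<ge> 1\<close>. With \<open>u = E(t)v\<close> and \<open>u\<^sub>h = E\<^sub>h(t)P\<^sub>hv\<close>, the error is \<open>w\<close> plus the part
  \<open>P\<^sub>hu - u\<close>, where \<open>w = u\<^sub>h - P\<^sub>hu\<close>. The second part is a best approximation error, so it is at most the
  Ritz error. The first one starts at zero and solves the finite system
  \<open>w' + \<mu>\<^sup>2 w = \<mu>\<^sup>2 \<rho> + \<mu> \<eta>\<close>, because \<open>R\<^sub>h\<phi>\<^sub>j\<close> has the coordinates \<open>\<lambda>\<^sub>j m\<^sub>i\<^sub>j / \<mu>\<^sub>i\<close> and
  \<open>\<lambda>\<^sup>2 - \<mu>\<^sup>2 = \<mu> (\<lambda> / \<mu> - 1) (\<lambda> + \<mu>)\<close>; here \<open>\<rho> = P\<^sub>h(R\<^sub>h - 1)u\<close> and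
  \<open>\<eta> = P\<^sub>h(R\<^sub>h - 1)Au\<close> are both controlled by the Ritz estimate.

  Two energy identities suffice. Testing the system with \<open>\<mu>\<^sup>-\<^sup>2 w\<close> controls \<open>\<parallel>A\<^sub>h\<^sup>-\<^sup>1w(t)\<parallel>\<close> and
  \<open>\<integral>\<parallel>w\<parallel>\<^sup>2\<close> through \<open>\<integral>\<parallel>\<rho>\<parallel>\<^sup>2\<close> and \<open>(\<integral>\<parallel>\<eta>\<parallel>)\<^sup>2\<close> (\<open>integrated_bound\<close>); testing it with
  \<open>t \<mu>\<^sup>-\<^sup>2 w'\<close> turns this into a bound at each time (\<open>pointwise_bound\<close>). For data in \<open>\<dot>H\<^sup>\<beta>\<close> the smoothing of the semigroup gives
  \<open>\<parallel>\<rho>\<parallel> \<le> \<kappa>\<close>, \<open>t\<parallel>\<rho>'\<parallel> \<le> \<kappa>\<close> and \<open>t\<^sup>1\<^sup>/\<^sup>2\<parallel>\<eta>\<parallel> \<le> \<kappa>\<close> with \<open>\<kappa> = C h\<^sup>\<beta> |v|\<^sub>\<beta>\<close>, hence the first estimate (\<open>smooth_data_bound\<close>). For data in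
  \<open>\<dot>H\<^sup>\<beta>\<^sup>-\<^sup>2\<close> the bound \<open>\<parallel>\<eta>\<parallel> \<le> C h\<^sup>\<beta> t\<^sup>-\<^sup>1 |v|\<^sub>\<beta>\<^sub>-\<^sub>2\<close>, which for large \<open>t\<close> improves to \<open>t\<^sup>-\<^sup>2\<close>,
  is integrable only away from \<open>t = 0\<close>, and its integral over \<open>[h\<^sup>4, \<infinity>)\<close> produces the logarithm. On \<open>[0, h\<^sup>4]\<close>
  there are two cases. If \<open>\<beta> \<ge> 2\<close>, the Ritz estimate of order \<open>\<beta> - 1\<close> gives
  \<open>\<parallel>\<eta>\<parallel> \<le> C h\<^sup>\<beta>\<^sup>-\<^sup>1 t\<^sup>-\<^sup>3\<^sup>/\<^sup>4 |v|\<^sub>\<beta>\<^sub>-\<^sub>2\<close>, which is integrable. If \<open>\<beta> = 1\<close>, both solutions are estimated separately,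
  using \<open>\<parallel>A\<^sub>h\<^sup>-\<^sup>1\<^sup>/\<^sup>2P\<^sub>hv\<parallel> \<le> |v|\<^sub>-\<^sub>1\<close>. For \<open>1 < \<beta> < 2\<close> the data are split at the frequency \<open>\<lambda> = h\<^sup>-\<^sup>2\<close>, the lower
  part being treated as data for \<open>\<beta> = 2\<close> and the higher part as data for \<open>\<beta> = 1\<close>; this keeps the constant
  bounded as \<open>\<beta> \<rightarrow> 1\<close> (\<open>rough_data_bound\<close>).

  General data are reached by truncating the expansion and letting the truncation index grow: the truncated
  errors converge to the norm of the error at each \<open>t > 0\<close>, and Fatou's lemma transfers the integral bound
  (\<open>galerkin_err_tendsto\<close>, \<open>error_integral_bound\<close>).
  Two facts about the function spaces are needed. Weak gradients must be unique, since otherwise neither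
  \<open>A\<^sub>h\<close> nor \<open>R\<^sub>h\<close> is known to exist; this is the fundamental lemma of the calculus of variations, proved with
  smooth bumps supported in boxes (\<open>AE_eq_0_of_test_functions\<close>). And \<open>L\<^sub>2(D)\<close> must be complete for \<open>E(t)v\<close> to exist (\<open>L2_complete\<close>).
\<close>

section \<open>Energy estimates for a damped linear system\<close>

definition sqs :: "'b set \<Rightarrow> ('b \<Rightarrow> real) \<Rightarrow> real" where
  "sqs A x = (\<Sum>i\<in>A. (x i)\<^sup>2)"

lemma sqs_nonneg [simp]: "0 \<le> sqs A x"
  by (simp add: sqs_def sum_nonneg)

lemma sqs_add_le: "sqs A (\<lambda>i. x i + y i) \<le> 2 * sqs A x + 2 * sqs A y"
proof -
  have "(x i + y i)\<^sup>2 \<le> 2 * (x i)\<^sup>2 + 2 * (y i)\<^sup>2" for i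
    using zero_le_power2[of "x i - y i"] by (simp add: power2_eq_square algebra_simps)
  then show ?thesis
    unfolding sqs_def by (simp add: sum_distrib_left flip: sum.distrib) (rule sum_mono, simp)
qed

lemma sum_mult_le_sqrt_sqs: "(\<Sum>i\<in>A. x i * y i) \<le> sqrt (sqs A x) * sqrt (sqs A y)"
proof -
  have "(\<Sum>i\<in>A. x i * y i)\<^sup>2 \<le> sqs A x * sqs A y"
    unfolding sqs_def by (rule Cauchy_Schwarz_ineq_sum)
  then have "\<bar>\<Sum>i\<in>A. x i * y i\<bar> \<le> sqrt (sqs A x * sqs A y)"
    by (metis real_sqrt_abs real_sqrt_le_mono)
  then show ?thesis by (simp add: real_sqrt_mult)
qed

text \<open>
  The pointwise form of the second energy identity: the left side is the integrand that arises when
  \<open>t w\<^sup>2/2 - t \<rho> w + (w/\<mu>)\<^sup>2\<close> is differentiated along the system, and the difference of the two sides is a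
  sum of five squares. The weight of \<open>(w/\<mu>)\<^sup>2\<close> is chosen so that all terms \<open>w\<^sup>2\<close> cancel.
\<close>

lemma energy_product_estimate:
  fixes t mu w r r' e :: real
  assumes "t > 0" "mu > 0"
  shows "w\<^sup>2 / 2 + t * (w * (mu\<^sup>2 * (r - w) + mu * e)) - r * w
      - t * (r' * w + r * (mu\<^sup>2 * (r - w) + mu * e)) + 2 * (w * (r - w)) + 2 * (e * (w / mu))
    \<le> 2 * r\<^sup>2 + t\<^sup>2 * r'\<^sup>2 + 5 / 4 * (t * e\<^sup>2) + (w / mu)\<^sup>2 / t"
proof -
  define s where "s = w / mu"
  have "2 * r\<^sup>2 + t\<^sup>2 * r'\<^sup>2 + 5 / 4 * (t * e\<^sup>2) + s\<^sup>2 / t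
     - (w\<^sup>2 / 2 + t * (w * (mu\<^sup>2 * (r - w) + mu * e)) - r * w
      - t * (r' * w + r * (mu\<^sup>2 * (r - w) + mu * e)) + 2 * (w * (r - w)) + 2 * (e * s))
    = t * (mu * (w - r) - e / 2)\<^sup>2 + (r + w / 2)\<^sup>2 + (t * r' + w / 2)\<^sup>2 + (r - w)\<^sup>2 + (t * e - s)\<^sup>2 / t"
    using assms by (simp add: field_simps power2_eq_square)
  moreover have "\<dots> \<ge> 0" using assms by (intro add_nonneg_nonneg) auto
  ultimately show ?thesis unfolding s_def[symmetric] by linarith
qed

text \<open>
  The equation for the error, \<open>w' = \<mu>\<^sup>2 (\<rho> - w) + \<mu> \<eta>\<close> in each coordinate. No relation between the
  coordinates is used, so all constants below are independent of the size of \<open>I\<close> and of \<open>\<mu>\<close>.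
\<close>

locale damped_system =
  fixes I :: "nat set" and mu :: "nat \<Rightarrow> real" and w rho eta :: "real \<Rightarrow> nat \<Rightarrow> real"
  assumes mu_pos: "\<And>i. i \<in> I \<Longrightarrow> 0 < mu i"
    and dw: "\<And>i t. i \<in> I \<Longrightarrow>
      ((\<lambda>t. w t i) has_real_derivative (mu i)\<^sup>2 * (rho t i - w t i) + mu i * eta t i) (at t)"
begin

text \<open>
  The square of the norm of \<open>A\<^sub>h\<^sup>-\<^sup>1 w\<close>.
\<close>

definition g :: "real \<Rightarrow> real" where "g t = sqs I (\<lambda>i. w t i / mu i)"

lemma g_nonneg [simp]: "0 \<le> g t" by (simp add: g_def)

lemma g_deriv:
  "(g has_real_derivative (\<Sum>i\<in>I. 2 * (w t i * (rho t i - w t i)) + 2 * (eta t i * (w t i / mu i)))) (at t)"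
  unfolding g_def[abs_def] sqs_def
proof (rule DERIV_sum)
  fix i assume i: "i \<in> I"
  have "((\<lambda>t. (w t i)\<^sup>2 / (mu i)\<^sup>2) has_real_derivative
      2 * (w t i * (rho t i - w t i)) + 2 * (eta t i * (w t i / mu i))) (at t)"
    by (rule DERIV_cong[OF DERIV_cdivide[OF DERIV_power[OF dw[OF i, of t], where n = 2]]])
      (use mu_pos[OF i] in \<open>simp add: field_simps power2_eq_square\<close>)
  then show "((\<lambda>t. (w t i / mu i)\<^sup>2) has_real_derivative
      2 * (w t i * (rho t i - w t i)) + 2 * (eta t i * (w t i / mu i))) (at t)"
    by (simp only: power_divide)
qed

lemma g_cont: "continuous_on A g"
  by (meson DERIV_continuous continuous_at_imp_continuous_on g_deriv)

text \<open>
  Young's inequality with weight \<open>2t\<close> gives \<open>g' \<le> 5/2 \<kappa>\<^sup>2 + g/(2t)\<close>, so \<open>f = g - 5 \<kappa>\<^sup>2 t\<close>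
  satisfies \<open>f' \<le> f/(2t)\<close>; thus \<open>f/\<surd>t\<close> is nonincreasing, and it tends to \<open>0\<close> at \<open>t = 0\<close> because
  \<open>f\<close> vanishes there and is differentiable.
\<close>

lemma g_growth:
  assumes w0: "\<And>i. i \<in> I \<Longrightarrow> w 0 i = 0"
    and rho: "\<And>t. t > 0 \<Longrightarrow> sqs I (rho t) \<le> \<kappa>\<^sup>2"
    and eta: "\<And>t. t > 0 \<Longrightarrow> t * sqs I (eta t) \<le> \<kappa>\<^sup>2"
    and t: "t > 0"
  shows "g t \<le> 5 * \<kappa>\<^sup>2 * t"
proof -
  define f where "f t = g t - 5 * \<kappa>\<^sup>2 * t" for t
  define g' where "g' t = (\<Sum>i\<in>I. 2 * (w t i * (rho t i - w t i)) + 2 * (eta t i * (w t i / mu i)))" for t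
  have f': "(f has_real_derivative g' t - 5 * \<kappa>\<^sup>2) (at t)" for t
    unfolding f_def[abs_def] using g_deriv[of t] unfolding g'_def[symmetric]
    by (auto intro!: derivative_eq_intros)
  have g'_le: "g' t \<le> 5 / 2 * \<kappa>\<^sup>2 + g t / (2 * t)" if "t > 0" for t
  proof -
    have "g' t \<le> (\<Sum>i\<in>I. 1 / 2 * (rho t i)\<^sup>2 + (2 * t) * (eta t i)\<^sup>2 + 1 / (2 * t) * (w t i / mu i)\<^sup>2)"
      unfolding g'_def
    proof (rule sum_mono)
      fix i
      have "2 * (w t i * (rho t i - w t i)) \<le> 1 / 2 * (rho t i)\<^sup>2"
        using zero_le_power2[of "2 * w t i - rho t i"] by (simp add: power2_eq_square algebra_simps)
      moreover have "2 * (eta t i * (w t i / mu i)) \<le> (2 * t) * (eta t i)\<^sup>2 + 1 / (2 * t) * (w t i / mu i)\<^sup>2"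
      proof -
        have "(2 * t) * x\<^sup>2 + 1 / (2 * t) * y\<^sup>2 - 2 * (x * y) = (2 * t * x - y)\<^sup>2 / (2 * t)" for x y
          using that by (simp add: field_simps power2_eq_square)
        moreover have "(2 * t * x - y)\<^sup>2 / (2 * t) \<ge> 0" for x y using that by simp
        ultimately show ?thesis by (smt (verit, best))
      qed
      ultimately show "2 * (w t i * (rho t i - w t i)) + 2 * (eta t i * (w t i / mu i))
         \<le> 1 / 2 * (rho t i)\<^sup>2 + (2 * t) * (eta t i)\<^sup>2 + 1 / (2 * t) * (w t i / mu i)\<^sup>2" by linarith
    qed
    also have "\<dots> = 1 / 2 * sqs I (rho t) + 2 * (t * sqs I (eta t)) + 1 / (2 * t) * g t"
      unfolding sqs_def g_def by (simp add: sum.distrib sum_distrib_left mult.assoc sum_divide_distrib)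
    finally show ?thesis using rho[OF that] eta[OF that] by simp
  qed
  \<comment> \<open>\<open>(f/\<surd>t)' = (f' - f/(2t))/\<surd>t\<close>\<close>
  have mono: "f t / sqrt t \<le> f s / sqrt s" if "0 < s" "s \<le> t" for s t
  proof (rule DERIV_nonpos_imp_nonincreasing[OF \<open>s \<le> t\<close>])
    fix x assume x: "s \<le> x" "x \<le> t"
    then have x0: "x > 0" using that by simp
    have "((\<lambda>t. f t / sqrt t) has_real_derivative
        ((g' x - 5 * \<kappa>\<^sup>2) * sqrt x - f x * (inverse (sqrt x) / 2)) / (sqrt x * sqrt x)) (at x)"
      using x0 by (intro DERIV_divide f' DERIV_real_sqrt) auto
    moreover have "(g' x - 5 * \<kappa>\<^sup>2) * sqrt x - f x * (inverse (sqrt x) / 2) \<le> 0"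
    proof -
      have "g' x - 5 * \<kappa>\<^sup>2 \<le> f x / (2 * x)"
        using g'_le[OF x0] x0 unfolding f_def by (simp add: field_simps)
      then have "(g' x - 5 * \<kappa>\<^sup>2) * sqrt x \<le> f x / (2 * x) * sqrt x"
        using x0 by (intro mult_right_mono) auto
      also have "\<dots> = f x * (inverse (sqrt x) / 2)"
        using x0 by (simp add: field_simps)
      finally show ?thesis by simp
    qed
    ultimately show "\<exists>y. ((\<lambda>t. f t / sqrt t) has_real_derivative y) (at x) \<and> y \<le> 0"
      using x0 by (intro exI conjI) (auto intro: divide_nonpos_nonneg)
  qed
  have "((\<lambda>s. (f s - f 0) / s) \<longlongrightarrow> g' 0 - 5 * \<kappa>\<^sup>2) (at 0)"
    using f'[of 0] unfolding DERIV_def by simp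
  then have "((\<lambda>s. (f s - f 0) / s) \<longlongrightarrow> g' 0 - 5 * \<kappa>\<^sup>2) (at_right 0)"
    by (rule tendsto_within_subset) auto
  moreover have "((\<lambda>s. sqrt s) \<longlongrightarrow> sqrt 0) (at_right (0::real))"
    by (intro tendsto_intros)
  ultimately have "((\<lambda>s. (f s - f 0) / s * sqrt s) \<longlongrightarrow> (g' 0 - 5 * \<kappa>\<^sup>2) * sqrt 0) (at_right 0)"
    by (rule tendsto_mult)
  moreover have "eventually (\<lambda>s. f t / sqrt t \<le> (f s - f 0) / s * sqrt s) (at_right 0)"
  proof -
    have "f 0 = 0" using w0 by (simp add: f_def g_def sqs_def)
    moreover have "f s / s * sqrt s = f s / sqrt s" if "s > 0" for s
      using that by (simp add: field_simps)
    ultimately show ?thesis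
      using mono t by (auto simp: eventually_at_right_field intro!: exI[of _ t])
  qed
  ultimately have "f t / sqrt t \<le> 0"
    by (auto dest: tendsto_lowerbound)
  then show ?thesis using t unfolding f_def by (simp add: field_simps)
qed

text \<open>
  The factor \<open>t\<close> in the weighted energy compensates the singularity of \<open>\<rho>'\<close> and \<open>\<eta>\<close> at the initial time.
  The term \<open>t(\<rho>, w')\<close> is not controlled by the assumptions and is moved into the energy by the product rule;
  this is why \<open>\<Psi>\<close> contains \<open>\<rho> w\<close> and why a bound for \<open>\<rho>'\<close> is needed.
\<close>

lemma pointwise_bound:
  assumes w0: "\<And>i. i \<in> I \<Longrightarrow> w 0 i = 0"
    and drho: "\<And>i t. i \<in> I \<Longrightarrow> ((\<lambda>t. rho t i) has_real_derivative rho' t i) (at t)"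
    and rho: "\<And>t. t > 0 \<Longrightarrow> sqs I (rho t) \<le> \<kappa>\<^sup>2"
    and rho': "\<And>t. t > 0 \<Longrightarrow> t\<^sup>2 * sqs I (rho' t) \<le> \<kappa>\<^sup>2"
    and eta: "\<And>t. t > 0 \<Longrightarrow> t * sqs I (eta t) \<le> \<kappa>\<^sup>2"
    and t: "t > 0"
  shows "sqs I (w t) \<le> 41 * \<kappa>\<^sup>2"
proof -
  let ?w' = "\<lambda>t i. (mu i)\<^sup>2 * (rho t i - w t i) + mu i * eta t i"
  define \<Psi> where "\<Psi> t = (\<Sum>i\<in>I. t * ((w t i)\<^sup>2 / 2 - rho t i * w t i)) + g t - 37 / 4 * \<kappa>\<^sup>2 * t" for t
  define \<Psi>' where "\<Psi>' t = (\<Sum>i\<in>I. (w t i)\<^sup>2 / 2 - rho t i * w t i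
      + t * (w t i * ?w' t i - (rho' t i * w t i + rho t i * ?w' t i)))
      + (\<Sum>i\<in>I. 2 * (w t i * (rho t i - w t i)) + 2 * (eta t i * (w t i / mu i))) - 37 / 4 * \<kappa>\<^sup>2" for t
  have D: "(\<Psi> has_real_derivative \<Psi>' t) (at t)" for t
  proof -
    have term': "((\<lambda>t. t * ((w t i)\<^sup>2 / 2 - rho t i * w t i)) has_real_derivative
        (w t i)\<^sup>2 / 2 - rho t i * w t i
        + t * (w t i * ?w' t i - (rho' t i * w t i + rho t i * ?w' t i))) (at t)"
      if i: "i \<in> I" for i
    proof -
      have "((\<lambda>t. (w t i)\<^sup>2 / 2 - rho t i * w t i) has_real_derivative
          w t i * ?w' t i - (rho' t i * w t i + rho t i * ?w' t i)) (at t)"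
        by (rule DERIV_cong[OF DERIV_diff[OF DERIV_cdivide[OF DERIV_power[OF dw[OF i, of t], where n = 2]]
              DERIV_mult[OF drho[OF i] dw[OF i]]]]) (simp add: field_simps)
      from DERIV_mult[OF DERIV_ident this] show ?thesis
        by (rule DERIV_cong) (simp add: algebra_simps)
    qed
    have "((\<lambda>t. \<Sum>i\<in>I. t * ((w t i)\<^sup>2 / 2 - rho t i * w t i)) has_real_derivative
      (\<Sum>i\<in>I. (w t i)\<^sup>2 / 2 - rho t i * w t i
        + t * (w t i * ?w' t i - (rho' t i * w t i + rho t i * ?w' t i)))) (at t)"
      by (rule DERIV_sum) (rule term')
    from DERIV_diff[OF DERIV_add[OF this g_deriv] DERIV_cmult_Id]
    show ?thesis unfolding \<Psi>_def[abs_def] \<Psi>'_def .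
  qed
  have "\<Psi> t \<le> \<Psi> 0"
  proof (rule DERIV_nonpos_imp_decreasing_open[where f = \<Psi>])
    show "0 \<le> t" using t by simp
    show "continuous_on {0..t} \<Psi>"
      by (auto intro!: continuous_at_imp_continuous_on DERIV_isCont[OF D])
    fix s :: real assume s: "0 < s" "s < t"
    have "\<Psi>' s + 37 / 4 * \<kappa>\<^sup>2 = (\<Sum>i\<in>I. (w s i)\<^sup>2 / 2 + s * (w s i * ?w' s i) - rho s i * w s i
      - s * (rho' s i * w s i + rho s i * ?w' s i) + 2 * (w s i * (rho s i - w s i)) + 2 * (eta s i * (w s i / mu i)))"
      unfolding \<Psi>'_def by (simp flip: sum.distrib) (intro sum.cong refl, simp add: algebra_simps)
    also have "\<dots> \<le> (\<Sum>i\<in>I. 2 * (rho s i)\<^sup>2 + s\<^sup>2 * (rho' s i)\<^sup>2 + 5 / 4 * (s * (eta s i)\<^sup>2) + (w s i / mu i)\<^sup>2 / s)"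
      by (intro sum_mono energy_product_estimate mu_pos s)
    also have "\<dots> = 2 * sqs I (rho s) + s\<^sup>2 * sqs I (rho' s) + 5 / 4 * (s * sqs I (eta s)) + g s / s"
      unfolding sqs_def g_def by (simp add: sum.distrib sum_distrib_left sum_divide_distrib)
    also have "\<dots> \<le> 2 * \<kappa>\<^sup>2 + \<kappa>\<^sup>2 + 5 / 4 * \<kappa>\<^sup>2 + 5 * \<kappa>\<^sup>2"
    proof -
      have "g s / s \<le> 5 * \<kappa>\<^sup>2"
        using g_growth[OF w0 rho eta s(1)] s(1) by (simp add: field_simps)
      then show ?thesis using rho[OF s(1)] rho'[OF s(1)] eta[OF s(1)] by linarith
    qed
    finally have "\<Psi>' s \<le> 0" by simp
    then show "\<exists>y. (\<Psi> has_real_derivative y) (at s) \<and> y \<le> 0" using D by blast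
  qed
  also have "\<Psi> 0 = 0" using w0 by (simp add: \<Psi>_def g_def sqs_def)
  finally have "(\<Sum>i\<in>I. t * ((w t i)\<^sup>2 / 2 - rho t i * w t i)) \<le> 37 / 4 * \<kappa>\<^sup>2 * t"
    using g_nonneg[of t] unfolding \<Psi>_def by linarith
  then have "t * (\<Sum>i\<in>I. (w t i)\<^sup>2 / 2 - rho t i * w t i) \<le> t * (37 / 4 * \<kappa>\<^sup>2)"
    by (simp add: sum_distrib_left algebra_simps)
  then have 1: "(\<Sum>i\<in>I. (w t i)\<^sup>2 / 2 - rho t i * w t i) \<le> 37 / 4 * \<kappa>\<^sup>2" using t by simp
  have "(\<Sum>i\<in>I. (w t i)\<^sup>2 / 4 - (rho t i)\<^sup>2) \<le> (\<Sum>i\<in>I. (w t i)\<^sup>2 / 2 - rho t i * w t i)"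
  proof (rule sum_mono)
    fix i show "(w t i)\<^sup>2 / 4 - (rho t i)\<^sup>2 \<le> (w t i)\<^sup>2 / 2 - rho t i * w t i"
      using zero_le_power2[of "w t i / 2 - rho t i"] by (simp add: power2_eq_square algebra_simps)
  qed
  then have "sqs I (w t) / 4 - sqs I (rho t) \<le> 37 / 4 * \<kappa>\<^sup>2"
    using 1 unfolding sqs_def by (simp add: sum_subtractf sum_divide_distrib)
  then show ?thesis using rho[OF t] by simp
qed

lemma w_cont: "i \<in> I \<Longrightarrow> continuous_on A (\<lambda>t. w t i)"
  by (auto intro!: continuous_at_imp_continuous_on DERIV_isCont[OF dw])

lemma W_cont: "continuous_on A (\<lambda>t. sqs I (w t))"
  unfolding sqs_def by (intro continuous_intros w_cont)

text \<open>
  Integrating the first energy inequality gives \<open>g + \<integral>\<parallel>w\<parallel>\<^sup>2 \<le> g(s) + \<integral>\<parallel>\<rho>\<parallel>\<^sup>2 + 2\<integral>\<parallel>\<eta>\<parallel>\<surd>g\<close>. Bounding \<open>\<surd>g\<close> by its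
  maximum \<open>M\<close> over the interval and evaluating at a maximum point yields a quadratic inequality for \<open>M\<close>.
  The data enter through majorants \<open>B'\<close> and \<open>L'\<close> with known antiderivatives; the majorants themselves may be
  singular at the endpoints.
\<close>

lemma integrated_bound:
  assumes st: "s \<le> T"
    and B_cont: "continuous_on {s..T} B" and L_cont: "continuous_on {s..T} L"
    and B': "\<And>t. s < t \<Longrightarrow> t < T \<Longrightarrow> (B has_real_derivative B' t) (at t)"
    and L': "\<And>t. s < t \<Longrightarrow> t < T \<Longrightarrow> (L has_real_derivative L' t) (at t)"
    and rho: "\<And>t. s < t \<Longrightarrow> t < T \<Longrightarrow> sqs I (rho t) \<le> B' t"
    and eta: "\<And>t. s < t \<Longrightarrow> t < T \<Longrightarrow> sqrt (sqs I (eta t)) \<le> L' t"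
  shows "g T \<le> 2 * (g s + (B T - B s)) + 4 * (L T - L s)\<^sup>2"
    and "integral {s..T} (\<lambda>t. sqs I (w t)) \<le> 3 * (g s + (B T - B s)) + 5 * (L T - L s)\<^sup>2"
proof -
  obtain t0 where t0: "t0 \<in> {s..T}" and max: "\<And>t. t \<in> {s..T} \<Longrightarrow> g t \<le> g t0"
    using continuous_attains_sup[OF _ _ g_cont, of "{s..T}"] st by auto
  define M where "M = sqrt (g t0)"
  have M: "M \<ge> 0" "M\<^sup>2 = g t0" by (auto simp: M_def)
  define g' where "g' t = (\<Sum>i\<in>I. 2 * (w t i * (rho t i - w t i)) + 2 * (eta t i * (w t i / mu i)))" for t
  have g'_le: "g' t \<le> - sqs I (w t) + B' t + 2 * M * L' t" if t: "s < t" "t < T" for t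
  proof -
    have "g' t = (\<Sum>i\<in>I. 2 * (w t i * (rho t i - w t i))) + 2 * (\<Sum>i\<in>I. eta t i * (w t i / mu i))"
      by (simp add: g'_def sum.distrib sum_distrib_left)
    also have "(\<Sum>i\<in>I. 2 * (w t i * (rho t i - w t i))) \<le> (\<Sum>i\<in>I. (rho t i)\<^sup>2 - (w t i)\<^sup>2)"
    proof (rule sum_mono)
      fix i show "2 * (w t i * (rho t i - w t i)) \<le> (rho t i)\<^sup>2 - (w t i)\<^sup>2"
        using zero_le_power2[of "w t i - rho t i"] by (simp add: power2_eq_square algebra_simps)
    qed
    also have "\<dots> = sqs I (rho t) - sqs I (w t)" by (simp add: sqs_def sum_subtractf)
    also have "(\<Sum>i\<in>I. eta t i * (w t i / mu i)) \<le> sqrt (sqs I (eta t)) * sqrt (g t)"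
      unfolding g_def by (rule sum_mult_le_sqrt_sqs)
    also have "\<dots> \<le> L' t * M"
      unfolding M_def using max[of t] t eta[OF t] order_trans[OF real_sqrt_ge_zero[OF sqs_nonneg] eta[OF t]]
      by (intro mult_mono) auto
    finally show ?thesis using rho[OF t] by (simp add: algebra_simps)
  qed
  have sub: "g u + integral {s..u} (\<lambda>t. sqs I (w t)) \<le> g s + (B u - B s) + 2 * M * (L u - L s)"
    if u: "s \<le> u" "u \<le> T" for u
  proof -
    define \<Phi> where "\<Phi> x = g x + integral {s..x} (\<lambda>t. sqs I (w t)) - B x - 2 * M * L x" for x
    have "\<Phi> u \<le> \<Phi> s"
    proof (rule DERIV_nonpos_imp_decreasing_open[OF u(1)])
      have "continuous_on {s..u} (\<lambda>x. integral {s..x} (\<lambda>t. sqs I (w t)))"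
        by (intro indefinite_integral_continuous_1 integrable_continuous_real W_cont)
      then show "continuous_on {s..u} \<Phi>"
        unfolding \<Phi>_def[abs_def] using u
        by (intro continuous_intros continuous_on_subset[OF B_cont] continuous_on_subset[OF L_cont] g_cont) auto
      fix x assume x: "s < x" "x < u"
      then have x': "x < T" using u by simp
      have "((\<lambda>x. integral {s..x} (\<lambda>t. sqs I (w t))) has_real_derivative sqs I (w x)) (at x within {s..u})"
        by (rule integral_has_real_derivative[OF W_cont]) (use x in auto)
      then have "((\<lambda>x. integral {s..x} (\<lambda>t. sqs I (w t))) has_real_derivative sqs I (w x)) (at x)"
        using x by (simp add: at_within_Icc_at)
      then have "(\<Phi> has_real_derivative g' x + sqs I (w x) - B' x - 2 * M * L' x) (at x)"
        unfolding \<Phi>_def[abs_def] g'_def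
        by (intro DERIV_diff DERIV_add g_deriv B' DERIV_cmult L' x x')
      moreover have "g' x + sqs I (w x) - B' x - 2 * M * L' x \<le> 0"
        using g'_le[OF x(1) x'] by simp
      ultimately show "\<exists>y. (\<Phi> has_real_derivative y) (at x) \<and> y \<le> 0" by blast
    qed
    then show ?thesis by (simp add: \<Phi>_def algebra_simps)
  qed
  have BL_mono: "B a \<le> B b \<and> L a \<le> L b" if "s \<le> a" "a \<le> b" "b \<le> T" for a b
  proof
    show "B a \<le> B b"
    proof (rule DERIV_nonneg_imp_increasing_open[OF \<open>a \<le> b\<close>])
      fix x assume "a < x" "x < b"
      then show "\<exists>y. (B has_real_derivative y) (at x) \<and> 0 \<le> y"
        using that B'[of x] order_trans[OF sqs_nonneg rho[of x]] by (intro exI[of _ "B' x"]) auto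
    qed (use that in \<open>auto intro: continuous_on_subset[OF B_cont]\<close>)
    show "L a \<le> L b"
    proof (rule DERIV_nonneg_imp_increasing_open[OF \<open>a \<le> b\<close>])
      fix x assume "a < x" "x < b"
      then show "\<exists>y. (L has_real_derivative y) (at x) \<and> 0 \<le> y"
        using that L'[of x] order_trans[OF real_sqrt_ge_zero[OF sqs_nonneg] eta[of x]]
        by (intro exI[of _ "L' x"]) auto
    qed (use that in \<open>auto intro: continuous_on_subset[OF L_cont]\<close>)
  qed
  have int0: "0 \<le> integral {s..u} (\<lambda>t. sqs I (w t))" for u
    by (intro integral_nonneg integrable_continuous_real W_cont) auto
  define b l where "b = g s + (B T - B s)" and "l = L T - L s"
  have "M\<^sup>2 \<le> b + 2 * M * l"
  proof -
    have "M\<^sup>2 \<le> g s + (B t0 - B s) + 2 * M * (L t0 - L s)"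
      using sub[of t0] t0 int0[of t0] M(2) by auto
    also have "\<dots> \<le> b + 2 * M * l"
      unfolding b_def l_def using BL_mono[of t0 T] t0 M(1) by (intro add_mono mult_left_mono) auto
    finally show ?thesis .
  qed
  moreover have "2 * M * l \<le> M\<^sup>2 / 2 + 2 * l\<^sup>2"
    using zero_le_power2[of "M - 2 * l"] by (simp add: power2_eq_square algebra_simps)
  ultimately have M2: "M\<^sup>2 \<le> 2 * b + 4 * l\<^sup>2" by simp
  then show "g T \<le> 2 * (g s + (B T - B s)) + 4 * (L T - L s)\<^sup>2"
    using max[of T] st M(2) by (simp add: b_def l_def)
  have "integral {s..T} (\<lambda>t. sqs I (w t)) \<le> b + 2 * M * l"
    using sub[OF st order_refl] g_nonneg[of T] unfolding b_def l_def by linarith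
  also have "2 * M * l \<le> M\<^sup>2 + l\<^sup>2"
    using zero_le_power2[of "M - l"] by (simp add: power2_eq_square algebra_simps)
  finally show "integral {s..T} (\<lambda>t. sqs I (w t)) \<le> 3 * (g s + (B T - B s)) + 5 * (L T - L s)\<^sup>2"
    using M2 by (simp add: b_def l_def)
qed

end

section \<open>The error of the Galerkin semigroup for finite eigenfunction expansions\<close>

lemma mult_exp_neg_le_1: "x * exp (- x) \<le> (1::real)"
proof -
  have "x \<le> exp x" using exp_ge_add_one_self[of x] by linarith
  then have "x * exp (- x) \<le> exp x * exp (- x)" by (intro mult_right_mono) auto
  then show ?thesis by (simp flip: exp_add)
qed

lemma power2_mult_exp_neg_le_1: "x \<ge> 0 \<Longrightarrow> x\<^sup>2 * exp (- x) \<le> (1::real)"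
proof -
  assume x: "x \<ge> 0"
  have "(x / 2 * exp (- (x / 2)))\<^sup>2 \<le> (1 / 2)\<^sup>2"
  proof (rule power_mono)
    have "y * exp (- y) \<le> 1 / 2" if "y \<ge> 0" for y :: real
    proof -
      have "1 + y + y\<^sup>2 / 2 \<le> exp y" using exp_lower_Taylor_quadratic[OF that] by simp
      moreover have "2 * y \<le> 1 + y + y\<^sup>2 / 2"
        using zero_le_power2[of "y - 1"] by (simp add: power2_eq_square algebra_simps)
      ultimately have "2 * y * exp (- y) \<le> exp y * exp (- y)" by (intro mult_right_mono) auto
      then show ?thesis by (simp flip: exp_add)
    qed
    from this[of "x / 2"] show "x / 2 * exp (- (x / 2)) \<le> 1 / 2" using x by simp
  qed (use x in auto)
  moreover have "(exp (- (x / 2)))\<^sup>2 = exp (- x)" by (simp add: power2_eq_square flip: exp_add)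
  then have "(x / 2 * exp (- (x / 2)))\<^sup>2 = x\<^sup>2 * exp (- x) / 4"
    by (simp only: power_mult_distrib power_divide) simp
  ultimately show ?thesis by (simp add: power_divide)
qed

lemma one_minus_exp_neg_squared_le_sqrt:
  assumes "x \<ge> 0" shows "(1 - exp (- x))\<^sup>2 \<le> sqrt (x::real)"
proof -
  define y where "y = 1 - exp (- x)"
  have y: "0 \<le> y" "y \<le> 1" "y \<le> x" using assms exp_ge_add_one_self[of "- x"] by (auto simp: y_def)
  have "y\<^sup>2 \<le> y" using y by (simp add: power2_eq_square mult_left_le)
  moreover have "y \<le> sqrt x"
  proof (rule real_le_rsqrt)
    show "y\<^sup>2 \<le> x" using \<open>y\<^sup>2 \<le> y\<close> y(3) by simp
  qed
  ultimately show ?thesis unfolding y_def[symmetric] by simp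
qed

text \<open>
  The data that remain of the problem when only finitely many eigenfunctions \<open>\<phi>\<^sub>j\<close>, \<open>j \<in> J\<close>, and the discrete
  eigenfunctions \<open>\<psi>\<^sub>i\<close>, \<open>i \<in> I\<close>, of positive eigenvalue are considered; \<open>m\<close> is the matrix of inner products
  \<open>(\<psi>\<^sub>i, \<phi>\<^sub>j)\<close>. Bessel's inequality is required in \<open>L\<^sub>2\<close> and, for the functions \<open>\<phi>\<^sub>j\<close>, in the energy space. The left side of the Ritz
  estimate is \<open>\<parallel>R\<^sub>hv - v\<parallel>\<^sup>2\<close>, split by Pythagoras into the part in the discrete space and the part
  orthogonal to it.
\<close>

locale galerkin =
  fixes I J :: "nat set" and lam mu :: "nat \<Rightarrow> real" and m :: "nat \<Rightarrow> nat \<Rightarrow> real"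
    and K h R l1 :: real
  assumes l1: "0 < l1" and lam_ge: "\<And>j. j \<in> J \<Longrightarrow> l1 \<le> lam j"
    and mu_pos: "\<And>i. i \<in> I \<Longrightarrow> 0 < mu i"
    and h_pos: "0 < h" and K_nonneg: "0 \<le> K" and R2: "2 \<le> R"
    and bessel: "\<And>a. sqs I (\<lambda>i. \<Sum>j\<in>J. m i j * a j) \<le> sqs J a"
    and energy: "\<And>x. (\<Sum>j\<in>J. lam j * (\<Sum>i\<in>I. m i j * x i)\<^sup>2) \<le> (\<Sum>i\<in>I. mu i * (x i)\<^sup>2)"
    and ritz: "\<And>\<beta> a. 1 \<le> \<beta> \<Longrightarrow> \<beta> \<le> R \<Longrightarrow>
      sqs I (\<lambda>i. (\<Sum>j\<in>J. m i j * (lam j * a j)) / mu i - (\<Sum>j\<in>J. m i j * a j))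
        + (sqs J a - sqs I (\<lambda>i. \<Sum>j\<in>J. m i j * a j))
      \<le> (K * h powr \<beta>)\<^sup>2 * (\<Sum>j\<in>J. lam j powr \<beta> * (a j)\<^sup>2)"
begin

text \<open>
  In coordinates: \<open>P\<close> is the orthogonal projector onto the discrete space, \<open>evolve t\<close> is \<open>E(t)\<close>,
  \<open>defect a\<close> is \<open>\<parallel>v - P\<^sub>hv\<parallel>\<^sup>2\<close>, \<open>ritz_residual\<close> is \<open>P\<^sub>h(R\<^sub>h - 1)\<close>, \<open>w\<close> is \<open>E\<^sub>h(t)P\<^sub>hv - P\<^sub>hE(t)v\<close>, and
  \<open>err\<close> is \<open>\<parallel>F\<^sub>h(t)v\<parallel>\<^sup>2\<close>, again split by Pythagoras.
\<close>

definition P :: "(nat \<Rightarrow> real) \<Rightarrow> nat \<Rightarrow> real" where "P a i = (\<Sum>j\<in>J. m i j * a j)"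
definition seminorm_sq :: "real \<Rightarrow> (nat \<Rightarrow> real) \<Rightarrow> real" where "seminorm_sq s a = (\<Sum>j\<in>J. lam j powr s * (a j)\<^sup>2)"
definition evolve :: "real \<Rightarrow> (nat \<Rightarrow> real) \<Rightarrow> nat \<Rightarrow> real" where "evolve t a j = exp (- t * (lam j)\<^sup>2) * a j"
definition defect :: "(nat \<Rightarrow> real) \<Rightarrow> real" where "defect a = sqs J a - sqs I (P a)"
definition ritz_residual :: "(nat \<Rightarrow> real) \<Rightarrow> nat \<Rightarrow> real" where "ritz_residual a i = P (\<lambda>j. lam j * a j) i / mu i - P a i"
definition w :: "(nat \<Rightarrow> real) \<Rightarrow> real \<Rightarrow> nat \<Rightarrow> real" where
  "w a t i = exp (- t * (mu i)\<^sup>2) * P a i - P (evolve t a) i"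
definition err :: "(nat \<Rightarrow> real) \<Rightarrow> real \<Rightarrow> real" where
  "err a t = sqs I (w a t) + defect (evolve t a)"

lemma lam_pos: "j \<in> J \<Longrightarrow> 0 < lam j" using lam_ge l1 by fastforce

lemma seminorm_sq_nonneg [simp]: "0 \<le> seminorm_sq s a" by (simp add: seminorm_sq_def sum_nonneg)

lemma defect_nonneg [simp]: "0 \<le> defect a"
  using bessel[of a] by (simp add: defect_def P_def[abs_def])

lemma ritz_residual_defect: "1 \<le> \<beta> \<Longrightarrow> \<beta> \<le> R \<Longrightarrow> sqs I (ritz_residual a) + defect a \<le> (K * h powr \<beta>)\<^sup>2 * seminorm_sq \<beta> a"
  using ritz[of \<beta> a] by (simp add: defect_def P_def[abs_def] seminorm_sq_def ritz_residual_def[abs_def])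

lemma ritz_residual_le: "1 \<le> \<beta> \<Longrightarrow> \<beta> \<le> R \<Longrightarrow> sqs I (ritz_residual a) \<le> (K * h powr \<beta>)\<^sup>2 * seminorm_sq \<beta> a"
  using ritz_residual_defect[of \<beta> a] defect_nonneg[of a] by linarith

lemma defect_le: "1 \<le> \<beta> \<Longrightarrow> \<beta> \<le> R \<Longrightarrow> defect a \<le> (K * h powr \<beta>)\<^sup>2 * seminorm_sq \<beta> a"
  using ritz_residual_defect[of \<beta> a] sqs_nonneg[of I "ritz_residual a"] by linarith

lemma seminorm_sq_le:
  assumes "\<And>j. j \<in> J \<Longrightarrow> lam j powr s * (b j)\<^sup>2 \<le> M * (lam j powr s' * (a j)\<^sup>2)"
  shows "seminorm_sq s b \<le> M * seminorm_sq s' a"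
  unfolding seminorm_sq_def sum_distrib_left by (intro sum_mono assms)

lemma P_deriv: "((\<lambda>t. P (evolve t a) i) has_real_derivative P (evolve t (\<lambda>j. - (lam j)\<^sup>2 * a j)) i) (at t)"
  unfolding P_def evolve_def
  by (rule DERIV_sum) (auto intro!: derivative_eq_intros)

lemma ritz_residual_deriv: "((\<lambda>t. ritz_residual (evolve t a) i) has_real_derivative ritz_residual (evolve t (\<lambda>j. - (lam j)\<^sup>2 * a j)) i) (at t)"
proof -
  have *: "(\<lambda>j. lam j * evolve t a j) = evolve t (\<lambda>j. lam j * a j)" for t a by (auto simp: evolve_def)
  show ?thesis
    unfolding ritz_residual_def * 
    using DERIV_diff[OF DERIV_cdivide[OF P_deriv[of "\<lambda>j. lam j * a j" i t], of "mu i"] P_deriv[of a i t]]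
    by (simp add: ac_simps)
qed

lemma P_uminus: "P (\<lambda>j. - b j) i = - P b i" by (simp add: P_def sum_negf)

text \<open>
  The identity \<open>\<lambda>\<^sup>2 - \<mu>\<^sup>2 = \<mu>\<^sup>2 (\<lambda>/\<mu> - 1) + \<mu> (\<lambda>/\<mu> - 1) \<lambda>\<close> rewrites the residual of \<open>P\<^sub>hE(t)v\<close> in the
  discrete equation by Ritz residuals of \<open>u\<close> and of \<open>Au\<close>.
\<close>

sublocale damped: damped_system I mu "w a" "\<lambda>t. ritz_residual (evolve t a)" "\<lambda>t. ritz_residual (evolve t (\<lambda>j. lam j * a j))" for a
proof
  fix i t assume i: "i \<in> I"
  have e: "evolve t (\<lambda>j. - (lam j)\<^sup>2 * a j) = (\<lambda>j. - ((lam j)\<^sup>2 * evolve t a j))"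
    "(\<lambda>j. lam j * evolve t (\<lambda>j. lam j * a j) j) = (\<lambda>j. (lam j)\<^sup>2 * evolve t a j)"
    "(\<lambda>j. lam j * evolve t a j) = evolve t (\<lambda>j. lam j * a j)"
    by (auto simp: evolve_def power2_eq_square)
  have "((\<lambda>t. exp (- t * (mu i)\<^sup>2) * P a i) has_real_derivative - (mu i)\<^sup>2 * exp (- t * (mu i)\<^sup>2) * P a i) (at t)"
    by (auto intro!: derivative_eq_intros)
  from DERIV_diff[OF this P_deriv[of a i t]]
  have "((\<lambda>t. w a t i) has_real_derivative
      - (mu i)\<^sup>2 * exp (- t * (mu i)\<^sup>2) * P a i + P (\<lambda>j. (lam j)\<^sup>2 * evolve t a j) i) (at t)"
    unfolding w_def e P_uminus by simp
  moreover have "mu i * ritz_residual (evolve t (\<lambda>j. lam j * a j)) i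
      = P (\<lambda>j. (lam j)\<^sup>2 * evolve t a j) i - mu i * P (evolve t (\<lambda>j. lam j * a j)) i"
    unfolding ritz_residual_def e using mu_pos[OF i] by (simp add: right_diff_distrib)
  moreover have "(mu i)\<^sup>2 * ritz_residual (evolve t a) i = mu i * P (evolve t (\<lambda>j. lam j * a j)) i - (mu i)\<^sup>2 * P (evolve t a) i"
    unfolding ritz_residual_def e using mu_pos[OF i] by (simp add: right_diff_distrib power2_eq_square)
  ultimately show "((\<lambda>t. w a t i) has_real_derivative
      (mu i)\<^sup>2 * (ritz_residual (evolve t a) i - w a t i) + mu i * ritz_residual (evolve t (\<lambda>j. lam j * a j)) i) (at t)"
    unfolding w_def by (simp add: algebra_simps)
qed (rule mu_pos)

lemma evolve_0 [simp]: "evolve 0 a = a" by (auto simp: evolve_def)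

lemma w_0 [simp]: "w a 0 i = 0" by (simp add: w_def)

lemma evolve_sq_le: "t \<ge> 0 \<Longrightarrow> (evolve t a j)\<^sup>2 \<le> (a j)\<^sup>2"
  by (auto simp: evolve_def power_mult_distrib intro!: mult_left_le_one_le power_le_one)

lemma seminorm_sq_mono: "(\<And>j. j \<in> J \<Longrightarrow> (b j)\<^sup>2 \<le> (a j)\<^sup>2) \<Longrightarrow> seminorm_sq s b \<le> seminorm_sq s a"
  unfolding seminorm_sq_def by (intro sum_mono mult_left_mono) auto

lemma seminorm_sq_evolve_le: "t \<ge> 0 \<Longrightarrow> seminorm_sq s (evolve t a) \<le> seminorm_sq s a"
  by (intro seminorm_sq_mono evolve_sq_le)

text \<open>
  Differentiating \<open>u = E(t)v\<close> in time and applying \<open>A\<close> cost \<open>t\<^sup>-\<^sup>1\<close> and \<open>t\<^sup>-\<^sup>1\<^sup>/\<^sup>2\<close> in every seminorm, since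
  \<open>x e\<^sup>-\<^sup>x \<le> 1\<close> for \<open>x = t\<lambda>\<^sup>2\<close>. These are exactly the bounds required by the pointwise energy estimate.
\<close>

theorem smooth_data_bound:
  assumes \<beta>: "1 \<le> \<beta>" "\<beta> \<le> R" and t: "t \<ge> 0"
  shows "err a t \<le> 42 * ((K * h powr \<beta>)\<^sup>2 * seminorm_sq \<beta> a)"
proof (cases "t = 0")
  case True
  then have "err a t = defect a" by (simp add: err_def sqs_def)
  moreover have "0 \<le> (K * h powr \<beta>)\<^sup>2 * seminorm_sq \<beta> a" by simp
  ultimately show ?thesis using defect_le[OF \<beta>, of a] by linarith
next
  case False
  define \<kappa> where "\<kappa> = sqrt ((K * h powr \<beta>)\<^sup>2 * seminorm_sq \<beta> a)"
  have \<kappa>2: "\<kappa>\<^sup>2 = (K * h powr \<beta>)\<^sup>2 * seminorm_sq \<beta> a" by (simp add: \<kappa>_def)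
  have rd_bd: "c * sqs I (ritz_residual b) \<le> \<kappa>\<^sup>2"
    if "c \<ge> 0" "\<And>j. j \<in> J \<Longrightarrow> c * (b j)\<^sup>2 \<le> (a j)\<^sup>2" for b c
  proof -
    have "c * sqs I (ritz_residual b) \<le> c * ((K * h powr \<beta>)\<^sup>2 * seminorm_sq \<beta> b)"
      by (intro mult_left_mono ritz_residual_le \<beta> that)
    also have "\<dots> = (K * h powr \<beta>)\<^sup>2 * (c * seminorm_sq \<beta> b)" by simp
    also have "c * seminorm_sq \<beta> b \<le> seminorm_sq \<beta> a"
      unfolding seminorm_sq_def sum_distrib_left
    proof (rule sum_mono)
      fix j assume "j \<in> J"
      have "lam j powr \<beta> * (c * (b j)\<^sup>2) \<le> lam j powr \<beta> * (a j)\<^sup>2"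
        by (intro mult_left_mono that \<open>j \<in> J\<close>) auto
      then show "c * (lam j powr \<beta> * (b j)\<^sup>2) \<le> lam j powr \<beta> * (a j)\<^sup>2" by (simp add: ac_simps)
    qed
    finally show ?thesis by (simp add: \<kappa>2 mult_left_mono)
  qed
  have "sqs I (w a t) \<le> 41 * \<kappa>\<^sup>2"
  proof (rule damped.pointwise_bound[where rho' = "\<lambda>t. ritz_residual (evolve t (\<lambda>j. - (lam j)\<^sup>2 * a j))"])
    fix t :: real assume t: "t > 0"
    show "sqs I (ritz_residual (evolve t a)) \<le> \<kappa>\<^sup>2"
      using rd_bd[of 1 "evolve t a"] evolve_sq_le[of t a] t by simp
    show "t\<^sup>2 * sqs I (ritz_residual (evolve t (\<lambda>j. - (lam j)\<^sup>2 * a j))) \<le> \<kappa>\<^sup>2"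
    proof (rule rd_bd)
      fix j
      have "0 \<le> t * (lam j)\<^sup>2 * exp (- (t * (lam j)\<^sup>2))" using t by simp
      then have "(t * (lam j)\<^sup>2 * exp (- (t * (lam j)\<^sup>2)))\<^sup>2 \<le> 1"
        using mult_exp_neg_le_1[of "t * (lam j)\<^sup>2"] by (intro power_le_one) auto
      then have "(t * (lam j)\<^sup>2 * exp (- (t * (lam j)\<^sup>2)))\<^sup>2 * (a j)\<^sup>2 \<le> 1 * (a j)\<^sup>2"
        by (intro mult_right_mono) auto
      then show "t\<^sup>2 * (evolve t (\<lambda>j. - (lam j)\<^sup>2 * a j) j)\<^sup>2 \<le> (a j)\<^sup>2"
        by (simp add: evolve_def power_mult_distrib ac_simps)
    qed simp
    show "t * sqs I (ritz_residual (evolve t (\<lambda>j. lam j * a j))) \<le> \<kappa>\<^sup>2"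
    proof (rule rd_bd)
      fix j
      have "t * (lam j)\<^sup>2 * exp (- (t * (lam j)\<^sup>2)) * exp (- (t * (lam j)\<^sup>2)) \<le> 1 * 1"
        using mult_exp_neg_le_1[of "t * (lam j)\<^sup>2"] t by (intro mult_mono) auto
      then have "t * (lam j)\<^sup>2 * exp (- (t * (lam j)\<^sup>2)) * exp (- (t * (lam j)\<^sup>2)) * (a j)\<^sup>2 \<le> 1 * (a j)\<^sup>2"
        by (intro mult_right_mono) auto
      then show "t * (evolve t (\<lambda>j. lam j * a j) j)\<^sup>2 \<le> (a j)\<^sup>2"
        by (simp add: evolve_def power_mult_distrib power2_eq_square ac_simps)
    qed (use t in simp)
  qed (use ritz_residual_deriv t False in auto)
  moreover have "defect (evolve t a) \<le> \<kappa>\<^sup>2"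
    using defect_le[OF \<beta>, of "evolve t a"] seminorm_sq_evolve_le[OF t, of \<beta> a]
    unfolding \<kappa>2 by (meson mult_left_mono order_trans zero_le_power2)
  ultimately show ?thesis unfolding err_def \<kappa>2 by linarith
qed

lemma sqs_w_cont: "continuous_on A (\<lambda>t. sqs I (w a t))"
  by (rule damped.W_cont)

text \<open>
  An antiderivative of the bound for \<open>\<parallel>\<rho>\<parallel>\<^sup>2\<close>: the \<open>\<beta>\<close>-seminorm of \<open>u\<close> is, up to a factor, minus
  the derivative of its \<open>(\<beta> - 2)\<close>-seminorm, so no power of \<open>h\<close> or logarithm is lost in this term.
\<close>

definition B :: "real \<Rightarrow> (nat \<Rightarrow> real) \<Rightarrow> real \<Rightarrow> real" where
  "B \<beta> a t = - ((K * h powr \<beta>)\<^sup>2 / 2 * seminorm_sq (\<beta> - 2) (evolve t a))"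

lemma B_deriv: "(B \<beta> a has_real_derivative (K * h powr \<beta>)\<^sup>2 * seminorm_sq \<beta> (evolve t a)) (at t)"
proof -
  have "((\<lambda>t. lam j powr (\<beta> - 2) * (evolve t a j)\<^sup>2) has_real_derivative - 2 * (lam j powr \<beta> * (evolve t a j)\<^sup>2)) (at t)"
    if "j \<in> J" for j
  proof -
    have "(lam j)\<^sup>2 = lam j powr 2" using lam_pos[OF that] by simp
    then have "lam j powr \<beta> = lam j powr (\<beta> - 2) * (lam j)\<^sup>2" by (simp flip: powr_add)
    then show ?thesis
      unfolding evolve_def by (auto intro!: derivative_eq_intros simp: power2_eq_square)
  qed
  then have "((\<lambda>t. seminorm_sq (\<beta> - 2) (evolve t a)) has_real_derivative (\<Sum>j\<in>J. - 2 * (lam j powr \<beta> * (evolve t a j)\<^sup>2))) (at t)"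
    unfolding seminorm_sq_def by (rule DERIV_sum)
  from DERIV_minus[OF DERIV_cmult[OF this, of "(K * h powr \<beta>)\<^sup>2 / 2"]] show ?thesis
    unfolding B_def[abs_def]
    by (rule DERIV_cong) (simp add: seminorm_sq_def sum_negf flip: sum_distrib_left)
qed

lemma B_cont: "continuous_on A (B \<beta> a)"
  by (auto intro!: continuous_at_imp_continuous_on DERIV_isCont[OF B_deriv])

lemma B_diff: "s \<ge> 0 \<Longrightarrow> B \<beta> a T - B \<beta> a s \<le> (K * h powr \<beta>)\<^sup>2 / 2 * seminorm_sq (\<beta> - 2) a"
proof -
  assume s: "s \<ge> 0"
  have "(K * h powr \<beta>)\<^sup>2 / 2 * seminorm_sq (\<beta> - 2) (evolve s a) \<le> (K * h powr \<beta>)\<^sup>2 / 2 * seminorm_sq (\<beta> - 2) a"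
    by (intro mult_left_mono seminorm_sq_evolve_le s) auto
  moreover have "0 \<le> (K * h powr \<beta>)\<^sup>2 / 2 * seminorm_sq (\<beta> - 2) (evolve T a)" by simp
  ultimately show ?thesis unfolding B_def by linarith
qed

text \<open>
  One bound serves small and large times: near zero the factor behaves like \<open>1/t\<close>, and at infinity
  the spectral gap \<open>l1\<close> improves it to \<open>1/t\<^sup>2\<close>. The antiderivative \<open>ln t - ln (1 + t)\<close> of \<open>1/(t(1 + t))\<close>
  is bounded at infinity, so the estimates do not depend on the final time.
\<close>

lemma growth_factor_bound:
  assumes "j \<in> J" "t > 0"
  shows "(lam j)\<^sup>2 * exp (- (t * (lam j)\<^sup>2)) \<le> (1 + 1 / l1\<^sup>2) / (t * (1 + t))"
proof -
  define x where "x = t * (lam j)\<^sup>2"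
  have x: "x > 0" using assms lam_pos[OF assms(1)] by (simp add: x_def)
  have "t * (1 + t) * ((lam j)\<^sup>2 * exp (- x)) = x * exp (- x) + x\<^sup>2 * exp (- x) / (lam j)\<^sup>2"
    using lam_pos[OF assms(1)] by (simp add: x_def field_simps power2_eq_square)
  also have "\<dots> \<le> 1 + 1 / l1\<^sup>2"
  proof (intro add_mono mult_exp_neg_le_1 frac_le)
    show "x\<^sup>2 * exp (- x) \<le> 1" using power2_mult_exp_neg_le_1[of x] x by simp
    show "l1\<^sup>2 \<le> (lam j)\<^sup>2" using lam_ge[OF assms(1)] l1 by (intro power_mono) auto
  qed (use l1 in auto)
  finally show ?thesis
    using assms unfolding x_def by (simp add: pos_le_divide_eq mult.commute)
qed

lemma sqrt_sqs_ritz_residual_le: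
  assumes "1 \<le> \<beta>" "\<beta> \<le> R" "0 \<le> c" "seminorm_sq \<beta> b \<le> c\<^sup>2 * N"
  shows "sqrt (sqs I (ritz_residual b)) \<le> K * h powr \<beta> * c * sqrt N"
proof -
  have "sqs I (ritz_residual b) \<le> (K * h powr \<beta>)\<^sup>2 * (c\<^sup>2 * N)"
    using ritz_residual_le[OF assms(1,2), of b] mult_left_mono[OF assms(4), of "(K * h powr \<beta>)\<^sup>2"] by simp
  then have "sqrt (sqs I (ritz_residual b)) \<le> sqrt ((K * h powr \<beta>)\<^sup>2 * (c\<^sup>2 * N))"
    by (rule real_sqrt_le_mono)
  also have "\<dots> = K * h powr \<beta> * c * sqrt N"
    using K_nonneg assms(3) by (simp add: real_sqrt_mult)
  finally show ?thesis .
qed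

text \<open>
  The only place where the logarithm arises: \<open>1/(t(1 + t))\<close> integrates to at most \<open>5 |ln h|\<close> over
  \<open>[h\<^sup>4, T]\<close>. The restriction \<open>h \<le> e\<^sup>-\<^sup>1\<close> makes \<open>|ln h| \<ge> 1\<close>, so bounded contributions can be absorbed.
\<close>

lemma late_time_bound:
  assumes \<beta>: "1 \<le> \<beta>" "\<beta> \<le> R" and h: "h \<le> exp (- 1)" and T: "T \<ge> 1"
  shows "integral {h^4..T} (\<lambda>t. sqs I (w a t)) \<le> 3 * damped.g a (h^4)
    + (2 + 125 * (1 + 1 / l1\<^sup>2)\<^sup>2) * K\<^sup>2 * ((h powr \<beta> * ln h)\<^sup>2 * seminorm_sq (\<beta> - 2) a)"
proof -
  define c0 where "c0 = 1 + 1 / l1\<^sup>2"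
  define N where "N = seminorm_sq (\<beta> - 2) a"
  define \<kappa> where "\<kappa> = K * h powr \<beta> * sqrt N"
  define L where "L t = c0 * \<kappa> * (ln t - ln (1 + t))" for t
  define \<delta> where "\<delta> = h^4"
  have c0: "c0 \<ge> 0" by (simp add: c0_def)
  have N: "N \<ge> 0" by (simp add: N_def)
  have \<kappa>: "\<kappa> \<ge> 0" "\<kappa>\<^sup>2 = (K * h powr \<beta>)\<^sup>2 * N"
    using K_nonneg N by (auto simp: \<kappa>_def power_mult_distrib)
  have h1: "h \<le> 1" using h by (simp add: order_trans[OF h])
  have \<delta>: "0 < \<delta>" "\<delta> \<le> 1" using h_pos h1 by (auto simp: \<delta>_def power_le_one)
  have "ln h \<le> ln (exp (- 1))" using h h_pos by (subst ln_le_cancel_iff) auto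
  then have ell: "\<bar>ln h\<bar> \<ge> 1" "ln h \<le> -1" by auto
  have *: "integral {\<delta>..T} (\<lambda>t. sqs I (w a t)) \<le> 3 * (damped.g a \<delta> + (B \<beta> a T - B \<beta> a \<delta>)) + 5 * (L T - L \<delta>)\<^sup>2"
  proof (rule damped.integrated_bound(2)[where L' = "\<lambda>t. K * h powr \<beta> * (c0 / (t * (1 + t))) * sqrt N"])
    show "\<delta> \<le> T" using \<delta> T by simp
    show "continuous_on {\<delta>..T} L" unfolding L_def using \<delta> by (auto intro!: continuous_intros)
    fix t assume t: "\<delta> < t" "t < T"
    then have t0: "t > 0" using \<delta> by simp
    show "(B \<beta> a has_real_derivative (K * h powr \<beta>)\<^sup>2 * seminorm_sq \<beta> (evolve t a)) (at t)" by (rule B_deriv)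
    show "(L has_real_derivative K * h powr \<beta> * (c0 / (t * (1 + t))) * sqrt N) (at t)"
      unfolding L_def[abs_def] \<kappa>_def using t0 by (auto intro!: derivative_eq_intros simp: field_simps)
    show "sqs I (ritz_residual (evolve t a)) \<le> (K * h powr \<beta>)\<^sup>2 * seminorm_sq \<beta> (evolve t a)" by (rule ritz_residual_le[OF \<beta>])
    show "sqrt (sqs I (ritz_residual (evolve t (\<lambda>j. lam j * a j)))) \<le> K * h powr \<beta> * (c0 / (t * (1 + t))) * sqrt N"
    proof (rule sqrt_sqs_ritz_residual_le[OF \<beta>])
      show "0 \<le> c0 / (t * (1 + t))" using c0 t0 by simp
      show "seminorm_sq \<beta> (evolve t (\<lambda>j. lam j * a j)) \<le> (c0 / (t * (1 + t)))\<^sup>2 * N"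
        unfolding N_def
      proof (rule seminorm_sq_le)
        fix j assume j: "j \<in> J"
        have "(lam j)\<^sup>2 = lam j powr 2" using lam_pos[OF j] by simp
        then have "lam j powr \<beta> = lam j powr (\<beta> - 2) * (lam j)\<^sup>2" by (simp flip: powr_add)
        then have "lam j powr \<beta> * (evolve t (\<lambda>j. lam j * a j) j)\<^sup>2
           = ((lam j)\<^sup>2 * exp (- (t * (lam j)\<^sup>2)))\<^sup>2 * (lam j powr (\<beta> - 2) * (a j)\<^sup>2)"
          by (simp add: evolve_def power_mult_distrib ac_simps power2_eq_square)
        also have "\<dots> \<le> (c0 / (t * (1 + t)))\<^sup>2 * (lam j powr (\<beta> - 2) * (a j)\<^sup>2)"
          unfolding c0_def using growth_factor_bound[OF j t0] by (intro mult_right_mono power_mono) auto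
        finally show "lam j powr \<beta> * (evolve t (\<lambda>j. lam j * a j) j)\<^sup>2
           \<le> (c0 / (t * (1 + t)))\<^sup>2 * (lam j powr (\<beta> - 2) * (a j)\<^sup>2)" .
      qed
    qed
  qed (rule B_cont)
  have "\<bar>L T - L \<delta>\<bar> \<le> c0 * \<kappa> * (5 * \<bar>ln h\<bar>)"
  proof -
    have "ln T - ln (1 + T) - (ln \<delta> - ln (1 + \<delta>)) \<le> 5 * \<bar>ln h\<bar>"
    proof -
      have "ln T \<le> ln (1 + T)" using T by simp
      moreover have "ln \<delta> = 4 * ln h" using h_pos by (simp add: \<delta>_def ln_realpow)
      moreover have "ln (1 + \<delta>) \<le> 1" using ln_add_one_self_le_self[of \<delta>] \<delta> by simp
      ultimately show ?thesis using ell by linarith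
    qed
    moreover have "0 \<le> ln T - ln (1 + T) - (ln \<delta> - ln (1 + \<delta>))"
    proof -
      have "T * (1 + \<delta>) \<ge> \<delta> * (1 + T)" using T \<delta> by (simp add: algebra_simps)
      then have "ln (T * (1 + \<delta>)) \<ge> ln (\<delta> * (1 + T))" using T \<delta> by (subst ln_le_cancel_iff) auto
      then show ?thesis using T \<delta> by (simp add: ln_mult)
    qed
    moreover have "L T - L \<delta> = c0 * \<kappa> * (ln T - ln (1 + T) - (ln \<delta> - ln (1 + \<delta>)))"
      by (simp add: L_def algebra_simps)
    ultimately show ?thesis using c0 \<kappa>(1) by (simp add: abs_mult mult_left_mono)
  qed
  then have "\<bar>L T - L \<delta>\<bar>\<^sup>2 \<le> (c0 * \<kappa> * (5 * \<bar>ln h\<bar>))\<^sup>2" by (intro power_mono) auto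
  then have 1: "(L T - L \<delta>)\<^sup>2 \<le> 25 * (c0\<^sup>2 * (\<kappa>\<^sup>2 * (ln h)\<^sup>2))" by (simp add: power_mult_distrib ac_simps)
  have b: "B \<beta> a T - B \<beta> a \<delta> \<le> \<kappa>\<^sup>2 / 2" using B_diff[of \<delta> \<beta> a T] \<delta> by (simp add: \<kappa>(2) N_def)
  have k: "\<kappa>\<^sup>2 * 1 \<le> \<kappa>\<^sup>2 * (ln h)\<^sup>2"
    using power_mono[OF ell(1), of 2] by (intro mult_left_mono) auto
  have "integral {\<delta>..T} (\<lambda>t. sqs I (w a t)) \<le> 3 * damped.g a \<delta> + (2 + 125 * c0\<^sup>2) * (\<kappa>\<^sup>2 * (ln h)\<^sup>2)"
  proof -
    have lin: "X \<le> 3 * g + 2 * z + 125 * u"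
      if "0 \<le> z" "X \<le> 3 * (g + b) + 5 * q" "q \<le> 25 * u" "b \<le> k / 2" "k * 1 \<le> z"
      for X g b q u k z :: real using that by (simp add: algebra_simps)
    have "integral {\<delta>..T} (\<lambda>t. sqs I (w a t))
        \<le> 3 * damped.g a \<delta> + 2 * (\<kappa>\<^sup>2 * (ln h)\<^sup>2) + 125 * (c0\<^sup>2 * (\<kappa>\<^sup>2 * (ln h)\<^sup>2))"
      by (rule lin[OF _ * 1 b k]) simp
    then show ?thesis by (simp add: algebra_simps)
  qed
  also have "(2 + 125 * c0\<^sup>2) * (\<kappa>\<^sup>2 * (ln h)\<^sup>2) = (2 + 125 * c0\<^sup>2) * K\<^sup>2 * ((h powr \<beta> * ln h)\<^sup>2 * N)"
    by (simp add: \<kappa>(2) power_mult_distrib)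
  finally show ?thesis unfolding \<delta>_def c0_def N_def .
qed

text \<open>
  On the initial layer one power of \<open>h\<close> is given up in the Ritz estimate for \<open>\<eta>\<close>; this makes the singularity
  \<open>t\<^sup>-\<^sup>3\<^sup>/\<^sup>4\<close> integrable, and its integral over \<open>[0, h\<^sup>4]\<close> returns the lost power.
\<close>

lemma early_time_bound_high_order:
  fixes a :: "nat \<Rightarrow> real"
  assumes \<beta>: "2 \<le> \<beta>" "\<beta> \<le> R" and h: "h \<le> 1"
  defines "H \<equiv> (h powr \<beta>)\<^sup>2 * seminorm_sq (\<beta> - 2) a"
  shows "damped.g a (h^4) \<le> 65 * (K\<^sup>2 * H)"
    and "integral {0..h^4} (\<lambda>t. sqs I (w a t)) \<le> 82 * (K\<^sup>2 * H)"
proof -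
  define N where "N = seminorm_sq (\<beta> - 2) a"
  define \<kappa> where "\<kappa> = K * h powr (\<beta> - 1) * sqrt N"
  define L where "L t = 4 * \<kappa> * t powr (1 / 4)" for t :: real
  define \<delta> where "\<delta> = h^4"
  have \<delta>: "0 < \<delta>" using h_pos by (simp add: \<delta>_def)
  have L_cont: "continuous_on {0..\<delta>} L"
    unfolding L_def by (intro continuous_intros continuous_on_powr') auto
  have L': "(L has_real_derivative K * h powr (\<beta> - 1) * t powr (- 3 / 4) * sqrt N) (at t)" if "t > 0" for t
    unfolding L_def[abs_def] \<kappa>_def using that by (auto intro!: derivative_eq_intros)
  have rho: "sqs I (ritz_residual (evolve t a)) \<le> (K * h powr \<beta>)\<^sup>2 * seminorm_sq \<beta> (evolve t a)" for t
    using ritz_residual_le \<beta> by simp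
  have eta: "sqrt (sqs I (ritz_residual (evolve t (\<lambda>j. lam j * a j)))) \<le> K * h powr (\<beta> - 1) * t powr (- 3 / 4) * sqrt N"
    if t: "t > 0" for t
  proof (rule sqrt_sqs_ritz_residual_le)
    show "seminorm_sq (\<beta> - 1) (evolve t (\<lambda>j. lam j * a j)) \<le> (t powr (- 3 / 4))\<^sup>2 * N"
      unfolding N_def
    proof (rule seminorm_sq_le)
      fix j assume j: "j \<in> J"
      define x where "x = t * (lam j)\<^sup>2"
      have lp: "lam j > 0" using lam_pos[OF j] .
      have x: "x > 0" using t lp by (simp add: x_def)
      have "lam j powr (\<beta> - 1) * lam j powr 2 = lam j powr (\<beta> - 2) * lam j powr 3"
        by (simp only: powr_add[symmetric]) simp
      then have "lam j powr (\<beta> - 1) * (lam j)\<^sup>2 = lam j powr (\<beta> - 2) * lam j powr 3"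
        using lp by simp
      also have "lam j powr 3 = t powr (- 3 / 2) * x powr (3 / 2)"
      proof -
        have "x powr (3 / 2) = t powr (3 / 2) * (lam j powr 2) powr (3 / 2)"
          using lp t powr_realpow[OF lp, of 2] by (simp add: x_def powr_mult)
        then have "x powr (3 / 2) = t powr (3 / 2) * lam j powr 3" by (simp add: powr_powr)
        then show ?thesis using t by (simp flip: powr_add mult.assoc)
      qed
      finally have 1: "lam j powr (\<beta> - 1) * (lam j)\<^sup>2 = lam j powr (\<beta> - 2) * (t powr (- 3 / 2) * x powr (3 / 2))" .
      have 2: "x powr (3 / 2) * (exp (- x))\<^sup>2 \<le> 1"
      proof -
        have "x powr (3 / 2) * exp (- x) \<le> 1"
        proof (cases "x \<le> 1")
          case True
          then have "x powr (3 / 2) \<le> 1" using x by (simp add: powr_le1)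
          then have "x powr (3 / 2) * exp (- x) \<le> 1 * 1" using x by (intro mult_mono) auto
          then show ?thesis by simp
        next
          case False
          then have "x powr (3 / 2) \<le> x powr 2" by (intro powr_mono) auto
          then have "x powr (3 / 2) * exp (- x) \<le> x\<^sup>2 * exp (- x)" using x by (intro mult_right_mono) auto
          then show ?thesis using power2_mult_exp_neg_le_1[of x] x by linarith
        qed
        then have "x powr (3 / 2) * exp (- x) * exp (- x) \<le> 1 * 1" using x by (intro mult_mono) auto
        then show ?thesis by (simp add: power2_eq_square)
      qed
      have 3: "(t powr (- 3 / 4))\<^sup>2 = t powr (- 3 / 2)"
        using t by (simp add: power2_eq_square flip: powr_add)
      have "lam j powr (\<beta> - 1) * (evolve t (\<lambda>j. lam j * a j) j)\<^sup>2
          = (lam j powr (\<beta> - 1) * (lam j)\<^sup>2) * (exp (- x))\<^sup>2 * (a j)\<^sup>2"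
        by (simp add: evolve_def power_mult_distrib x_def)
      also have "\<dots> = (x powr (3 / 2) * (exp (- x))\<^sup>2) * (t powr (- 3 / 2) * (lam j powr (\<beta> - 2) * (a j)\<^sup>2))"
        unfolding 1 by simp
      also have "\<dots> \<le> 1 * (t powr (- 3 / 2) * (lam j powr (\<beta> - 2) * (a j)\<^sup>2))"
        by (intro mult_right_mono 2) auto
      finally show "lam j powr (\<beta> - 1) * (evolve t (\<lambda>j. lam j * a j) j)\<^sup>2
          \<le> (t powr (- 3 / 4))\<^sup>2 * (lam j powr (\<beta> - 2) * (a j)\<^sup>2)"
        unfolding 3 by simp
    qed
  qed (use \<beta> in auto)
  have "0 \<le> \<delta>" using \<delta> by simp
  note bounds = damped.integrated_bound[where a = a and s = 0, OF this B_cont L_cont B_deriv L' rho eta]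
  have B: "B \<beta> a \<delta> - B \<beta> a 0 \<le> K\<^sup>2 * H / 2"
    using B_diff[of 0 \<beta> a \<delta>] by (simp add: H_def power_mult_distrib)
  have "\<delta> powr (1 / 4) = h"
  proof -
    have "\<delta> = h powr 4" using h_pos powr_realpow[OF h_pos, of 4] by (simp add: \<delta>_def)
    then have "\<delta> powr (1 / 4) = h powr (4 * (1 / 4))" by (simp only: powr_powr)
    then show ?thesis using h_pos by simp
  qed
  moreover have "h powr (\<beta> - 1) * h = h powr \<beta>" using h_pos by (simp add: powr_mult_base mult.commute)
  ultimately have "L \<delta> - L 0 = 4 * (K * h powr \<beta> * sqrt N)" by (simp add: L_def \<kappa>_def ac_simps)
  then have L: "(L \<delta> - L 0)\<^sup>2 = 16 * (K\<^sup>2 * H)"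
    by (simp add: power_mult_distrib H_def N_def)
  have g0: "damped.g a 0 = 0" by (simp add: damped.g_def sqs_def)
  have KH: "0 \<le> K\<^sup>2 * H" by (simp add: H_def)
  show "damped.g a (h^4) \<le> 65 * (K\<^sup>2 * H)"
    using bounds(1) B L g0 unfolding \<delta>_def by simp
  show "integral {0..h^4} (\<lambda>t. sqs I (w a t)) \<le> 82 * (K\<^sup>2 * H)"
    using bounds(2) B L g0 KH unfolding \<delta>_def by simp
qed

text \<open>
  \<open>\<parallel>A\<^sub>h\<^sup>-\<^sup>1\<^sup>/\<^sup>2P\<^sub>hv\<parallel> \<le> |v|\<^sub>-\<^sub>1\<close>: testing \<open>v\<close> with \<open>x = A\<^sub>h\<^sup>-\<^sup>1P\<^sub>hv\<close> gives the square of the left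
  side, and \<open>(v, x) \<le> |v|\<^sub>-\<^sub>1 |x|\<^sub>1\<close> where \<open>|x|\<^sub>1\<close> is at most the energy norm of \<open>x\<close>.
\<close>

lemma neg_norm_P_le: "(\<Sum>i\<in>I. (P a i)\<^sup>2 / mu i) \<le> seminorm_sq (- 1) a"
proof -
  define x where "x i = P a i / mu i" for i
  define S where "S = (\<Sum>i\<in>I. (P a i)\<^sup>2 / mu i)"
  have S: "S = (\<Sum>i\<in>I. mu i * (x i)\<^sup>2)"
    unfolding S_def x_def by (intro sum.cong refl) (use mu_pos in \<open>auto simp: field_simps power2_eq_square\<close>)
  have S0: "0 \<le> S" unfolding S_def using mu_pos by (intro sum_nonneg) (simp add: less_imp_le)
  have "S = (\<Sum>i\<in>I. P a i * x i)" unfolding S_def x_def by (simp add: power2_eq_square)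
  also have "\<dots> = (\<Sum>j\<in>J. (a j / sqrt (lam j)) * (sqrt (lam j) * (\<Sum>i\<in>I. m i j * x i)))"
  proof -
    have "(\<Sum>i\<in>I. P a i * x i) = (\<Sum>j\<in>J. \<Sum>i\<in>I. a j * (m i j * x i))"
      unfolding P_def by (subst sum.swap) (simp add: sum_distrib_left sum_distrib_right ac_simps)
    also have "\<dots> = (\<Sum>j\<in>J. (a j / sqrt (lam j)) * (sqrt (lam j) * (\<Sum>i\<in>I. m i j * x i)))"
      by (intro sum.cong refl) (use lam_pos in \<open>simp add: sum_distrib_left less_imp_neq[symmetric]\<close>)
    finally show ?thesis .
  qed
  also have "\<dots> \<le> sqrt (sqs J (\<lambda>j. a j / sqrt (lam j))) * sqrt (sqs J (\<lambda>j. sqrt (lam j) * (\<Sum>i\<in>I. m i j * x i)))"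
    by (rule sum_mult_le_sqrt_sqs)
  also have "sqs J (\<lambda>j. a j / sqrt (lam j)) = seminorm_sq (- 1) a"
    unfolding sqs_def seminorm_sq_def
    by (intro sum.cong refl) (use lam_pos in \<open>simp add: power_divide powr_minus_divide less_imp_le\<close>)
  also have "sqrt (sqs J (\<lambda>j. sqrt (lam j) * (\<Sum>i\<in>I. m i j * x i))) \<le> sqrt S"
  proof -
    have "sqs J (\<lambda>j. sqrt (lam j) * (\<Sum>i\<in>I. m i j * x i)) = (\<Sum>j\<in>J. lam j * (\<Sum>i\<in>I. m i j * x i)\<^sup>2)"
      unfolding sqs_def by (intro sum.cong refl) (use lam_pos in \<open>simp add: power_mult_distrib less_imp_le\<close>)
    then show ?thesis using energy[of x] by (simp add: S)
  qed
  finally have "S \<le> sqrt (seminorm_sq (- 1) a) * sqrt S" by (simp add: mult_left_mono)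
  then have "sqrt S * sqrt S \<le> sqrt (seminorm_sq (- 1) a) * sqrt S" using S0 by simp
  then have "sqrt S \<le> sqrt (seminorm_sq (- 1) a) \<or> sqrt S = 0"
    by (metis mult_right_le_imp_le S0 real_sqrt_ge_zero less_eq_real_def)
  then have "S \<le> seminorm_sq (- 1) a" using S0 by (auto simp: real_sqrt_le_iff)
  then show ?thesis by (simp add: S_def)
qed

text \<open>
  For \<open>\<beta> = 1\<close> the difference of the two solutions brings nothing on the initial layer, and each is bounded
  alone: \<open>exp (- 2 t \<mu>\<^sup>2) \<le> t\<^sup>-\<^sup>1\<^sup>/\<^sup>2/\<mu>\<close>, whose integral up to \<open>h\<^sup>4\<close> is \<open>2h\<^sup>2/\<mu>\<close>. At the end of the layer \<open>A\<^sub>h\<^sup>-\<^sup>1w\<close> is the sum of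
  \<open>A\<^sub>h\<^sup>-\<^sup>1(E\<^sub>h - 1)P\<^sub>hv\<close> and \<open>A\<^sub>h\<^sup>-\<^sup>1P\<^sub>h(1 - E)v\<close>. The second one is \<open>R\<^sub>hb\<close> for \<open>b = A\<^sup>-\<^sup>1(1 - E)v\<close>,
  which is compared with \<open>P\<^sub>hb\<close> by the Ritz estimate of first order.
\<close>

lemma early_time_bound_low_order:
  fixes a :: "nat \<Rightarrow> real"
  defines "H \<equiv> h\<^sup>2 * seminorm_sq (- 1) a"
  shows "damped.g a (h^4) \<le> (6 + 4 * K\<^sup>2) * H"
    and "integral {0..h^4} (\<lambda>t. sqs I (w a t)) \<le> 8 * H"
proof -
  define \<delta> where "\<delta> = h^4"
  have \<delta>: "0 < \<delta>" using h_pos by (simp add: \<delta>_def)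
  have sq\<delta>: "sqrt \<delta> = h\<^sup>2" unfolding \<delta>_def by (rule real_sqrt_unique) auto
  define X where "X i = (exp (- \<delta> * (mu i)\<^sup>2) - 1) * P a i / mu i" for i
  define b where "b j = (1 - exp (- \<delta> * (lam j)\<^sup>2)) * a j / lam j" for j
  have damp: "(1 - exp (- \<delta> * y\<^sup>2))\<^sup>2 \<le> h\<^sup>2 * y" if "y > 0" for y
    using one_minus_exp_neg_squared_le_sqrt[of "\<delta> * y\<^sup>2"] \<delta> that by (simp add: real_sqrt_mult sq\<delta>)
  have w_eq: "w a \<delta> i / mu i = X i + (ritz_residual b i + P b i)" if "i \<in> I" for i
  proof -
    have lamb: "(\<Sum>j\<in>J. m i j * (lam j * b j)) = P a i - P (evolve \<delta> a) i"
      unfolding P_def b_def evolve_def sum_subtractf[symmetric]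
    proof (intro sum.cong refl)
      fix j assume "j \<in> J"
      then have "lam j \<noteq> 0" using lam_pos[of j] by simp
      then have "lam j * (c * a j / lam j) = c * a j" for c by simp
      then have "m i j * (lam j * ((1 - exp (- \<delta> * (lam j)\<^sup>2)) * a j / lam j))
          = m i j * ((1 - exp (- \<delta> * (lam j)\<^sup>2)) * a j)" by (simp only:)
      then show "m i j * (lam j * ((1 - exp (- \<delta> * (lam j)\<^sup>2)) * a j / lam j))
          = m i j * a j - m i j * (exp (- \<delta> * (lam j)\<^sup>2) * a j)"
        by (simp only: left_diff_distrib right_diff_distrib mult_1_left)
    qed
    then show ?thesis
      unfolding w_def X_def ritz_residual_def P_def[of "\<lambda>j. lam j * b j"] lamb
      by (simp add: diff_divide_distrib left_diff_distrib)
  qed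
  have "damped.g a \<delta> = sqs I (\<lambda>i. X i + (ritz_residual b i + P b i))"
    unfolding damped.g_def sqs_def by (intro sum.cong refl) (simp add: w_eq)
  also have "\<dots> \<le> 2 * sqs I X + 2 * sqs I (\<lambda>i. ritz_residual b i + P b i)" by (rule sqs_add_le)
  also have "sqs I (\<lambda>i. ritz_residual b i + P b i) \<le> 2 * sqs I (ritz_residual b) + 2 * sqs I (P b)" by (rule sqs_add_le)
  also have "sqs I X \<le> H"
  proof -
    have "sqs I X \<le> (\<Sum>i\<in>I. h\<^sup>2 * ((P a i)\<^sup>2 / mu i))"
      unfolding sqs_def
    proof (rule sum_mono)
      fix i assume i: "i \<in> I"
      have "(X i)\<^sup>2 = (1 - exp (- \<delta> * (mu i)\<^sup>2))\<^sup>2 * ((P a i)\<^sup>2 / (mu i)\<^sup>2)"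
        by (simp add: X_def power_mult_distrib power_divide power2_commute)
      also have "\<dots> \<le> (h\<^sup>2 * mu i) * ((P a i)\<^sup>2 / (mu i)\<^sup>2)"
        by (intro mult_right_mono damp mu_pos i) auto
      also have "\<dots> = h\<^sup>2 * ((P a i)\<^sup>2 / mu i)" using mu_pos[OF i] by (simp add: power2_eq_square)
      finally show "(X i)\<^sup>2 \<le> h\<^sup>2 * ((P a i)\<^sup>2 / mu i)" .
    qed
    also have "\<dots> \<le> H"
      unfolding H_def sum_distrib_left[symmetric] by (intro mult_left_mono neg_norm_P_le) auto
    finally show ?thesis .
  qed
  also have "sqs I (ritz_residual b) \<le> K\<^sup>2 * H"
  proof -
    have "seminorm_sq 1 b \<le> 1 * seminorm_sq (- 1) a"
    proof (rule seminorm_sq_le)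
      fix j assume j: "j \<in> J"
      have lp: "lam j > 0" by (rule lam_pos[OF j])
      have e: "exp (- \<delta> * (lam j)\<^sup>2) \<le> 1" using \<delta> by simp
      have "lam j powr 1 * (b j)\<^sup>2 = (1 - exp (- \<delta> * (lam j)\<^sup>2))\<^sup>2 * ((a j)\<^sup>2 / lam j)"
        using lp by (simp add: b_def power_mult_distrib power_divide power2_eq_square)
      also have "\<dots> \<le> 1 * ((a j)\<^sup>2 / lam j)"
        using e lp by (intro mult_right_mono power_le_one) auto
      finally show "lam j powr 1 * (b j)\<^sup>2 \<le> 1 * (lam j powr (- 1) * (a j)\<^sup>2)"
        using lp by (simp add: powr_minus_divide)
    qed
    then have "(K * h powr 1)\<^sup>2 * seminorm_sq 1 b \<le> (K * h powr 1)\<^sup>2 * seminorm_sq (- 1) a"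
      by (intro mult_left_mono) auto
    then show ?thesis using ritz_residual_le[of 1 b] R2 h_pos by (simp add: H_def power_mult_distrib)
  qed
  also have "sqs I (P b) \<le> H"
  proof -
    have "sqs I (P b) \<le> sqs J b" using bessel[of b] by (simp add: P_def[abs_def])
    also have "\<dots> \<le> (\<Sum>j\<in>J. h\<^sup>2 * (lam j powr (- 1) * (a j)\<^sup>2))"
      unfolding sqs_def
    proof (rule sum_mono)
      fix j assume j: "j \<in> J"
      have lp: "lam j > 0" by (rule lam_pos[OF j])
      have "(b j)\<^sup>2 = (1 - exp (- \<delta> * (lam j)\<^sup>2))\<^sup>2 * ((a j)\<^sup>2 / (lam j)\<^sup>2)"
        by (simp add: b_def power_mult_distrib power_divide)
      also have "\<dots> \<le> (h\<^sup>2 * lam j) * ((a j)\<^sup>2 / (lam j)\<^sup>2)"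
        by (intro mult_right_mono damp lp) auto
      also have "\<dots> = h\<^sup>2 * (lam j powr (- 1) * (a j)\<^sup>2)"
        using lp by (simp add: power2_eq_square powr_minus_divide)
      finally show "(b j)\<^sup>2 \<le> h\<^sup>2 * (lam j powr (- 1) * (a j)\<^sup>2)" .
    qed
    also have "\<dots> = H" by (simp add: H_def seminorm_sq_def sum_distrib_left)
    finally show ?thesis .
  qed
  finally have "damped.g a \<delta> \<le> 2 * H + 2 * (2 * (K\<^sup>2 * H) + 2 * H)" by simp
  then show "damped.g a (h^4) \<le> (6 + 4 * K\<^sup>2) * H" by (simp add: \<delta>_def algebra_simps)
  define N where "N = seminorm_sq (- 1) a"
  have decay: "(exp (- t * y\<^sup>2))\<^sup>2 \<le> 1 / sqrt t / y" if "t > 0" "y > 0" for t y :: real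
  proof -
    have "(sqrt (t * y\<^sup>2) * exp (- (t * y\<^sup>2)))\<^sup>2 \<le> 1"
    proof -
      have "(sqrt (t * y\<^sup>2) * exp (- (t * y\<^sup>2)))\<^sup>2 = t * y\<^sup>2 * exp (- (t * y\<^sup>2)) * exp (- (t * y\<^sup>2))"
        using that by (simp add: power_mult_distrib power2_eq_square)
      also have "\<dots> \<le> 1 * 1" using mult_exp_neg_le_1[of "t * y\<^sup>2"] that by (intro mult_mono) auto
      finally show ?thesis by simp
    qed
    then have "sqrt (t * y\<^sup>2) * exp (- (t * y\<^sup>2)) \<le> 1"
      by (metis one_power2 power2_le_imp_le zero_le_one)
    then have "sqrt t * y * exp (- (t * y\<^sup>2)) * exp (- (t * y\<^sup>2)) \<le> 1 * 1"
      using that by (intro mult_mono) (auto simp: real_sqrt_mult)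
    then show ?thesis using that by (simp add: field_simps power2_eq_square)
  qed
  have W_le: "sqs I (w a t) \<le> 4 * N / sqrt t" if t: "t > 0" for t
  proof -
    have "w a t = (\<lambda>i. exp (- t * (mu i)\<^sup>2) * P a i + - P (evolve t a) i)" by (auto simp: w_def)
    then have "sqs I (w a t) \<le> 2 * sqs I (\<lambda>i. exp (- t * (mu i)\<^sup>2) * P a i) + 2 * sqs I (\<lambda>i. - P (evolve t a) i)"
      using sqs_add_le[of I "\<lambda>i. exp (- t * (mu i)\<^sup>2) * P a i" "\<lambda>i. - P (evolve t a) i"] by simp
    also have "sqs I (\<lambda>i. exp (- t * (mu i)\<^sup>2) * P a i) \<le> (\<Sum>i\<in>I. 1 / sqrt t * ((P a i)\<^sup>2 / mu i))"
      unfolding sqs_def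
    proof (rule sum_mono)
      fix i assume i: "i \<in> I"
      have "(exp (- t * (mu i)\<^sup>2))\<^sup>2 * (P a i)\<^sup>2 \<le> (1 / sqrt t / mu i) * (P a i)\<^sup>2"
        by (intro mult_right_mono decay t mu_pos i) auto
      then show "(exp (- t * (mu i)\<^sup>2) * P a i)\<^sup>2 \<le> 1 / sqrt t * ((P a i)\<^sup>2 / mu i)"
        by (simp add: power_mult_distrib)
    qed
    also have "\<dots> \<le> 1 / sqrt t * N"
      unfolding N_def sum_distrib_left[symmetric] using t by (intro mult_left_mono neg_norm_P_le) auto
    also have "sqs I (\<lambda>i. - P (evolve t a) i) = sqs I (P (evolve t a))" by (simp add: sqs_def)
    also have "\<dots> \<le> sqs J (evolve t a)" using bessel[of "evolve t a"] by (simp add: P_def[abs_def])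
    also have "\<dots> \<le> (\<Sum>j\<in>J. 1 / sqrt t * (lam j powr (- 1) * (a j)\<^sup>2))"
      unfolding sqs_def
    proof (rule sum_mono)
      fix j assume j: "j \<in> J"
      have "(exp (- t * (lam j)\<^sup>2))\<^sup>2 * (a j)\<^sup>2 \<le> (1 / sqrt t / lam j) * (a j)\<^sup>2"
        by (intro mult_right_mono decay t lam_pos j) auto
      then show "(evolve t a j)\<^sup>2 \<le> 1 / sqrt t * (lam j powr (- 1) * (a j)\<^sup>2)"
        using lam_pos[OF j] by (simp add: evolve_def power_mult_distrib powr_minus_divide)
    qed
    also have "\<dots> = 1 / sqrt t * N" by (simp add: N_def seminorm_sq_def sum_distrib_left)
    finally show ?thesis by simp
  qed
  have I1: "((\<lambda>t. 4 * N / sqrt t) has_integral (8 * N * sqrt \<delta> - 8 * N * sqrt 0)) {0..\<delta>}"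
  proof (rule fundamental_theorem_of_calculus_interior)
    show "continuous_on {0..\<delta>} (\<lambda>t. 8 * N * sqrt t)" by (intro continuous_intros)
    fix t assume t: "t \<in> {0<..<\<delta>}"
    have "((\<lambda>t. 8 * N * sqrt t) has_real_derivative 4 * N / sqrt t) (at t)"
      using t by (auto intro!: derivative_eq_intros simp: field_simps)
    then show "((\<lambda>t. 8 * N * sqrt t) has_vector_derivative 4 * N / sqrt t) (at t)"
      by (simp add: has_real_derivative_iff_has_vector_derivative)
  qed (use \<delta> in simp)
  have I2: "((\<lambda>t. sqs I (w a t)) has_integral integral {0..\<delta>} (\<lambda>t. sqs I (w a t))) {0..\<delta>}"
    by (intro integrable_integral integrable_continuous_real sqs_w_cont)
  have "integral {0..\<delta>} (\<lambda>t. sqs I (w a t)) \<le> 8 * N * sqrt \<delta> - 8 * N * sqrt 0"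
  proof (rule has_integral_le[OF I2 I1])
    fix t assume t: "t \<in> {0..\<delta>}"
    show "sqs I (w a t) \<le> 4 * N / sqrt t"
    proof (cases "t = 0")
      case True
      then show ?thesis by (simp add: sqs_def)
    qed (use W_le t in auto)
  qed
  then show "integral {0..h^4} (\<lambda>t. sqs I (w a t)) \<le> 8 * H"
    by (simp add: sq\<delta> H_def N_def \<delta>_def[symmetric] ac_simps)
qed

text \<open>
  The constants of the initial layer and of late times, combined so that one value serves \<open>\<beta> = 1\<close> and
  \<open>\<beta> \<ge> 2\<close>.
\<close>

definition stab :: real where "stab = 26 + (279 + 125 * (1 + 1 / l1\<^sup>2)\<^sup>2) * K\<^sup>2"

lemma w_add: "w (\<lambda>j. a j + b j) t i = w a t i + w b t i"
  by (simp add: w_def P_def evolve_def algebra_simps sum.distrib)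

lemma integral_w_bound_endpoint:
  assumes \<beta>: "\<beta> = 1 \<or> 2 \<le> \<beta>" "\<beta> \<le> R" and h: "h \<le> exp (- 1)" and T: "T \<ge> 1"
  shows "integral {0..T} (\<lambda>t. sqs I (w a t)) \<le> stab * ((h powr \<beta> * ln h)\<^sup>2 * seminorm_sq (\<beta> - 2) a)"
proof -
  define H where "H = (h powr \<beta>)\<^sup>2 * seminorm_sq (\<beta> - 2) a"
  define c where "c = 125 * (1 + 1 / l1\<^sup>2)\<^sup>2"
  have h1: "h \<le> 1" by (rule order_trans[OF h]) simp
  have \<delta>: "0 \<le> h^4" "h^4 \<le> T" using h_pos h1 T power_le_one[of h 4] by auto
  have H0: "0 \<le> H" by (simp add: H_def)
  have "ln h \<le> ln (exp (- 1))" using h h_pos by (subst ln_le_cancel_iff) auto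
  then have "1 \<le> \<bar>ln h\<bar>" by auto
  from power_mono[OF this, of 2] have ell: "1 \<le> (ln h)\<^sup>2" by simp
  have early: "3 * damped.g a (h^4) + integral {0..h^4} (\<lambda>t. sqs I (w a t)) \<le> (26 + 277 * K\<^sup>2) * H"
  proof (cases "\<beta> = 1")
    case True
    have "0 \<le> K\<^sup>2 * H" using H0 by simp
    moreover have Heq: "h\<^sup>2 * seminorm_sq (- 1) a = H" using h_pos True by (simp add: H_def)
    ultimately show ?thesis
      using early_time_bound_low_order[of a, unfolded Heq] by (simp add: algebra_simps)
  next
    case False
    then have "2 \<le> \<beta>" using \<beta> by auto
    from early_time_bound_high_order[OF this \<beta>(2) h1, of a] H0
    show ?thesis by (simp add: H_def[symmetric] algebra_simps)
  qed
  have "1 \<le> \<beta>" using \<beta> by auto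
  from late_time_bound[OF this \<beta>(2) h T, of a]
  have late: "integral {h^4..T} (\<lambda>t. sqs I (w a t)) \<le> 3 * damped.g a (h^4) + (2 + c) * K\<^sup>2 * (H * (ln h)\<^sup>2)"
    by (simp add: H_def c_def power_mult_distrib ac_simps)
  have "integral {0..T} (\<lambda>t. sqs I (w a t)) = integral {0..h^4} (\<lambda>t. sqs I (w a t)) + integral {h^4..T} (\<lambda>t. sqs I (w a t))"
    by (rule Henstock_Kurzweil_Integration.integral_combine[symmetric])
      (use \<delta> in \<open>auto intro!: integrable_continuous_real sqs_w_cont\<close>)
  also have "\<dots> \<le> (26 + 277 * K\<^sup>2) * H + (2 + c) * K\<^sup>2 * (H * (ln h)\<^sup>2)"
    using early late by linarith
  also have "(26 + 277 * K\<^sup>2) * H \<le> (26 + 277 * K\<^sup>2) * (H * (ln h)\<^sup>2)"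
    using H0 ell by (intro mult_left_mono) (auto simp: mult_le_cancel_left1)
  also have "(26 + 277 * K\<^sup>2) * (H * (ln h)\<^sup>2) + (2 + c) * K\<^sup>2 * (H * (ln h)\<^sup>2)
      = stab * ((h powr \<beta> * ln h)\<^sup>2 * seminorm_sq (\<beta> - 2) a)"
    by (simp add: stab_def c_def[symmetric] H_def power_mult_distrib algebra_simps)
  finally show ?thesis by simp
qed

text \<open>
  Interpolation between \<open>\<beta> = 1\<close> and \<open>\<beta> = 2\<close> by hand: with the cut at \<open>c = h\<^sup>-\<^sup>2\<close> the low frequencies satisfy
  \<open>h\<^sup>2|v\<^sub>l|\<^sub>0 \<le> h\<^sup>\<beta>|v|\<^sub>\<beta>\<^sub>-\<^sub>2\<close> and the high ones \<open>h|v\<^sub>h|\<^sub>-\<^sub>1 \<le> h\<^sup>\<beta>|v|\<^sub>\<beta>\<^sub>-\<^sub>2\<close>.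
\<close>

lemma integral_w_bound:
  assumes \<beta>: "1 \<le> \<beta>" "\<beta> \<le> R" and h: "h \<le> exp (- 1)" and T: "T \<ge> 1"
  shows "integral {0..T} (\<lambda>t. sqs I (w a t)) \<le> 4 * stab * ((h powr \<beta> * ln h)\<^sup>2 * seminorm_sq (\<beta> - 2) a)"
proof -
  have stab0: "0 \<le> stab" by (simp add: stab_def)
  have X0: "0 \<le> stab * ((h powr \<beta> * ln h)\<^sup>2 * seminorm_sq (\<beta> - 2) a)" using stab0 by simp
  show ?thesis
  proof (cases "\<beta> = 1 \<or> 2 \<le> \<beta>")
    case True
    from integral_w_bound_endpoint[OF this \<beta>(2) h T, of a] X0 show ?thesis by simp
  next
    case False
    then have \<beta>2: "1 < \<beta>" "\<beta> < 2" using \<beta> by auto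
    define c where "c = h powr (- 2)"
    have c: "c > 0" using h_pos by (simp add: c_def)
    define al where "al j = (if lam j \<le> c then a j else 0)" for j
    define ah where "ah j = (if lam j \<le> c then 0 else a j)" for j
    have a_split: "a = (\<lambda>j. al j + ah j)" by (auto simp: al_def ah_def)
    have W_le: "sqs I (w a t) \<le> 2 * sqs I (w al t) + 2 * sqs I (w ah t)" for t
      by (subst a_split, subst w_add[abs_def]) (rule sqs_add_le)
    have "integral {0..T} (\<lambda>t. sqs I (w a t)) \<le> integral {0..T} (\<lambda>t. 2 * sqs I (w al t) + 2 * sqs I (w ah t))"
      by (intro integral_le integrable_continuous_real continuous_intros sqs_w_cont W_le)
    also have "\<dots> = 2 * integral {0..T} (\<lambda>t. sqs I (w al t)) + 2 * integral {0..T} (\<lambda>t. sqs I (w ah t))"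
      by (subst Henstock_Kurzweil_Integration.integral_add)
        (auto intro!: integrable_continuous_real continuous_intros sqs_w_cont)
    also have "integral {0..T} (\<lambda>t. sqs I (w al t)) \<le> stab * ((h powr 2 * ln h)\<^sup>2 * seminorm_sq 0 al)"
      using integral_w_bound_endpoint[of 2 T al] R2 h T by simp
    also have "integral {0..T} (\<lambda>t. sqs I (w ah t)) \<le> stab * ((h powr 1 * ln h)\<^sup>2 * seminorm_sq (- 1) ah)"
      using integral_w_bound_endpoint[of 1 T ah] R2 h T by simp
    also have "(h powr 2 * ln h)\<^sup>2 * seminorm_sq 0 al \<le> (h powr \<beta> * ln h)\<^sup>2 * seminorm_sq (\<beta> - 2) a"
    proof -
      have "seminorm_sq 0 al \<le> c powr (2 - \<beta>) * seminorm_sq (\<beta> - 2) a"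
      proof (rule seminorm_sq_le)
        fix j assume j: "j \<in> J"
        have lp: "lam j > 0" by (rule lam_pos[OF j])
        show "lam j powr 0 * (al j)\<^sup>2 \<le> c powr (2 - \<beta>) * (lam j powr (\<beta> - 2) * (a j)\<^sup>2)"
        proof (cases "lam j \<le> c")
          case True
          have "lam j powr 0 = lam j powr (2 - \<beta>) * lam j powr (\<beta> - 2)"
            by (simp only: powr_add[symmetric]) simp
          also have "\<dots> \<le> c powr (2 - \<beta>) * lam j powr (\<beta> - 2)"
            using True lp \<beta>2 by (intro mult_right_mono powr_mono2) auto
          finally have "lam j powr 0 * (a j)\<^sup>2 \<le> c powr (2 - \<beta>) * lam j powr (\<beta> - 2) * (a j)\<^sup>2"
            by (rule mult_right_mono) simp
          then show ?thesis using True by (simp add: al_def)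
        qed (simp add: al_def)
      qed
      then have "(h powr 2 * ln h)\<^sup>2 * seminorm_sq 0 al \<le> (h powr 2 * ln h)\<^sup>2 * (c powr (2 - \<beta>) * seminorm_sq (\<beta> - 2) a)"
        by (rule mult_left_mono) simp
      also have "\<dots> = (h powr 2)\<^sup>2 * c powr (2 - \<beta>) * ((ln h)\<^sup>2 * seminorm_sq (\<beta> - 2) a)"
        by (simp add: power_mult_distrib ac_simps)
      also have "(h powr 2)\<^sup>2 * c powr (2 - \<beta>) = h powr (2 + 2 + (- 2) * (2 - \<beta>))"
        by (simp only: c_def powr_powr power2_eq_square powr_add[symmetric])
      also have "\<dots> = (h powr \<beta>)\<^sup>2"
        by (simp only: power2_eq_square powr_add[symmetric]) simp
      finally show ?thesis by (simp add: power_mult_distrib ac_simps)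
    qed
    also have "(h powr 1 * ln h)\<^sup>2 * seminorm_sq (- 1) ah \<le> (h powr \<beta> * ln h)\<^sup>2 * seminorm_sq (\<beta> - 2) a"
    proof -
      have "seminorm_sq (- 1) ah \<le> c powr (1 - \<beta>) * seminorm_sq (\<beta> - 2) a"
      proof (rule seminorm_sq_le)
        fix j assume j: "j \<in> J"
        have lp: "lam j > 0" by (rule lam_pos[OF j])
        show "lam j powr (- 1) * (ah j)\<^sup>2 \<le> c powr (1 - \<beta>) * (lam j powr (\<beta> - 2) * (a j)\<^sup>2)"
        proof (cases "lam j \<le> c")
          case False
          have "lam j powr (- 1) = lam j powr (1 - \<beta>) * lam j powr (\<beta> - 2)"
            by (simp only: powr_add[symmetric]) simp
          also have "\<dots> \<le> c powr (1 - \<beta>) * lam j powr (\<beta> - 2)"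
            using False c \<beta>2 by (intro mult_right_mono powr_mono2') auto
          finally have "lam j powr (- 1) * (a j)\<^sup>2 \<le> c powr (1 - \<beta>) * lam j powr (\<beta> - 2) * (a j)\<^sup>2"
            by (rule mult_right_mono) simp
          then show ?thesis using False by (simp add: ah_def mult.assoc)
        qed (simp add: ah_def)
      qed
      then have "(h powr 1 * ln h)\<^sup>2 * seminorm_sq (- 1) ah \<le> (h powr 1 * ln h)\<^sup>2 * (c powr (1 - \<beta>) * seminorm_sq (\<beta> - 2) a)"
        by (rule mult_left_mono) simp
      also have "\<dots> = (h powr 1)\<^sup>2 * c powr (1 - \<beta>) * ((ln h)\<^sup>2 * seminorm_sq (\<beta> - 2) a)"
        by (simp only: power_mult_distrib ac_simps)
      also have "(h powr 1)\<^sup>2 * c powr (1 - \<beta>) = h powr (1 + 1 + (- 2) * (1 - \<beta>))"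
        by (simp only: c_def powr_powr power2_eq_square powr_add[symmetric])
      also have "\<dots> = (h powr \<beta>)\<^sup>2"
        by (simp only: power2_eq_square powr_add[symmetric]) simp
      finally show ?thesis by (simp add: power_mult_distrib ac_simps)
    qed
    finally have "integral {0..T} (\<lambda>t. sqs I (w a t))
        \<le> 2 * (stab * ((h powr \<beta> * ln h)\<^sup>2 * seminorm_sq (\<beta> - 2) a)) + 2 * (stab * ((h powr \<beta> * ln h)\<^sup>2 * seminorm_sq (\<beta> - 2) a))"
      using stab0 by (simp add: mult_left_mono)
    also have "\<dots> = 4 * stab * ((h powr \<beta> * ln h)\<^sup>2 * seminorm_sq (\<beta> - 2) a)" by simp
    finally show ?thesis .
  qed
qed

lemma defect_cont: "continuous_on A (\<lambda>t. defect (evolve t a))"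
  unfolding defect_def sqs_def P_def evolve_def by (intro continuous_intros)

lemma err_cont: "continuous_on A (err a)"
  unfolding err_def[abs_def] by (intro continuous_intros sqs_w_cont defect_cont)

lemma err_nonneg: "0 \<le> err a t" by (simp add: err_def)

theorem rough_data_bound:
  assumes \<beta>: "1 \<le> \<beta>" "\<beta> \<le> R" and h: "h \<le> exp (- 1)" and T: "T \<ge> 0"
  shows "integral {0..T} (err a) \<le> (4 * stab + K\<^sup>2) * ((h powr \<beta> * ln h)\<^sup>2 * seminorm_sq (\<beta> - 2) a)"
proof -
  define H where "H = (h powr \<beta>)\<^sup>2 * seminorm_sq (\<beta> - 2) a"
  \<comment> \<open>the late time estimate needs a final time beyond the initial layer\<close>
  define T' where "T' = max T 1"
  have T': "T \<le> T'" "T' \<ge> 1" by (auto simp: T'_def)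
  have H0: "0 \<le> H" by (simp add: H_def)
  have "ln h \<le> ln (exp (- 1))" using h h_pos by (subst ln_le_cancel_iff) auto
  then have "1 \<le> \<bar>ln h\<bar>" by auto
  from power_mono[OF this, of 2] have ell: "1 \<le> (ln h)\<^sup>2" by simp
  have "((\<lambda>t. (K * h powr \<beta>)\<^sup>2 * seminorm_sq \<beta> (evolve t a)) has_integral B \<beta> a T' - B \<beta> a 0) {0..T'}"
    using T' by (intro fundamental_theorem_of_calculus)
      (auto intro!: has_field_derivative_at_within[OF B_deriv] simp flip: has_real_derivative_iff_has_vector_derivative)
  then have "integral {0..T'} (\<lambda>t. defect (evolve t a)) \<le> B \<beta> a T' - B \<beta> a 0"
    by (intro has_integral_le[OF integrable_integral])
      (auto intro!: integrable_continuous_real defect_cont defect_le \<beta>)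
  also have "\<dots> \<le> K\<^sup>2 * H" proof -
    have "B \<beta> a T' - B \<beta> a 0 \<le> K\<^sup>2 * H / 2"
      using B_diff[of 0 \<beta> a T'] by (simp add: H_def power_mult_distrib)
    moreover have "0 \<le> K\<^sup>2 * H" using H0 by simp
    ultimately show ?thesis by linarith
  qed
  also have "\<dots> \<le> K\<^sup>2 * (H * (ln h)\<^sup>2)"
    using H0 ell by (intro mult_left_mono) (auto simp: mult_le_cancel_left1)
  finally have 1: "integral {0..T'} (\<lambda>t. defect (evolve t a)) \<le> K\<^sup>2 * (H * (ln h)\<^sup>2)" .
  have 2: "integral {0..T'} (\<lambda>t. sqs I (w a t)) \<le> 4 * stab * (H * (ln h)\<^sup>2)"
    using integral_w_bound[OF \<beta> h T'(2), of a] by (simp add: H_def power_mult_distrib ac_simps)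
  have "integral {0..T} (err a) \<le> integral {0..T'} (err a)"
    using T' by (intro integral_subset_le integrable_continuous_real err_cont) (auto simp: err_nonneg)
  also have "\<dots> = integral {0..T'} (\<lambda>t. sqs I (w a t)) + integral {0..T'} (\<lambda>t. defect (evolve t a))"
    unfolding err_def[abs_def]
    by (intro Henstock_Kurzweil_Integration.integral_add integrable_continuous_real sqs_w_cont defect_cont)
  also have "\<dots> \<le> 4 * stab * (H * (ln h)\<^sup>2) + K\<^sup>2 * (H * (ln h)\<^sup>2)" using 1 2 by simp
  also have "\<dots> = (4 * stab + K\<^sup>2) * ((h powr \<beta> * ln h)\<^sup>2 * seminorm_sq (\<beta> - 2) a)"
    by (simp add: H_def power_mult_distrib algebra_simps)
  finally show ?thesis .
qed

end

section \<open>Smooth bumps and the fundamental lemma of the calculus of variations\<close>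

text \<open>
  The \<open>n\<close>-th derivative of \<open>e\<^sup>-\<^sup>1\<^sup>/\<^sup>s\<close> for \<open>s > 0\<close> is a polynomial in \<open>1/s\<close> times \<open>e\<^sup>-\<^sup>1\<^sup>/\<^sup>s\<close>; the recursion is the
  chain rule. Continued by zero, these functions are flat at the origin.
\<close>

fun flat_poly :: "nat \<Rightarrow> real poly" where
  "flat_poly 0 = 1"
| "flat_poly (Suc n) = [:0, 0, 1:] * (flat_poly n - pderiv (flat_poly n))"

definition flat :: "nat \<Rightarrow> real \<Rightarrow> real" where
  "flat n s = (if s > 0 then poly (flat_poly n) (1 / s) * exp (- (1 / s)) else 0)"

lemma poly_times_exp_neg_at_top: "((\<lambda>y. poly p y * exp (- y)) \<longlongrightarrow> 0) (at_top :: real filter)"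
proof -
  have "((\<lambda>y. \<Sum>i\<le>degree p. coeff p i * (y ^ i / exp y)) \<longlongrightarrow> (\<Sum>i\<le>degree p. coeff p i * 0)) at_top"
    by (intro tendsto_sum tendsto_mult tendsto_const tendsto_power_div_exp_0)
  then show ?thesis by (simp add: poly_altdef exp_minus sum_distrib_right divide_inverse mult.assoc)
qed

lemma flat_deriv: "(flat n has_real_derivative flat (Suc n) s) (at s)"
proof -
  consider "s < 0" | "s > 0" | "s = 0" by linarith
  then show ?thesis
  proof cases
    case 1
    have "((\<lambda>s. 0) has_real_derivative flat (Suc n) s) (at s)" using 1 by (simp add: flat_def)
    then show ?thesis
      by (rule has_field_derivative_transform_within_open[where S = "{..<0}"]) (use 1 in \<open>auto simp: flat_def\<close>)
  next
    case 2
    have "((\<lambda>s. poly (flat_poly n) (1 / s) * exp (- (1 / s))) has_real_derivative flat (Suc n) s) (at s)"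
      using 2 by (auto intro!: derivative_eq_intros simp: flat_def field_simps power2_eq_square)
    then show ?thesis
      by (rule has_field_derivative_transform_within_open[where S = "{0<..}"]) (use 2 in \<open>auto simp: flat_def\<close>)
  next
    case 3
    have "((\<lambda>h. flat n h / h) \<longlongrightarrow> 0) (at_right 0)"
    proof -
      have "((\<lambda>h. poly ([:0, 1:] * flat_poly n) (inverse h) * exp (- inverse h)) \<longlongrightarrow> 0) (at_right (0::real))"
        by (rule filterlim_compose[OF poly_times_exp_neg_at_top filterlim_inverse_at_top_right])
      then show ?thesis
        by (rule Lim_transform_eventually)
          (auto simp: eventually_at_right_field flat_def field_simps intro!: exI[of _ 1])
    qed
    moreover have "((\<lambda>h. flat n h / h) \<longlongrightarrow> 0) (at_left 0)"
      by (rule Lim_transform_eventually[OF tendsto_const])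
        (auto simp: eventually_at_left_field flat_def intro!: exI[of _ "-1"])
    ultimately have "((\<lambda>h. flat n h / h) \<longlongrightarrow> 0) (at 0)" by (simp add: filterlim_split_at)
    then show ?thesis by (simp add: 3 DERIV_def flat_def)
  qed
qed

lemma flat_0: "flat 0 s = (if s > 0 then exp (- (1 / s)) else 0)"
  by (simp add: flat_def)

lemma Ck_on_SucI:
  assumes "\<And>x. (f has_derivative (\<lambda>v. f' x \<bullet> v)) (at x)"
    and "\<And>b. b \<in> Basis \<Longrightarrow> Ck_on k UNIV (\<lambda>x. f' x \<bullet> b)"
  shows "Ck_on (Suc k) UNIV f"
  unfolding Ck_on.simps using assms by blast

lemma Ck_on_const: "Ck_on k UNIV (\<lambda>x. c)"
proof (induction k arbitrary: c)
  case (Suc k)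
  show ?case by (rule Ck_on_SucI[where f' = "\<lambda>x. 0"]) (use Suc in auto)
qed simp

lemma Ck_on_Suc_imp: "Ck_on (Suc k) UNIV f \<Longrightarrow> Ck_on k UNIV f"
proof (induction k arbitrary: f)
  case 0
  then obtain f' where "\<And>x. (f has_derivative (\<lambda>v. f' x \<bullet> v)) (at x)" by auto
  then show ?case by (auto intro!: continuous_at_imp_continuous_on has_derivative_continuous)
next
  case (Suc k)
  from Suc.prems obtain f' where f': "\<And>x. (f has_derivative (\<lambda>v. f' x \<bullet> v)) (at x)"
    "\<And>b. b \<in> Basis \<Longrightarrow> Ck_on (Suc k) UNIV (\<lambda>x. f' x \<bullet> b)"
    by (subst (asm) Ck_on.simps(2)) auto
  show ?case
    unfolding Ck_on.simps(2)[of k]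
    using f' Suc.IH by (intro exI[of _ f']) blast
qed

lemma Ck_on_add: "Ck_on k UNIV f \<Longrightarrow> Ck_on k UNIV g \<Longrightarrow> Ck_on k UNIV (\<lambda>x. f x + g x)"
proof (induction k arbitrary: f g)
  case 0
  then show ?case by (auto intro: continuous_on_add)
next
  case (Suc k)
  obtain f' where f': "\<And>x. (f has_derivative (\<lambda>v. f' x \<bullet> v)) (at x)"
    "\<And>b. b \<in> Basis \<Longrightarrow> Ck_on k UNIV (\<lambda>x. f' x \<bullet> b)" using Suc.prems(1) by auto
  obtain g' where g': "\<And>x. (g has_derivative (\<lambda>v. g' x \<bullet> v)) (at x)"
    "\<And>b. b \<in> Basis \<Longrightarrow> Ck_on k UNIV (\<lambda>x. g' x \<bullet> b)" using Suc.prems(2) by auto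
  have "((\<lambda>x. f x + g x) has_derivative (\<lambda>v. (f' x + g' x) \<bullet> v)) (at x)" for x
    using has_derivative_add[OF f'(1) g'(1), of x] by (simp add: inner_add_left)
  moreover have "Ck_on k UNIV (\<lambda>x. (f' x + g' x) \<bullet> b)" if "b \<in> Basis" for b
    unfolding inner_add_left by (intro Suc.IH f' g' that)
  ultimately show ?case by (rule Ck_on_SucI)
qed

lemma Ck_on_mult: "Ck_on k UNIV f \<Longrightarrow> Ck_on k UNIV g \<Longrightarrow> Ck_on k UNIV (\<lambda>x. f x * g x)"
proof (induction k arbitrary: f g)
  case 0
  then show ?case by (auto intro: continuous_on_mult)
next
  case (Suc k)
  have fg: "Ck_on k UNIV f" "Ck_on k UNIV g" by (rule Ck_on_Suc_imp[OF Suc.prems(1)], rule Ck_on_Suc_imp[OF Suc.prems(2)])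
  obtain f' where f': "\<And>x. (f has_derivative (\<lambda>v. f' x \<bullet> v)) (at x)"
    "\<And>b. b \<in> Basis \<Longrightarrow> Ck_on k UNIV (\<lambda>x. f' x \<bullet> b)" using Suc.prems(1) by auto
  obtain g' where g': "\<And>x. (g has_derivative (\<lambda>v. g' x \<bullet> v)) (at x)"
    "\<And>b. b \<in> Basis \<Longrightarrow> Ck_on k UNIV (\<lambda>x. g' x \<bullet> b)" using Suc.prems(2) by auto
  have "((\<lambda>x. f x * g x) has_derivative (\<lambda>v. (f x *\<^sub>R g' x + g x *\<^sub>R f' x) \<bullet> v)) (at x)" for x
    using has_derivative_mult[OF f'(1) g'(1), of x] by (simp add: inner_add_left ac_simps)
  moreover have "Ck_on k UNIV (\<lambda>x. (f x *\<^sub>R g' x + g x *\<^sub>R f' x) \<bullet> b)" if "b \<in> Basis" for b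
    unfolding inner_add_left inner_scaleR_left by (intro Ck_on_add Suc.IH f' g' that fg)
  ultimately show ?case by (rule Ck_on_SucI)
qed

lemma Ck_on_prod:
  "finite A \<Longrightarrow> (\<And>i. i \<in> A \<Longrightarrow> Ck_on k UNIV (f i)) \<Longrightarrow> Ck_on k UNIV (\<lambda>x. \<Prod>i\<in>A. f i x)"
  by (induction A rule: finite_induct) (auto intro: Ck_on_const Ck_on_mult)

lemma Ck_on_affine_compose:
  assumes "\<And>n s. (F n has_real_derivative F (Suc n) s) (at s)"
  shows "Ck_on k UNIV (\<lambda>x. e * F n (a \<bullet> x + d))"
proof (induction k arbitrary: e n)
  case 0
  have "continuous_on UNIV (F n)" by (auto intro!: continuous_at_imp_continuous_on DERIV_isCont[OF assms])
  then have "continuous_on UNIV (\<lambda>x. F n (a \<bullet> x + d))"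
    by (rule continuous_on_compose2) (auto intro!: continuous_intros)
  then show ?case by (auto intro!: continuous_intros)
next
  case (Suc k)
  have "((\<lambda>x. e * F n (a \<bullet> x + d)) has_derivative (\<lambda>v. ((e * F (Suc n) (a \<bullet> x + d)) *\<^sub>R a) \<bullet> v)) (at x)" for x
    by (rule has_derivative_eq_rhs, rule has_derivative_mult_right,
        rule has_derivative_compose[OF _ assms[unfolded has_field_derivative_def]])
      (auto intro!: derivative_eq_intros)
  moreover have "Ck_on k UNIV (\<lambda>x. ((e * F (Suc n) (a \<bullet> x + d)) *\<^sub>R a) \<bullet> b)" for b
  proof -
    have "(\<lambda>x. ((e * F (Suc n) (a \<bullet> x + d)) *\<^sub>R a) \<bullet> b) = (\<lambda>x. (e * (a \<bullet> b)) * F (Suc n) (a \<bullet> x + d))" by auto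
    then show ?thesis using Suc by simp
  qed
  ultimately show ?case by (rule Ck_on_SucI)
qed

text \<open>
  Rescaling by \<open>Suc n\<close> does not change the support but flattens the bump: \<open>exp (- 1 / (n s)) \<rightarrow> 1\<close> for every \<open>s > 0\<close>, so the
  bumps increase to the indicator of the open box.
\<close>

definition box_bump :: "'a::euclidean_space \<Rightarrow> 'a \<Rightarrow> nat \<Rightarrow> 'a \<Rightarrow> real" where
  "box_bump a c n x = (\<Prod>b\<in>Basis. flat 0 (real (Suc n) * (x \<bullet> b - a \<bullet> b)) * flat 0 (real (Suc n) * (c \<bullet> b - x \<bullet> b)))"

lemma box_bump_Ck: "Ck_on k UNIV (box_bump a c n)"
proof -
  have A: "Ck_on k UNIV (\<lambda>x. flat 0 (d \<bullet> x + e))" for d :: 'a and e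
    using Ck_on_affine_compose[of flat k 1 0 d e] flat_deriv by simp
  have *: "Ck_on k UNIV (\<lambda>x. flat 0 (real (Suc n) * (x \<bullet> b - a \<bullet> b)) * flat 0 (real (Suc n) * (c \<bullet> b - x \<bullet> b)))" for b
  proof (rule Ck_on_mult)
    have "real (Suc n) * (x \<bullet> b - a \<bullet> b) = (real (Suc n) *\<^sub>R b) \<bullet> x + - (real (Suc n) * (a \<bullet> b))"
      and "real (Suc n) * (c \<bullet> b - x \<bullet> b) = (- real (Suc n) *\<^sub>R b) \<bullet> x + real (Suc n) * (c \<bullet> b)" for x
      by (simp_all add: algebra_simps inner_commute)
    then show "Ck_on k UNIV (\<lambda>x. flat 0 (real (Suc n) * (x \<bullet> b - a \<bullet> b)))"
      "Ck_on k UNIV (\<lambda>x. flat 0 (real (Suc n) * (c \<bullet> b - x \<bullet> b)))"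
      by (simp_all only: A)
  qed
  show ?thesis unfolding box_bump_def[abs_def] by (intro Ck_on_prod * finite_Basis)
qed

lemma box_bump_support: "box_bump a c n x \<noteq> 0 \<longleftrightarrow> x \<in> box a c"
  by (auto simp: box_bump_def flat_0 mem_box zero_less_mult_iff)

lemma box_bump_bounds: "0 \<le> box_bump a c n x" "box_bump a c n x \<le> 1"
proof -
  have f: "0 \<le> flat 0 s" "flat 0 s \<le> 1" for s by (auto simp: flat_0)
  show "0 \<le> box_bump a c n x" unfolding box_bump_def by (intro prod_nonneg mult_nonneg_nonneg f)
  show "box_bump a c n x \<le> 1" unfolding box_bump_def by (intro prod_le_1 conjI mult_nonneg_nonneg mult_le_one f)
qed

lemma box_bump_tendsto: "(\<lambda>n. box_bump a c n x) \<longlonglongrightarrow> indicat_real (box a c) x"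
proof -
  have flat_lim: "(\<lambda>n. flat 0 (real (Suc n) * s)) \<longlonglongrightarrow> (if s > 0 then 1 else 0)" for s
  proof (cases "s > 0")
    case True
    have "(\<lambda>n. inverse (real (Suc n))) \<longlonglongrightarrow> 0" by (rule LIMSEQ_inverse_real_of_nat)
    then have "(\<lambda>n. exp (- (inverse (real (Suc n)) * (1 / s)))) \<longlonglongrightarrow> exp (- (0 * (1 / s)))"
      by (intro tendsto_intros)
    moreover have "flat 0 (real (Suc n) * s) = exp (- (inverse (real (Suc n)) * (1 / s)))" for n
      using True by (simp add: flat_0 field_simps add_pos_nonneg)
    ultimately show ?thesis using True by simp
  next
    case False
    then have "\<not> real (Suc n) * s > 0" for n by (simp add: zero_less_mult_iff)
    then show ?thesis using False by (simp add: flat_0 del: of_nat_Suc)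
  qed
  have "(\<lambda>n. box_bump a c n x) \<longlonglongrightarrow>
      (\<Prod>b\<in>Basis. (if x \<bullet> b - a \<bullet> b > 0 then 1 else 0) * (if c \<bullet> b - x \<bullet> b > 0 then 1 else 0))"
    unfolding box_bump_def by (intro tendsto_prod tendsto_mult flat_lim)
  also have "(\<Prod>b\<in>Basis. (if x \<bullet> b - a \<bullet> b > 0 then 1 else 0) * (if c \<bullet> b - x \<bullet> b > 0 then 1 else 0)) = indicat_real (box a c) x"
  proof (cases "x \<in> box a c")
    case True then show ?thesis by (simp add: mem_box)
  next
    case False
    then obtain b where "b \<in> Basis" "\<not> (a \<bullet> b < x \<bullet> b \<and> x \<bullet> b < c \<bullet> b)" by (auto simp: mem_box)
    then have "(\<Prod>b\<in>Basis. (if x \<bullet> b - a \<bullet> b > 0 then 1 else 0) * (if c \<bullet> b - x \<bullet> b > 0 then 1 else (0::real))) = 0"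
      by (intro prod_zero) auto
    then show ?thesis using False by simp
  qed
  finally show ?thesis .
qed

lemma box_bump_test_function:
  assumes "cbox a c \<subseteq> D" shows "box_bump a c n \<in> test_functions D"
proof -
  have "{x. box_bump a c n x \<noteq> 0} = box a c" using box_bump_support by blast
  moreover have "closure (box a c) \<subseteq> cbox a c" by (intro closure_minimal box_subset_cbox closed_cbox)
  ultimately show ?thesis
    unfolding test_functions_def using assms box_bump_Ck by (auto simp: bounded_box)
qed

lemma integral_box_eq_0:
  fixes g :: "'a::euclidean_space \<Rightarrow> real"
  assumes D: "open D" and g: "integrable (lebesgue_on D) g"
    and test: "\<And>\<psi>. \<psi> \<in> test_functions D \<Longrightarrow> ip D g \<psi> = 0"
    and ac: "cbox a c \<subseteq> D"
  shows "(\<integral>x. indicat_real (box a c) x * g x \<partial>lebesgue_on D) = 0"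
proof -
  have [measurable]: "g \<in> borel_measurable (lebesgue_on D)" using g by auto
  have meas: "box_bump a c n \<in> borel_measurable (lebesgue_on D)" for n
  proof -
    have "Ck_on 0 UNIV (box_bump a c n)" by (rule box_bump_Ck)
    then have "continuous_on D (box_bump a c n)" by (auto intro: continuous_on_subset)
    then show ?thesis using D by (intro continuous_imp_measurable_on_sets_lebesgue) auto
  qed
  have "(\<lambda>n. \<integral>x. box_bump a c n x * g x \<partial>lebesgue_on D) \<longlonglongrightarrow> (\<integral>x. indicat_real (box a c) x * g x \<partial>lebesgue_on D)"
  proof (rule integral_dominated_convergence[where w = "\<lambda>x. \<bar>g x\<bar>"])
    show "(\<lambda>x. indicat_real (box a c) x * g x) \<in> borel_measurable (lebesgue_on D)"
      using D by (intro borel_measurable_times borel_measurable_indicator')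
        (auto simp: sets_restrict_space_iff intro!: lmeasurable_open )
    show "AE x in lebesgue_on D. (\<lambda>n. box_bump a c n x * g x) \<longlonglongrightarrow> indicat_real (box a c) x * g x"
      by (intro AE_I2 tendsto_mult box_bump_tendsto tendsto_const)
    show "AE x in lebesgue_on D. norm (box_bump a c n x * g x) \<le> \<bar>g x\<bar>" for n
      using box_bump_bounds[of a c n] by (intro AE_I2) (auto simp: abs_mult intro!: mult_left_le_one_le)
  qed (use g meas in auto)
  moreover have "(\<integral>x. box_bump a c n x * g x \<partial>lebesgue_on D) = 0" for n
    using test[OF box_bump_test_function[OF ac], of n] by (simp add: ip_def mult.commute)
  ultimately show ?thesis by (simp add: LIMSEQ_const_iff)
qed

lemma integral_borel_eq_0_of_boxes:
  fixes f :: "'a::euclidean_space \<Rightarrow> real"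
  assumes f: "integrable lborel f" and A: "A \<in> sets borel"
    and boxes: "\<And>a b. (LINT x:box a b|lborel. f x) = 0" and tot: "(LINT x|lborel. f x) = 0"
  shows "(LINT x:A|lborel. f x) = 0"
proof -
  have "Int_stable (range (\<lambda>(a, b). box a b :: 'a set))"
    by (auto simp: Int_stable_def box_Int_box)
  moreover have "range (\<lambda>(a, b). box a b :: 'a set) \<subseteq> Pow UNIV" by auto
  moreover have "A \<in> sigma_sets UNIV (range (\<lambda>(a, b). box a b))"
    using A by (simp add: borel_eq_box)
  ultimately show ?thesis
  proof (induction rule: sigma_sets_induct_disjoint)
    case (basic A) then show ?case using boxes by auto
  next
    case empty then show ?case by (simp add: set_lebesgue_integral_def)
  next
    case (compl A)
    then have "A \<in> sets lborel" by (simp add: borel_eq_box)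
    then have "integrable lborel (\<lambda>x. indicat_real A x *\<^sub>R f x)"
      using f by (rule integrable_mult_indicator)
    moreover have "(\<lambda>x. indicat_real (UNIV - A) x *\<^sub>R f x) = (\<lambda>x. f x - indicat_real A x *\<^sub>R f x)"
      by (auto simp: indicator_def fun_eq_iff)
    ultimately have "(LINT x:UNIV - A|lborel. f x) = (LINT x|lborel. f x) - (LINT x:A|lborel. f x)"
      unfolding set_lebesgue_integral_def using f by (simp only: Bochner_Integration.integral_diff)
    then show ?case using compl tot by simp
  next
    case (union A)
    then have A: "A i \<in> sets lborel" for i by (auto simp: borel_eq_box)
    have "(LINT x:(\<Union>i. A i)|lborel. f x) = (\<Sum>i. LINT x:A i|lborel. f x)"
    proof (rule lebesgue_integral_countable_add)
      show "set_integrable lborel (\<Union>i. A i) f"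
        unfolding set_integrable_def using f A by (intro integrable_mult_indicator) auto
    qed (use A union in \<open>auto simp: disjoint_family_on_def\<close>)
    then show ?case using union by simp
  qed
qed

text \<open>
  By dominated convergence along the bumps, \<open>g\<close> has integral zero over every box whose closure lies in \<open>D\<close>.
  Inside one such box the boxes generate the Borel sets, so \<open>g\<close> vanishes almost everywhere there, and
  countably many of them cover \<open>D\<close>. The change to a Borel representative \<open>f'\<close> is made because the boxes generate
  only the Borel sets, not the Lebesgue measurable ones.
\<close>

theorem AE_eq_0_of_test_functions:
  fixes g :: "'a::euclidean_space \<Rightarrow> real"
  assumes D: "open D" and g: "integrable (lebesgue_on D) g"
    and test: "\<And>\<psi>. \<psi> \<in> test_functions D \<Longrightarrow> ip D g \<psi> = 0"
  shows "AE x in lebesgue_on D. g x = 0"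
proof -
  have DL: "D \<in> sets lebesgue" using D by auto
  have "AE x in lebesgue. x \<in> box a c \<longrightarrow> g x = 0" if ac: "cbox a c \<subseteq> D" for a c
  proof -
    define f where "f x = indicat_real (box a c) x * g x" for x
    have boxD: "box a c \<subseteq> D" using ac box_subset_cbox by blast
    have int_eq: "(\<integral>x. indicat_real B x * f x \<partial>lebesgue) = (\<integral>x. indicat_real (B \<inter> box a c) x * g x \<partial>lebesgue_on D)" for B
      unfolding f_def using DL boxD
      by (subst integral_restrict_space) (auto intro!: Bochner_Integration.integral_cong simp: indicator_def)
    have fint: "integrable lebesgue f"
    proof -
      have "integrable (lebesgue_on D) (\<lambda>x. indicat_real (box a c) x *\<^sub>R g x)"
        using boxD DL g by (intro integrable_mult_indicator) (auto simp: sets_restrict_space_iff)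
      then have "integrable lebesgue (\<lambda>x. indicat_real D x *\<^sub>R (indicat_real (box a c) x *\<^sub>R g x))"
        using DL by (subst (asm) integrable_restrict_space) auto
      moreover have "(\<lambda>x. indicat_real D x *\<^sub>R (indicat_real (box a c) x *\<^sub>R g x)) = f"
        using boxD by (intro ext) (auto simp: f_def indicator_def)
      ultimately show ?thesis by simp
    qed
    then obtain f' where f': "f' \<in> borel_measurable lborel" "AE x in lborel. f x = f' x"
      using completion_ex_borel_measurable_real[of f lborel] by auto
    have AE': "AE x in lebesgue. f x = f' x" using f'(2) by (rule AE_completion)
    have f'm: "f' \<in> borel_measurable lebesgue" using f'(1) by (rule measurable_completion)
    have "integrable lebesgue f'" using fint f'm AE' by (subst integrable_cong_AE[symmetric]) auto
    then have f'int: "integrable lborel f'" using f'(1) by (simp add: integrable_completion)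
    have int_f': "(LINT x:B|lborel. f' x) = (\<integral>x. indicat_real B x * f x \<partial>lebesgue)" if "B \<in> sets borel" for B
    proof -
      have "(LINT x:B|lborel. f' x) = (\<integral>x. indicat_real B x * f' x \<partial>lebesgue)"
        unfolding set_lebesgue_integral_def using f'(1) that by (subst integral_completion) auto
      also have "\<dots> = (\<integral>x. indicat_real B x * f x \<partial>lebesgue)"
      proof (rule integral_cong_AE)
        have B: "indicat_real B \<in> borel_measurable lebesgue"
          using that by (intro borel_measurable_indicator) simp
        show "(\<lambda>x. indicat_real B x * f' x) \<in> borel_measurable lebesgue"
          by (rule borel_measurable_times[OF B f'm])
        show "(\<lambda>x. indicat_real B x * f x) \<in> borel_measurable lebesgue"
          by (rule borel_measurable_times[OF B borel_measurable_integrable[OF fint]])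
        show "AE x in lebesgue. indicat_real B x * f' x = indicat_real B x * f x"
          using AE' by eventually_elim simp
      qed
      finally show ?thesis .
    qed
    have box0: "(\<integral>x. indicat_real (box p q \<inter> box a c) x * g x \<partial>lebesgue_on D) = 0" for p q
    proof (cases "box p q \<inter> box a c = {}")
      case False
      have "\<exists>u v. box p q \<inter> box a c = box u v" by (intro exI) (rule box_Int_box)
      then obtain u v where uv: "box p q \<inter> box a c = box u v" by blast
      with False have "box u v \<noteq> {}" by simp
      then have "closure (box u v) = cbox u v" by (rule closure_box)
      moreover have "closure (box u v) \<subseteq> cbox a c"
        using uv box_subset_cbox[of a c] by (intro closure_minimal) auto
      ultimately have "cbox u v \<subseteq> D" using ac by auto
      then show ?thesis unfolding uv using integral_box_eq_0[OF D g] test by blast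
    qed simp
    have "AE x in lborel. f' x = 0"
    proof (rule sigma_finite_measure.density_zero[OF lborel.sigma_finite_measure_axioms f'int])
      fix A :: "'a set" assume "A \<in> sets lborel"
      then have A: "A \<in> sets borel" by simp
      show "(LINT x:A|lborel. f' x) = 0"
      proof (rule integral_borel_eq_0_of_boxes[OF f'int A])
        show "(LINT x:box p q|lborel. f' x) = 0" for p q
          by (simp add: int_f' int_eq box0)
        have "(LINT x|lborel. f' x) = (LINT x:UNIV|lborel. f' x)" by (simp add: set_lebesgue_integral_def)
        also have "\<dots> = (\<integral>x. indicat_real UNIV x * f x \<partial>lebesgue)" by (rule int_f') simp
        also have "\<dots> = 0" unfolding int_eq using box0[of a c] by simp
        finally show "(LINT x|lborel. f' x) = 0" .
      qed
    qed
    then have "AE x in lebesgue. f' x = 0" by (rule AE_completion)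
    with AE' show ?thesis by eventually_elim (auto simp: f_def)
  qed
  then have cbox0: "AE x in lebesgue. x \<in> cbox a c \<longrightarrow> g x = 0" if "cbox a c \<subseteq> D" for a c
  proof -
    have "AE x in lebesgue. x \<notin> cbox a c - box a c"
      using negligible_frontier_interval[of a c] by (intro AE_not_in) (simp add: negligible_iff_null_sets)
    moreover have "AE x in lebesgue. x \<in> box a c \<longrightarrow> g x = 0"
      by (rule \<open>\<And>c a. cbox a c \<subseteq> D \<Longrightarrow> AE x in lebesgue. x \<in> box a c \<longrightarrow> g x = 0\<close>[OF that])
    ultimately show ?thesis by eventually_elim auto
  qed
  obtain \<D> where \<D>: "countable \<D>" "\<D> \<subseteq> Pow D" "\<And>X. X \<in> \<D> \<Longrightarrow> \<exists>a b. X = cbox a b" "\<Union>\<D> = D"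
    using open_countable_Union_open_cbox[OF D] by metis
  have "AE x in lebesgue. \<forall>X\<in>\<D>. x \<in> X \<longrightarrow> g x = 0"
  proof (subst AE_ball_countable[OF \<D>(1)], intro ballI)
    fix X assume "X \<in> \<D>"
    with \<D>(2,3) obtain a b where "X = cbox a b" "cbox a b \<subseteq> D" by blast
    then show "AE x in lebesgue. x \<in> X \<longrightarrow> g x = 0" using cbox0 by simp
  qed
  then have "AE x in lebesgue. x \<in> D \<longrightarrow> g x = 0" by eventually_elim (use \<D>(4) in blast)
  then show ?thesis using DL by (simp add: AE_restrict_space_iff)
qed

section \<open>The space \<open>L\<^sub>2\<close> and weak gradients on a bounded open set\<close>

locale bounded_open =
  fixes D :: "'a::euclidean_space set"
  assumes openD: "open D" and boundedD: "bounded D"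
begin

lemma D_lebesgue: "D \<in> sets lebesgue" using openD by auto

lemma finite_measure_D: "finite_measure (lebesgue_on D)"
  using openD boundedD by (intro finite_measure_lebesgue_on lmeasurable_open) auto

lemma L2_measurable: "f \<in> L2 D \<Longrightarrow> f \<in> borel_measurable (lebesgue_on D)"
  by (simp add: L2_def)

lemma L2_square: "f \<in> L2 D \<Longrightarrow> integrable (lebesgue_on D) (\<lambda>x. (f x)\<^sup>2)"
  by (simp add: L2_def)

lemma L2_mult: 
  assumes "f \<in> L2 D" "g \<in> L2 D"
  shows "integrable (lebesgue_on D) (\<lambda>x. f x * g x)"
proof (rule Bochner_Integration.integrable_bound)
  show "integrable (lebesgue_on D) (\<lambda>x. (f x)\<^sup>2 + (g x)\<^sup>2)"
    using assms by (intro Bochner_Integration.integrable_add L2_square)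
  show "(\<lambda>x. f x * g x) \<in> borel_measurable (lebesgue_on D)"
    using assms by (intro borel_measurable_times L2_measurable)
  have "\<bar>f x * g x\<bar> \<le> (f x)\<^sup>2 + (g x)\<^sup>2" for x
  proof -
    have "2 * \<bar>f x * g x\<bar> \<le> (f x)\<^sup>2 + (g x)\<^sup>2"
      using sum_squares_bound[of "\<bar>f x\<bar>" "\<bar>g x\<bar>"] by (simp add: abs_mult mult.assoc)
    then show ?thesis using abs_ge_zero[of "f x * g x"] by linarith
  qed
  then show "AE x in lebesgue_on D. norm (f x * g x) \<le> norm ((f x)\<^sup>2 + (g x)\<^sup>2)" by simp
qed

lemma L2_bounded:
  assumes "f \<in> borel_measurable (lebesgue_on D)" "\<And>x. x \<in> D \<Longrightarrow> \<bar>f x\<bar> \<le> B"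
  shows "f \<in> L2 D"
proof -
  have "integrable (lebesgue_on D) (\<lambda>x. (f x)\<^sup>2)"
  proof (rule finite_measure.integrable_const_bound[OF finite_measure_D, where B = "B\<^sup>2"])
    have "\<bar>f x\<bar>\<^sup>2 \<le> B\<^sup>2" if "x \<in> D" for x using assms(2)[OF that] by (intro power_mono) auto
    then show "AE x in lebesgue_on D. norm ((f x)\<^sup>2) \<le> B\<^sup>2" by (intro AE_I2) auto
  qed (use assms in auto)
  then show ?thesis using assms by (simp add: L2_def)
qed

lemma L2_const [simp]: "(\<lambda>x. c) \<in> L2 D"
  by (rule L2_bounded[of _ "\<bar>c\<bar>"]) auto

lemma L2_integrable: "f \<in> L2 D \<Longrightarrow> integrable (lebesgue_on D) f"
  using L2_mult[of f "\<lambda>x. 1"] by simp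

lemma L2_scale [intro]: "f \<in> L2 D \<Longrightarrow> (\<lambda>x. c * f x) \<in> L2 D"
  by (auto simp: L2_def power_mult_distrib)

lemma L2_add [intro]: "f \<in> L2 D \<Longrightarrow> g \<in> L2 D \<Longrightarrow> (\<lambda>x. f x + g x) \<in> L2 D"
  using L2_mult[of f g] by (auto simp: L2_def power2_sum mult.assoc)

lemma L2_diff [intro]: "f \<in> L2 D \<Longrightarrow> g \<in> L2 D \<Longrightarrow> (\<lambda>x. f x - g x) \<in> L2 D"
  using L2_add[OF _ L2_scale[of g "-1"]] by simp

lemma L2_sum [intro]: "(\<And>i. i \<in> A \<Longrightarrow> f i \<in> L2 D) \<Longrightarrow> (\<lambda>x. \<Sum>i\<in>A. f i x) \<in> L2 D"
  by (induction A rule: infinite_finite_induct) auto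

lemma ip_commute: "ip D f g = ip D g f" by (simp add: ip_def mult.commute)

lemma ip_scale_left: "ip D (\<lambda>x. c * f x) g = c * ip D f g"
  by (simp add: ip_def mult.assoc)

lemma ip_add_left: "f \<in> L2 D \<Longrightarrow> f' \<in> L2 D \<Longrightarrow> g \<in> L2 D \<Longrightarrow> ip D (\<lambda>x. f x + f' x) g = ip D f g + ip D f' g"
  by (simp add: ip_def distrib_right L2_mult)

lemma ip_diff_left: "f \<in> L2 D \<Longrightarrow> f' \<in> L2 D \<Longrightarrow> g \<in> L2 D \<Longrightarrow> ip D (\<lambda>x. f x - f' x) g = ip D f g - ip D f' g"
  by (simp add: ip_def left_diff_distrib L2_mult)

lemma ip_sum_left:
  "(\<And>i. i \<in> A \<Longrightarrow> f i \<in> L2 D) \<Longrightarrow> g \<in> L2 D \<Longrightarrow> ip D (\<lambda>x. \<Sum>i\<in>A. c i * f i x) g = (\<Sum>i\<in>A. c i * ip D (f i) g)"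
proof (induction A rule: infinite_finite_induct)
  case (insert i A)
  then show ?case by (simp add: ip_add_left L2_scale L2_sum ip_scale_left)
qed (simp_all add: ip_def)

lemma ip_sum_right:
  "(\<And>i. i \<in> A \<Longrightarrow> f i \<in> L2 D) \<Longrightarrow> g \<in> L2 D \<Longrightarrow> ip D g (\<lambda>x. \<Sum>i\<in>A. c i * f i x) = (\<Sum>i\<in>A. c i * ip D g (f i))"
  using ip_sum_left[of A f g c] by (simp add: ip_commute)

lemma ip_diff_right: "f \<in> L2 D \<Longrightarrow> f' \<in> L2 D \<Longrightarrow> g \<in> L2 D \<Longrightarrow> ip D g (\<lambda>x. f x - f' x) = ip D g f - ip D g f'"
  using ip_diff_left[of f f' g] by (simp add: ip_commute)

lemma ip_self_nonneg [simp]: "0 \<le> ip D f f" by (simp add: ip_def)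

lemma ip_cong_left:
  "ae_eq D f f' \<Longrightarrow> f \<in> L2 D \<Longrightarrow> f' \<in> L2 D \<Longrightarrow> g \<in> L2 D \<Longrightarrow> ip D f g = ip D f' g"
  unfolding ip_def ae_eq_def
  by (intro integral_cong_AE borel_measurable_times L2_measurable) auto

lemma nrm_sq: "(nrm D f)\<^sup>2 = ip D f f" by (simp add: nrm_def)

lemma nrm_nonneg [simp]: "0 \<le> nrm D f" by (simp add: nrm_def)

lemma nrm_minus_commute: "nrm D (\<lambda>x. f x - g x) = nrm D (\<lambda>x. g x - f x)"
  by (simp add: nrm_def ip_def algebra_simps)

text \<open>
  The inner product is only semidefinite on functions, so the degenerate case \<open>(g, g) = 0\<close> is not
  reducible to \<open>g = 0\<close>; it follows from the linearity in \<open>t\<close> of a nonnegative function.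
\<close>

lemma ip_le_nrm:
  assumes f: "f \<in> L2 D" and g: "g \<in> L2 D"
  shows "\<bar>ip D f g\<bar> \<le> nrm D f * nrm D g"
proof -
  have "0 \<le> ip D f f + 2 * t * ip D f g + t\<^sup>2 * ip D g g" for t
  proof -
    have "0 \<le> ip D (\<lambda>x. f x + t * g x) (\<lambda>x. f x + t * g x)" by simp
    also have "\<dots> = ip D f (\<lambda>x. f x + t * g x) + t * ip D g (\<lambda>x. f x + t * g x)"
      using f g by (simp add: ip_add_left L2_scale L2_add ip_scale_left)
    also have "ip D f (\<lambda>x. f x + t * g x) = ip D f f + t * ip D f g"
      using f g ip_add_left[of f "\<lambda>x. t * g x" f] by (simp add: L2_scale ip_scale_left ip_commute)
    also have "ip D g (\<lambda>x. f x + t * g x) = ip D f g + t * ip D g g"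
      using f g ip_add_left[of f "\<lambda>x. t * g x" g] by (simp add: L2_scale ip_scale_left ip_commute)
    finally show ?thesis by (simp add: algebra_simps power2_eq_square)
  qed
  then have q: "0 \<le> ip D f f + 2 * t * ip D f g + t\<^sup>2 * ip D g g" for t .
  have "(ip D f g)\<^sup>2 \<le> ip D f f * ip D g g"
  proof (cases "ip D g g = 0")
    case True
    have "ip D f g = 0"
    proof (rule ccontr)
      assume n: "ip D f g \<noteq> 0"
      have "0 \<le> ip D f f + 2 * (- (ip D f f + 1) / (2 * ip D f g)) * ip D f g" using q[of "- (ip D f f + 1) / (2 * ip D f g)"] True by simp
      also have "\<dots> = -1" using n by (simp add: field_simps)
      finally show False by simp
    qed
    then show ?thesis by simp
  next
    case False
    then have p: "ip D g g > 0" by (metis ip_self_nonneg less_eq_real_def)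
    have "0 \<le> ip D f f - (ip D f g)\<^sup>2 / ip D g g"
      using q[of "- ip D f g / ip D g g"] p by (simp add: power2_eq_square field_simps)
    then show ?thesis using p by (simp add: field_simps)
  qed
  then have "sqrt ((ip D f g)\<^sup>2) \<le> sqrt (ip D f f * ip D g g)" by (rule real_sqrt_le_mono)
  then show ?thesis by (simp add: nrm_def real_sqrt_mult)
qed

lemma nrm_add_sq:
  assumes f: "f \<in> L2 D" and g: "g \<in> L2 D"
  shows "(nrm D (\<lambda>x. f x + g x))\<^sup>2 = (nrm D f)\<^sup>2 + 2 * ip D f g + (nrm D g)\<^sup>2"
proof -
  have "ip D (\<lambda>x. f x + g x) (\<lambda>x. f x + g x) = ip D f (\<lambda>x. f x + g x) + ip D g (\<lambda>x. f x + g x)"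
    using f g by (intro ip_add_left) auto
  moreover have "ip D k (\<lambda>x. f x + g x) = ip D k f + ip D k g" if "k \<in> L2 D" for k
    using ip_add_left[OF f g that] by (simp add: ip_commute)
  ultimately show ?thesis using f g by (simp add: nrm_sq ip_commute)
qed

lemma nrm_triangle:
  assumes f: "f \<in> L2 D" and g: "g \<in> L2 D"
  shows "nrm D (\<lambda>x. f x + g x) \<le> nrm D f + nrm D g"
proof (rule power2_le_imp_le)
  show "(nrm D (\<lambda>x. f x + g x))\<^sup>2 \<le> (nrm D f + nrm D g)\<^sup>2"
    using nrm_add_sq[OF f g] ip_le_nrm[OF f g] by (simp add: power2_sum)
qed simp

lemma nrm_diff_le:
  assumes "f \<in> L2 D" "g \<in> L2 D"
  shows "\<bar>nrm D f - nrm D g\<bar> \<le> nrm D (\<lambda>x. f x - g x)"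
proof -
  have "nrm D f \<le> nrm D (\<lambda>x. f x - g x) + nrm D g"
    using nrm_triangle[of "\<lambda>x. f x - g x" g] assms by (simp add: L2_diff)
  moreover have "nrm D g \<le> nrm D (\<lambda>x. f x - g x) + nrm D f"
    using nrm_triangle[of "\<lambda>x. g x - f x" f] assms by (simp add: L2_diff nrm_minus_commute[of g])
  ultimately show ?thesis by simp
qed

lemma ip_tendsto_left:
  assumes "\<And>n. f n \<in> L2 D" "g \<in> L2 D" "w \<in> L2 D"
    and "(\<lambda>n. nrm D (\<lambda>x. w x - f n x)) \<longlonglongrightarrow> 0"
  shows "(\<lambda>n. ip D (f n) g) \<longlonglongrightarrow> ip D w g"
proof -
  have "(\<lambda>n. ip D w g - ip D (f n) g) \<longlonglongrightarrow> 0"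
  proof (rule Lim_null_comparison)
    show "\<forall>\<^sub>F n in sequentially. norm (ip D w g - ip D (f n) g) \<le> nrm D (\<lambda>x. w x - f n x) * nrm D g"
      using ip_le_nrm[of "\<lambda>x. w x - f n x" g for n] assms by (auto simp: ip_diff_left L2_diff)
    show "(\<lambda>n. nrm D (\<lambda>x. w x - f n x) * nrm D g) \<longlonglongrightarrow> 0" using tendsto_mult_right[OF assms(4), of "nrm D g"] by simp
  qed
  from tendsto_diff[OF tendsto_const[of "ip D w g"] this] show ?thesis by simp
qed

lemma test_function_L2:
  assumes "\<psi> \<in> test_functions D" and b: "b \<in> Basis"
  shows "\<psi> \<in> L2 D" "(\<lambda>x. frechet_derivative \<psi> (at x) b) \<in> L2 D"
proof -
  define S where "S = closure {x. \<psi> x \<noteq> 0}"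
  have S: "compact S" "closed S" and Ck: "Ck_on k UNIV \<psi>" for k
    using assms unfolding test_functions_def S_def by auto
  have L2_cont: "f \<in> L2 D" if c: "continuous_on UNIV f" and z: "\<And>x. x \<notin> S \<Longrightarrow> f x = 0" for f :: "'a \<Rightarrow> real"
  proof -
    have "bounded (f ` S)"
      by (intro compact_imp_bounded compact_continuous_image S continuous_on_subset[OF c]) auto
    then obtain B where B: "\<And>x. x \<in> S \<Longrightarrow> \<bar>f x\<bar> \<le> B" by (auto simp: bounded_iff)
    have "\<bar>f x\<bar> \<le> max B 0" for x
      by (cases "x \<in> S") (use B[of x] z[of x] in auto)
    moreover have "f \<in> borel_measurable (lebesgue_on D)"
      by (intro continuous_imp_measurable_on_sets_lebesgue continuous_on_subset[OF c] D_lebesgue) auto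
    ultimately show ?thesis by (intro L2_bounded)
  qed
  have zero: "\<psi> x = 0" if "x \<notin> S" for x using that closure_subset[of "{x. \<psi> x \<noteq> 0}"] unfolding S_def by auto
  show "\<psi> \<in> L2 D" using Ck[of 0] zero by (intro L2_cont) auto
  obtain f' where f': "\<And>x. (\<psi> has_derivative (\<lambda>v. f' x \<bullet> v)) (at x)"
    "\<And>b. b \<in> Basis \<Longrightarrow> Ck_on 0 UNIV (\<lambda>x. f' x \<bullet> b)" using Ck[of "Suc 0"] by auto
  have eq: "frechet_derivative \<psi> (at x) b = f' x \<bullet> b" for x
    using frechet_derivative_at[OF f'(1)[of x]] by metis
  show "(\<lambda>x. frechet_derivative \<psi> (at x) b) \<in> L2 D"
  proof (rule L2_cont)
    show "continuous_on UNIV (\<lambda>x. frechet_derivative \<psi> (at x) b)" using f'(2)[OF b] by (simp add: eq)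
    fix x assume x: "x \<notin> S"
    have "((\<lambda>x. 0) has_derivative (\<lambda>v. f' x \<bullet> v)) (at x)"
      by (rule has_derivative_transform_within_open[OF f'(1)[of x], of "- S"]) (use x S zero in auto)
    then have "(\<lambda>v. f' x \<bullet> v) = (\<lambda>v. 0)" using has_derivative_unique by (metis has_derivative_const)
    then show "frechet_derivative \<psi> (at x) b = 0" unfolding eq by metis
  qed
qed

lemma weak_deriv_unique:
  assumes "has_weak_deriv D b f g" "has_weak_deriv D b f g'" "b \<in> Basis"
  shows "ae_eq D g g'"
proof -
  have g: "g \<in> L2 D" "g' \<in> L2 D" using assms by (auto simp: has_weak_deriv_def)
  have "AE x in lebesgue_on D. g x - g' x = 0"
  proof (rule AE_eq_0_of_test_functions[OF openD])
    show "integrable (lebesgue_on D) (\<lambda>x. g x - g' x)" using g by (intro L2_integrable) auto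
    fix \<psi> assume \<psi>: "\<psi> \<in> test_functions D"
    show "ip D (\<lambda>x. g x - g' x) \<psi> = 0"
      using assms g \<psi> test_function_L2(1)[OF \<psi> assms(3)] by (simp add: ip_diff_left has_weak_deriv_def)
  qed
  then show ?thesis unfolding ae_eq_def by simp
qed

lemma H1_iff: "f \<in> sobolev D 1 \<longleftrightarrow> f \<in> L2 D \<and> (\<forall>b\<in>Basis. \<exists>g. has_weak_deriv D b f g)"
  by (auto simp: has_weak_deriv_def)

lemma H1_L2: "f \<in> sobolev D 1 \<Longrightarrow> f \<in> L2 D" by (simp add: H1_iff)

lemma H2_subset_H1: "f \<in> sobolev D 2 \<Longrightarrow> f \<in> sobolev D 1"
  by (auto simp: numeral_2_eq_2)

lemma wderiv_has_weak_deriv: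
  "f \<in> sobolev D 1 \<Longrightarrow> b \<in> Basis \<Longrightarrow> has_weak_deriv D b f (wderiv D b f)"
  unfolding wderiv_def H1_iff by (metis someI_ex)

lemma wderiv_L2: "f \<in> sobolev D 1 \<Longrightarrow> b \<in> Basis \<Longrightarrow> wderiv D b f \<in> L2 D"
  using wderiv_has_weak_deriv by (auto simp: has_weak_deriv_def)

text \<open>
  Stated for a function that equals a linear combination only almost everywhere, since elements of the discrete space
  are determined by their expansions in this sense.
\<close>

lemma weak_deriv_lincomb:
  assumes f: "\<And>i. i \<in> A \<Longrightarrow> f i \<in> sobolev D 1" and F: "F \<in> L2 D" "ae_eq D F (\<lambda>x. \<Sum>i\<in>A. c i * f i x)"
    and b: "b \<in> Basis"
  shows "has_weak_deriv D b F (\<lambda>x. \<Sum>i\<in>A. c i * wderiv D b (f i) x)"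
  unfolding has_weak_deriv_def
proof (intro conjI ballI)
  have w: "wderiv D b (f i) \<in> L2 D" if "i \<in> A" for i using f b that by (simp add: wderiv_L2)
  have fL: "f i \<in> L2 D" if "i \<in> A" for i using f that H1_L2 by blast
  show "(\<lambda>x. \<Sum>i\<in>A. c i * wderiv D b (f i) x) \<in> L2 D" by (intro L2_sum L2_scale w)
  fix \<psi> assume \<psi>: "\<psi> \<in> test_functions D"
  let ?d = "\<lambda>x. frechet_derivative \<psi> (at x) b"
  have "ip D F ?d = ip D (\<lambda>x. \<Sum>i\<in>A. c i * f i x) ?d"
    by (intro ip_cong_left F test_function_L2(2)[OF \<psi> b] L2_sum L2_scale fL)
  also have "\<dots> = (\<Sum>i\<in>A. c i * ip D (f i) ?d)"
    using fL test_function_L2(2)[OF \<psi> b] by (intro ip_sum_left)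
  also have "\<dots> = (\<Sum>i\<in>A. c i * - ip D (wderiv D b (f i)) \<psi>)"
    using wderiv_has_weak_deriv[OF f b] \<psi> by (intro sum.cong refl) (auto simp: has_weak_deriv_def)
  also have "\<dots> = - ip D (\<lambda>x. \<Sum>i\<in>A. c i * wderiv D b (f i) x) \<psi>"
    using w test_function_L2(1)[OF \<psi> b] by (subst ip_sum_left) (auto simp: sum_negf)
  finally show "ip D F ?d = - ip D (\<lambda>x. \<Sum>i\<in>A. c i * wderiv D b (f i) x) \<psi>" .
qed

lemma H1_lincomb:
  assumes "\<And>i. i \<in> A \<Longrightarrow> f i \<in> sobolev D 1" and "F \<in> L2 D" "ae_eq D F (\<lambda>x. \<Sum>i\<in>A. c i * f i x)"
  shows "F \<in> sobolev D 1"
  unfolding H1_iff using assms(2) weak_deriv_lincomb[OF assms] by blast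

lemma grad_ip_sum: 
  assumes "f \<in> sobolev D 1" "g \<in> sobolev D 1"
  shows "grad_ip D f g = (\<Sum>b\<in>Basis. ip D (wderiv D b f) (wderiv D b g))"
proof -
  have "grad D k x \<bullet> b = wderiv D b k x" if "b \<in> Basis" for b k x
    unfolding grad_def using that by simp
  then have "grad D f x \<bullet> grad D g x = (\<Sum>b\<in>Basis. wderiv D b f x * wderiv D b g x)" for x
    by (subst euclidean_inner) (intro sum.cong refl, simp)
  then have "grad_ip D f g = (\<integral>x. (\<Sum>b\<in>Basis. wderiv D b f x * wderiv D b g x) \<partial>lebesgue_on D)"
    unfolding grad_ip_def by (simp only:)
  also have "\<dots> = (\<Sum>b\<in>Basis. ip D (wderiv D b f) (wderiv D b g))"
    unfolding ip_def by (intro Bochner_Integration.integral_sum L2_mult wderiv_L2 assms)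
  finally show ?thesis .
qed

lemma grad_ip_commute: "grad_ip D f g = grad_ip D g f"
  by (simp add: grad_ip_def inner_commute)

lemma grad_ip_self_nonneg: "0 \<le> grad_ip D f f" by (simp add: grad_ip_def)

text \<open>
  The gradient is made from arbitrarily chosen weak derivatives, and it is their uniqueness almost everywhere that
  makes the gradient form bilinear.
\<close>

lemma grad_ip_lincomb_left:
  assumes f: "\<And>i. i \<in> A \<Longrightarrow> f i \<in> sobolev D 1" and F: "F \<in> L2 D" "ae_eq D F (\<lambda>x. \<Sum>i\<in>A. c i * f i x)"
    and g: "g \<in> sobolev D 1"
  shows "grad_ip D F g = (\<Sum>i\<in>A. c i * grad_ip D (f i) g)"
proof -
  have FH: "F \<in> sobolev D 1" by (rule H1_lincomb[OF f F])
  have "ip D (wderiv D b F) (wderiv D b g) = (\<Sum>i\<in>A. c i * ip D (wderiv D b (f i)) (wderiv D b g))"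
    if b: "b \<in> Basis" for b
  proof -
    have w: "wderiv D b (f i) \<in> L2 D" if "i \<in> A" for i using f b that by (simp add: wderiv_L2)
    have "ae_eq D (wderiv D b F) (\<lambda>x. \<Sum>i\<in>A. c i * wderiv D b (f i) x)"
      by (rule weak_deriv_unique[OF wderiv_has_weak_deriv[OF FH b] weak_deriv_lincomb[OF f F b] b])
    then have "ip D (wderiv D b F) (wderiv D b g) = ip D (\<lambda>x. \<Sum>i\<in>A. c i * wderiv D b (f i) x) (wderiv D b g)"
      by (intro ip_cong_left wderiv_L2 FH g b L2_sum L2_scale w)
    also have "\<dots> = (\<Sum>i\<in>A. c i * ip D (wderiv D b (f i)) (wderiv D b g))"
      by (intro ip_sum_left wderiv_L2 f g b)
    finally show ?thesis .
  qed
  then have "grad_ip D F g = (\<Sum>b\<in>Basis. \<Sum>i\<in>A. c i * ip D (wderiv D b (f i)) (wderiv D b g))"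
    unfolding grad_ip_sum[OF FH g] by (rule sum.cong[OF refl])
  also have "\<dots> = (\<Sum>i\<in>A. c i * grad_ip D (f i) g)"
    by (subst sum.swap) (intro sum.cong refl, simp only: grad_ip_sum[OF f g] sum_distrib_left)
  finally show ?thesis .
qed

lemma grad_ip_lincomb_right:
  assumes "\<And>i. i \<in> A \<Longrightarrow> f i \<in> sobolev D 1" "F \<in> L2 D" "ae_eq D F (\<lambda>x. \<Sum>i\<in>A. c i * f i x)" "g \<in> sobolev D 1"
  shows "grad_ip D g F = (\<Sum>i\<in>A. c i * grad_ip D g (f i))"
  using grad_ip_lincomb_left[OF assms] by (simp add: grad_ip_commute)

text \<open>
  The argument of Riesz and Fischer: a subsequence with \<open>\<parallel>f\<^sub>s\<^sub>(\<^sub>k\<^sub>+\<^sub>1\<^sub>) - f\<^sub>s\<^sub>(\<^sub>k\<^sub>)\<parallel> \<le> 2\<^sup>-\<^sup>k\<close> converges absolutely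
  almost everywhere, as \<open>L\<^sub>2\<close> norms dominate \<open>L\<^sub>1\<close> norms on a bounded set, and Fatou's lemma identifies the limit.
\<close>

theorem L2_complete:
  assumes f: "\<And>n. f n \<in> L2 D"
    and Cauchy: "\<And>e. e > 0 \<Longrightarrow> \<exists>M. \<forall>m\<ge>M. \<forall>n\<ge>M. nrm D (\<lambda>x. f m x - f n x) < e"
  shows "\<exists>w. w \<in> L2 D \<and> (\<lambda>n. nrm D (\<lambda>x. w x - f n x)) \<longlonglongrightarrow> 0"
proof -
  let ?M = "lebesgue_on D"
  have [measurable]: "f n \<in> borel_measurable ?M" for n using f by (rule L2_measurable)
  have "\<forall>k. \<exists>M. \<forall>m\<ge>M. \<forall>n\<ge>M. nrm D (\<lambda>x. f m x - f n x) < (1/2)^k" using Cauchy by simp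
  then obtain N where N: "\<And>k m n. m \<ge> N k \<Longrightarrow> n \<ge> N k \<Longrightarrow> nrm D (\<lambda>x. f m x - f n x) < (1/2)^k"
    by metis
  \<comment> \<open>partial sums make the chosen indices monotone\<close>
  define s where "s k = (\<Sum>i\<le>k. N i)" for k
  have s: "N k \<le> s j" if "k \<le> j" for k j
    unfolding s_def using that by (intro member_le_sum) auto
  define d where "d k x = f (s (Suc k)) x - f (s k) x" for k x
  have d: "d k \<in> L2 D" for k unfolding d_def[abs_def] using f by auto
  have [measurable]: "d k \<in> borel_measurable ?M" for k using d by (rule L2_measurable)
  have dn: "nrm D (d k) \<le> (1/2)^k" for k
    unfolding d_def[abs_def] using N[of k "s (Suc k)" "s k"] s by (simp add: less_imp_le)
  have d_int: "(\<integral>\<^sup>+x. ennreal \<bar>d k x\<bar> \<partial>?M) \<le> ennreal ((1/2)^k * nrm D (\<lambda>x. 1))" for k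
  proof -
    have abs: "(\<lambda>x. \<bar>d k x\<bar>) \<in> L2 D" using d[of k] by (auto simp: L2_def)
    have "(\<integral>\<^sup>+x. ennreal \<bar>d k x\<bar> \<partial>?M) = ennreal (\<integral>x. \<bar>d k x\<bar> \<partial>?M)"
      by (rule nn_integral_eq_integral) (use L2_integrable[OF abs] in auto)
    also have "(\<integral>x. \<bar>d k x\<bar> \<partial>?M) = ip D (\<lambda>x. \<bar>d k x\<bar>) (\<lambda>x. 1)" by (simp add: ip_def)
    also have "\<dots> \<le> nrm D (\<lambda>x. \<bar>d k x\<bar>) * nrm D (\<lambda>x. 1)"
      using ip_le_nrm[OF abs L2_const[of 1]] by linarith
    also have "nrm D (\<lambda>x. \<bar>d k x\<bar>) = nrm D (d k)" by (simp add: nrm_def ip_def)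
    also have "nrm D (d k) * nrm D (\<lambda>x. 1) \<le> (1/2)^k * nrm D (\<lambda>x. 1)"
      by (intro mult_right_mono dn) simp
    finally show ?thesis by (simp add: ennreal_leI)
  qed
  have "(\<integral>\<^sup>+x. (\<Sum>k. ennreal \<bar>d k x\<bar>) \<partial>?M) = (\<Sum>k. \<integral>\<^sup>+x. ennreal \<bar>d k x\<bar> \<partial>?M)"
    by (rule nn_integral_suminf) measurable
  also have "\<dots> \<le> (\<Sum>k. ennreal ((1/2)^k * nrm D (\<lambda>x. 1)))"
    by (intro suminf_le d_int) auto
  also have "\<dots> = ennreal (\<Sum>k. (1/2)^k * nrm D (\<lambda>x. 1))"
    by (intro suminf_ennreal2) (auto intro!: summable_mult2 summable_geometric)
  also have "\<dots> < \<infinity>" by simp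
  finally have "(\<integral>\<^sup>+x. (\<Sum>k. ennreal \<bar>d k x\<bar>) \<partial>?M) \<noteq> \<infinity>" by simp
  then have "AE x in ?M. (\<Sum>k. ennreal \<bar>d k x\<bar>) \<noteq> \<infinity>"
    by (intro nn_integral_PInf_AE) measurable
  then have conv: "AE x in ?M. convergent (\<lambda>k. f (s k) x)"
  proof eventually_elim
    case (elim x)
    then have "summable (\<lambda>k. \<bar>d k x\<bar>)" by (intro summable_suminf_not_top) auto
    then have "summable (\<lambda>k. d k x)" by (rule summable_rabs_cancel)
    then have "convergent (\<lambda>n. \<Sum>k<n. d k x)" by (simp add: summable_iff_convergent)
    then have "convergent (\<lambda>n. f (s 0) x + (\<Sum>k<n. d k x))" by (simp add: convergent_add_const_iff)
    moreover have "f (s 0) x + (\<Sum>k<n. d k x) = f (s n) x" for n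
      unfolding d_def by (subst sum_lessThan_telescope) simp
    ultimately show ?case by simp
  qed
  define w where "w x = lim (\<lambda>k. f (s k) x)" for x
  have [measurable]: "w \<in> borel_measurable ?M"
    unfolding w_def[abs_def] by (rule borel_measurable_lim_metric) measurable
  have w_lim: "AE x in ?M. (\<lambda>k. f (s k) x) \<longlonglongrightarrow> w x"
    using conv by eventually_elim (simp add: w_def convergent_LIMSEQ_iff)
  have key: "(\<lambda>x. w x - f m x) \<in> L2 D \<and> nrm D (\<lambda>x. w x - f m x) \<le> (1/2)^K" if m: "m \<ge> N K" for m K
  proof -
    have "(\<integral>\<^sup>+x. ennreal ((w x - f m x)\<^sup>2) \<partial>?M) = (\<integral>\<^sup>+x. liminf (\<lambda>k. ennreal ((f (s k) x - f m x)\<^sup>2)) \<partial>?M)"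
    proof (rule nn_integral_cong_AE)
      show "AE x in ?M. ennreal ((w x - f m x)\<^sup>2) = liminf (\<lambda>k. ennreal ((f (s k) x - f m x)\<^sup>2))"
        using w_lim
      proof eventually_elim
        case (elim x)
        then have "(\<lambda>k. ennreal ((f (s k) x - f m x)\<^sup>2)) \<longlonglongrightarrow> ennreal ((w x - f m x)\<^sup>2)"
          by (intro tendsto_ennrealI tendsto_intros)
        then show ?case by (intro lim_imp_Liminf[symmetric]) simp
      qed
    qed
    also have "\<dots> \<le> liminf (\<lambda>k. \<integral>\<^sup>+x. ennreal ((f (s k) x - f m x)\<^sup>2) \<partial>?M)"
      by (rule nn_integral_liminf) measurable
    also have "\<dots> \<le> ennreal (((1/2)^K)\<^sup>2)"
    proof (rule Liminf_le)
      show "\<forall>\<^sub>F k in sequentially. (\<integral>\<^sup>+x. ennreal ((f (s k) x - f m x)\<^sup>2) \<partial>?M) \<le> ennreal (((1/2)^K)\<^sup>2)"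
        using eventually_ge_at_top[of K]
      proof eventually_elim
        case (elim k)
        have "(\<integral>\<^sup>+x. ennreal ((f (s k) x - f m x)\<^sup>2) \<partial>?M) = ennreal (\<integral>x. (f (s k) x - f m x)\<^sup>2 \<partial>?M)"
          by (rule nn_integral_eq_integral) (use f in \<open>auto intro!: L2_square\<close>)
        also have "(\<integral>x. (f (s k) x - f m x)\<^sup>2 \<partial>?M) = (nrm D (\<lambda>x. f (s k) x - f m x))\<^sup>2"
          unfolding nrm_sq ip_def by (simp only: power2_eq_square)
        also have "\<dots> \<le> ((1/2)^K)\<^sup>2"
          using N[of K "s k" m] s[OF elim] m by (intro power_mono) (auto simp: less_imp_le)
        finally show ?case by (simp add: ennreal_leI)
      qed
    qed simp
    finally have le: "(\<integral>\<^sup>+x. ennreal ((w x - f m x)\<^sup>2) \<partial>?M) \<le> ennreal (((1/2)^K)\<^sup>2)" .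
    then have int: "integrable ?M (\<lambda>x. (w x - f m x)\<^sup>2)"
      by (intro integrableI_nonneg) (auto intro: le_less_trans)
    then have L2: "(\<lambda>x. w x - f m x) \<in> L2 D" by (simp add: L2_def)
    have "ennreal (\<integral>x. (w x - f m x)\<^sup>2 \<partial>?M) \<le> ennreal (((1/2)^K)\<^sup>2)"
      using le nn_integral_eq_integral[OF int] by simp
    then have "(nrm D (\<lambda>x. w x - f m x))\<^sup>2 \<le> ((1/2)^K)\<^sup>2"
      unfolding nrm_sq ip_def by (simp flip: power2_eq_square)
    then have "nrm D (\<lambda>x. w x - f m x) \<le> (1/2)^K" by (rule power2_le_imp_le) simp
    with L2 show ?thesis by simp
  qed
  have "w \<in> L2 D" using L2_add[OF conjunct1[OF key[where K = 0 and m = "N 0"]] f[of "N 0"]] by simp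
  moreover have "(\<lambda>n. nrm D (\<lambda>x. w x - f n x)) \<longlonglongrightarrow> 0"
  proof (rule LIMSEQ_I)
    fix e :: real assume "e > 0"
    then obtain K where "(1/2)^K < e" using real_arch_pow_inv[of e "1/2"] by auto
    then have "norm (nrm D (\<lambda>x. w x - f n x) - 0) < e" if "n \<ge> N K" for n
      using key[OF that] by simp
    then show "\<exists>no. \<forall>n\<ge>no. norm (nrm D (\<lambda>x. w x - f n x) - 0) < e" by blast
  qed
  ultimately show ?thesis by blast
qed

end

section \<open>The discrete problem in the coordinates of the eigenbases\<close>

text \<open>
  The setting for one fixed \<open>h\<close>. The bound of the Ritz error has a nonnegative constant \<open>K\<close>, which later is the same
  for all \<open>h\<close>.
\<close>

locale semidiscretization = bounded_open D for D :: "'a::euclidean_space set" +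
  fixes lam :: "nat \<Rightarrow> real" and phi :: "nat \<Rightarrow> 'a \<Rightarrow> real"
    and V :: "('a \<Rightarrow> real) set" and N :: nat and mu :: "nat \<Rightarrow> real" and psi :: "nat \<Rightarrow> 'a \<Rightarrow> real"
    and K h R :: real
  assumes eigenbasis: "neumann_eigenbasis D lam phi"
    and V_subspace: "fin_dim_subspace D V"
    and V_H1: "V \<subseteq> sobolev D 1"
    and disc_eigenbasis: "disc_eigenbasis D V N mu psi"
    and psi_0: "ae_eq D (psi 0) (phi 0)"
    and h_pos: "0 < h" and K_nonneg: "0 \<le> K" and R2: "2 \<le> R"
    and ritz_bound: "\<And>\<beta> v. 1 \<le> \<beta> \<Longrightarrow> \<beta> \<le> R \<Longrightarrow> v \<in> Hdot D lam phi \<beta> \<Longrightarrow>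
      nrm D (\<lambda>x. ritz D V v x - v x) \<le> K * h powr \<beta> * snorm D lam phi \<beta> v"
begin

lemma phi_dom: "phi j \<in> dom_A D"
  and phi_eq: "ae_eq D (op_A D (phi j)) (\<lambda>x. lam j * phi j x)"
  and phi_ortho: "ip D (phi i) (phi j) = (if i = j then 1 else 0)"
  and phi_complete: "f \<in> L2 D \<Longrightarrow> (\<lambda>n. nrm D (\<lambda>x. f x - (\<Sum>j<n. ip D f (phi j) * phi j x))) \<longlonglongrightarrow> 0"
  and lam_1: "0 < lam 1"
  and phi_0: "ae_eq D (phi 0) (\<lambda>x. measure lebesgue D powr (- (1 / 2)))"
  using eigenbasis by (auto simp: neumann_eigenbasis_def)

lemma lam_ge: "1 \<le> j \<Longrightarrow> lam 1 \<le> lam j"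
proof (induction j rule: dec_induct)
  case (step j)
  then have "lam j \<le> lam (Suc j)" using eigenbasis by (auto simp: neumann_eigenbasis_def)
  then show ?case using step by simp
qed simp

lemma lam_pos: "1 \<le> j \<Longrightarrow> 0 < lam j" using lam_ge lam_1 by fastforce

lemma phi_H2: "phi j \<in> sobolev D 2" using phi_dom by (auto simp: dom_A_def)
lemma phi_H1: "phi j \<in> sobolev D 1" by (rule H2_subset_H1[OF phi_H2])
lemma phi_L2 [simp]: "phi j \<in> L2 D" by (rule H1_L2[OF phi_H1])

lemma laplacian_L2:
  assumes "f \<in> sobolev D 2" shows "laplacian D f \<in> L2 D"
proof -
  have f1: "f \<in> sobolev D 1" by (rule H2_subset_H1[OF assms])
  have "wderiv D b f \<in> sobolev D 1" if b: "b \<in> Basis" for b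
  proof -
    \<comment> \<open>a derivative in \<open>H\<^sup>1\<close> exists, and the chosen one agrees with it almost everywhere\<close>
    obtain g where g: "g \<in> sobolev D 1" "has_weak_deriv D b f g"
      using assms b by (auto simp: numeral_2_eq_2)
    have "ae_eq D (wderiv D b f) g"
      by (rule weak_deriv_unique[OF wderiv_has_weak_deriv[OF f1 b] g(2) b])
    then show ?thesis
      using H1_lincomb[of "{0::nat}" "\<lambda>_. g" "wderiv D b f" "\<lambda>_. 1"] g(1) wderiv_L2[OF f1 b] by simp
  qed
  then show ?thesis unfolding laplacian_def[abs_def] by (intro L2_sum wderiv_L2)
qed

text \<open>
  Green's formula for an eigenfunction. It is the defining property of the Neumann condition, so no trace theorem
  is involved; what has to be seen is that the Laplacian is an \<open>L\<^sub>2\<close> function, which needs the uniqueness of weak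
  derivatives, because the chosen first derivative must itself be in \<open>H\<^sup>1\<close>.
\<close>

lemma grad_ip_phi:
  assumes "\<eta> \<in> sobolev D 1" shows "grad_ip D (phi j) \<eta> = lam j * ip D (phi j) \<eta>"
proof -
  have "ip D (laplacian D (phi j)) \<eta> + grad_ip D (phi j) \<eta> = 0"
    using phi_dom[of j] assms by (auto simp: dom_A_def normal_deriv_def)
  moreover have "ae_eq D (laplacian D (phi j)) (\<lambda>x. - lam j * phi j x)"
    using phi_eq[of j] unfolding ae_eq_def op_A_def by eventually_elim simp
  then have "ip D (laplacian D (phi j)) \<eta> = ip D (\<lambda>x. - lam j * phi j x) \<eta>"
    by (intro ip_cong_left laplacian_L2 phi_H2 L2_scale phi_L2 H1_L2[OF assms])
  ultimately show ?thesis by (simp add: ip_scale_left[of "- lam j", simplified])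
qed

lemma V_L2: "\<xi> \<in> V \<Longrightarrow> \<xi> \<in> L2 D" using V_H1 H1_L2 by blast

lemma V_scale: "f \<in> V \<Longrightarrow> (\<lambda>x. c * f x) \<in> V"
proof -
  assume f: "f \<in> V"
  obtain B where B: "V = {f \<in> L2 D. \<exists>c. ae_eq D f (\<lambda>x. \<Sum>b\<in>B. c b * b x)}"
    using V_subspace by (auto simp: fin_dim_subspace_def)
  obtain c' where c': "ae_eq D f (\<lambda>x. \<Sum>b\<in>B. c' b * b x)" using f B by auto
  then have "ae_eq D (\<lambda>x. c * f x) (\<lambda>x. \<Sum>b\<in>B. (c * c' b) * b x)"
    unfolding ae_eq_def by eventually_elim (simp add: sum_distrib_left mult.assoc)
  then show ?thesis using B f V_L2[OF f] by (auto intro!: exI[of _ "\<lambda>b. c * c' b"])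
qed

lemma V_add: "f \<in> V \<Longrightarrow> g \<in> V \<Longrightarrow> (\<lambda>x. f x + g x) \<in> V"
proof -
  assume f: "f \<in> V" and g: "g \<in> V"
  obtain B where B: "V = {f \<in> L2 D. \<exists>c. ae_eq D f (\<lambda>x. \<Sum>b\<in>B. c b * b x)}"
    using V_subspace by (auto simp: fin_dim_subspace_def)
  obtain c' c'' where "ae_eq D f (\<lambda>x. \<Sum>b\<in>B. c' b * b x)" "ae_eq D g (\<lambda>x. \<Sum>b\<in>B. c'' b * b x)"
    using f g B by auto
  then have "ae_eq D (\<lambda>x. f x + g x) (\<lambda>x. \<Sum>b\<in>B. (c' b + c'' b) * b x)"
    unfolding ae_eq_def by eventually_elim (simp add: sum.distrib distrib_right)
  then show ?thesis using B V_L2[OF f] V_L2[OF g] by (auto intro!: exI[of _ "\<lambda>b. c' b + c'' b"])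
qed

lemma psi_V: "j \<le> N \<Longrightarrow> psi j \<in> V"
  and psi_eq: "j \<le> N \<Longrightarrow> ae_eq D (disc_A D V (psi j)) (\<lambda>x. mu j * psi j x)"
  and psi_ortho: "i \<le> N \<Longrightarrow> j \<le> N \<Longrightarrow> ip D (psi i) (psi j) = (if i = j then 1 else 0)"
  and psi_expand: "\<xi> \<in> V \<Longrightarrow> ae_eq D \<xi> (\<lambda>x. \<Sum>j\<le>N. ip D \<xi> (psi j) * psi j x)"
  using disc_eigenbasis by (auto simp: disc_eigenbasis_def)

lemma mu_pos: "1 \<le> i \<Longrightarrow> i \<le> N \<Longrightarrow> 0 < mu i"
  using disc_eigenbasis unfolding disc_eigenbasis_def by (metis le_trans less_le_trans order_refl)

lemma psi_L2 [simp]: "j \<le> N \<Longrightarrow> psi j \<in> L2 D" using V_L2 psi_V by blast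
lemma psi_H1: "j \<le> N \<Longrightarrow> psi j \<in> sobolev D 1" using V_H1 psi_V by blast

lemma V_lincomb: "A \<subseteq> {..N} \<Longrightarrow> (\<lambda>x. \<Sum>i\<in>A. c i * psi i x) \<in> V"
proof -
  assume A: "A \<subseteq> {..N}"
  then have "finite A" using finite_subset by blast
  then show ?thesis using A
  proof (induction A)
    case empty
    show ?case using V_scale[OF psi_V[of 0], of 0] by simp
  next
    case (insert i A)
    then show ?case using V_add[OF V_scale[OF psi_V[of i], of "c i"], of "\<lambda>x. \<Sum>i\<in>A. c i * psi i x"] by simp
  qed
qed

text \<open>
  Both lowest eigenfunctions are the same nonzero constant, so having mean zero means being orthogonal to
  them. The constant is nonzero because eigenfunctions are normalized.
\<close>

lemma psi_0_const: obtains c where "c \<noteq> 0" "\<And>v. v \<in> L2 D \<Longrightarrow> ip D v (psi 0) = c * ip D v (\<lambda>x. 1)"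
  "\<And>v. v \<in> L2 D \<Longrightarrow> ip D v (phi 0) = c * ip D v (\<lambda>x. 1)"
proof -
  \<comment> \<open>the normalizing constant of the lowest eigenfunction\<close>
  define c where "c = measure lebesgue D powr (- (1 / 2))"
  have p: "ip D v (phi 0) = c * ip D v (\<lambda>x. 1)" if "v \<in> L2 D" for v
  proof -
    have "ip D (phi 0) v = ip D (\<lambda>x. c) v"
      using phi_0 that unfolding c_def by (intro ip_cong_left) auto
    also have "\<dots> = c * ip D (\<lambda>x. 1) v" using ip_scale_left[of c "\<lambda>x. 1" v] by simp
    finally show ?thesis by (simp add: ip_commute)
  qed
  moreover have "ip D v (psi 0) = ip D v (phi 0)" if "v \<in> L2 D" for v
    using ip_cong_left[OF psi_0 _ _ that] by (simp add: ip_commute)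
  moreover have "c \<noteq> 0"
  proof
    assume "c = 0"
    then show False using p[of "phi 0"] phi_ortho[of 0 0] by simp
  qed
  ultimately show ?thesis using that[of c] by simp
qed

lemma zero_mean_phi_0: "v \<in> L2_zero_mean D \<Longrightarrow> ip D v (phi 0) = 0"
  and zero_mean_psi_0: "v \<in> L2_zero_mean D \<Longrightarrow> ip D v (psi 0) = 0"
  by (rule psi_0_const, simp add: L2_zero_mean_def)+

lemma zero_mean_iff: "\<xi> \<in> zero_mean D V \<longleftrightarrow> \<xi> \<in> V \<and> ip D \<xi> (psi 0) = 0"
  by (rule psi_0_const) (use V_L2 in \<open>auto simp: zero_mean_def\<close>)

lemma psi_zero_mean: "1 \<le> i \<Longrightarrow> i \<le> N \<Longrightarrow> psi i \<in> zero_mean D V"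
  by (simp add: zero_mean_iff psi_V psi_ortho)

lemma sum_atMost_split: "(\<Sum>i\<le>N. f i) = f 0 + (\<Sum>i=1..N. f i :: real)"
  by (simp add: atMost_atLeast0 sum.atLeast_Suc_atMost)

lemma ip_V_expand:
  assumes "\<xi> \<in> V" "v \<in> L2 D"
  shows "ip D \<xi> v = (\<Sum>i\<le>N. ip D \<xi> (psi i) * ip D (psi i) v)"
proof -
  have "(\<lambda>x. \<Sum>j\<le>N. ip D \<xi> (psi j) * psi j x) \<in> L2 D" by (intro L2_sum L2_scale psi_L2) simp
  then have "ip D \<xi> v = ip D (\<lambda>x. \<Sum>j\<le>N. ip D \<xi> (psi j) * psi j x) v"
    by (rule ip_cong_left[OF psi_expand[OF assms(1)] V_L2[OF assms(1)] _ assms(2)])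
  also have "\<dots> = (\<Sum>i\<le>N. ip D \<xi> (psi i) * ip D (psi i) v)"
    by (intro ip_sum_left assms) simp
  finally show ?thesis .
qed

lemma ip_zero_mean_expand:
  assumes "\<xi> \<in> zero_mean D V" "v \<in> L2 D"
  shows "ip D \<xi> v = (\<Sum>i=1..N. ip D \<xi> (psi i) * ip D (psi i) v)"
  using ip_V_expand[of \<xi> v] assms by (simp add: zero_mean_iff sum_atMost_split)

lemma ip_lincomb_psi:
  assumes "A \<subseteq> {..N}" "k \<le> N"
  shows "ip D (\<lambda>x. \<Sum>i\<in>A. c i * psi i x) (psi k) = (if k \<in> A then c k else 0)"
proof -
  have A: "finite A" using assms finite_subset by blast
  have "ip D (\<lambda>x. \<Sum>i\<in>A. c i * psi i x) (psi k) = (\<Sum>i\<in>A. c i * ip D (psi i) (psi k))"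
    using assms by (intro ip_sum_left) auto
  also have "\<dots> = (\<Sum>i\<in>A. if i = k then c k else 0)"
    by (intro sum.cong refl) (use assms in \<open>auto simp: psi_ortho\<close>)
  finally show ?thesis using A by simp
qed

lemma grad_ip_V_expand:
  assumes "\<xi> \<in> sobolev D 1" "\<eta> \<in> zero_mean D V"
  shows "grad_ip D \<xi> \<eta> = (\<Sum>i=1..N. ip D \<eta> (psi i) * grad_ip D \<xi> (psi i))"
proof -
  have \<eta>: "\<eta> \<in> V" "ip D \<eta> (psi 0) = 0" using assms by (auto simp: zero_mean_iff)
  have "grad_ip D \<xi> \<eta> = (\<Sum>i\<le>N. ip D \<eta> (psi i) * grad_ip D \<xi> (psi i))"
    by (rule grad_ip_lincomb_right[OF _ V_L2[OF \<eta>(1)] psi_expand[OF \<eta>(1)] assms(1)]) (rule psi_H1, simp)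
  then show ?thesis using \<eta> by (simp add: sum_atMost_split)
qed

text \<open>
  Existence of the discrete Laplacian. The Riesz representative is written down in the discrete eigenbasis, which needs
  the linearity of the gradient form.
\<close>

lemma disc_A_props:
  assumes "\<xi> \<in> V"
  shows "disc_A D V \<xi> \<in> zero_mean D V \<and> (\<forall>\<eta>\<in>zero_mean D V. ip D (disc_A D V \<xi>) \<eta> = grad_ip D \<xi> \<eta>)"
proof -
  let ?w = "\<lambda>x. \<Sum>i=1..N. grad_ip D \<xi> (psi i) * psi i x"
  have "?w \<in> zero_mean D V \<and> (\<forall>\<eta>\<in>zero_mean D V. ip D ?w \<eta> = grad_ip D \<xi> \<eta>)"
  proof
    show "?w \<in> zero_mean D V"
      unfolding zero_mean_iff using V_lincomb[of "{1..N}"] ip_lincomb_psi[of "{1..N}" 0] by auto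
    show "\<forall>\<eta>\<in>zero_mean D V. ip D ?w \<eta> = grad_ip D \<xi> \<eta>"
    proof
      fix \<eta> assume \<eta>: "\<eta> \<in> zero_mean D V"
      then have "\<eta> \<in> L2 D" using V_L2 by (simp add: zero_mean_def)
      then have "ip D ?w \<eta> = (\<Sum>i=1..N. grad_ip D \<xi> (psi i) * ip D (psi i) \<eta>)"
        by (intro ip_sum_left) auto
      then show "ip D ?w \<eta> = grad_ip D \<xi> \<eta>"
        using grad_ip_V_expand[OF _ \<eta>, of \<xi>] assms V_H1 by (simp add: ip_commute mult.commute subset_iff)
    qed
  qed
  then have "\<exists>w. w \<in> zero_mean D V \<and> (\<forall>\<eta>\<in>zero_mean D V. ip D w \<eta> = grad_ip D \<xi> \<eta>)" by blast
  from someI_ex[OF this] show ?thesis unfolding disc_A_def .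
qed

lemma grad_ip_psi:
  assumes "i \<le> N" "\<eta> \<in> zero_mean D V"
  shows "grad_ip D (psi i) \<eta> = mu i * ip D (psi i) \<eta>"
proof -
  have "\<eta> \<in> L2 D" using assms V_L2 by (simp add: zero_mean_def)
  then have "ip D (disc_A D V (psi i)) \<eta> = ip D (\<lambda>x. mu i * psi i x) \<eta>"
    using disc_A_props[OF psi_V[OF assms(1)]] assms(1)
    by (intro ip_cong_left psi_eq L2_scale) (auto simp: zero_mean_def V_L2)
  then show ?thesis
    using disc_A_props[OF psi_V[OF assms(1)]] assms(2) by (simp add: ip_scale_left)
qed

lemma ip_phi_sum:
  assumes "finite J"
  shows "ip D (\<lambda>x. \<Sum>j\<in>J. a j * phi j x) (phi k) = (if k \<in> J then a k else 0)"
proof -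
  have "ip D (\<lambda>x. \<Sum>j\<in>J. a j * phi j x) (phi k) = (\<Sum>j\<in>J. a j * ip D (phi j) (phi k))"
    by (intro ip_sum_left) auto
  also have "\<dots> = (\<Sum>j\<in>J. if j = k then a k else 0)" by (intro sum.cong refl) (auto simp: phi_ortho)
  finally show ?thesis using assms by simp
qed

lemma phi_sum_L2: "(\<lambda>x. \<Sum>j\<in>J. a j * phi j x) \<in> L2 D"
  by (intro L2_sum L2_scale phi_L2)

lemma nrm_phi_sum:
  assumes "finite J" shows "(nrm D (\<lambda>x. \<Sum>j\<in>J. a j * phi j x))\<^sup>2 = sqs J a"
  unfolding nrm_sq ip_sum_left[OF phi_L2 phi_sum_L2] ip_commute[of "phi _"] ip_phi_sum[OF assms]
  by (simp add: sqs_def power2_eq_square)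

text \<open>
  Pythagoras: the distance to the projection of \<open>v\<close> and the distance of \<open>v\<close> to the discrete space.
\<close>

lemma dist_to_V:
  assumes w: "w \<in> zero_mean D V" and v: "v \<in> L2 D"
  shows "(nrm D (\<lambda>x. w x - v x))\<^sup>2
    = sqs {1..N} (\<lambda>i. ip D w (psi i) - ip D (psi i) v) + ((nrm D v)\<^sup>2 - sqs {1..N} (\<lambda>i. ip D (psi i) v))"
proof -
  have wL: "w \<in> L2 D" using w V_L2 by (simp add: zero_mean_def)
  have "(nrm D (\<lambda>x. w x - v x))\<^sup>2 = ip D w w - 2 * ip D w v + ip D v v"
    using w v wL by (simp add: nrm_sq ip_diff_left ip_diff_right L2_diff ip_commute)
  also have "ip D w w = (\<Sum>i=1..N. ip D w (psi i) * ip D w (psi i))"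
    using ip_zero_mean_expand[OF w wL] by (simp add: ip_commute)
  also have "ip D w v = (\<Sum>i=1..N. ip D w (psi i) * ip D (psi i) v)"
    by (rule ip_zero_mean_expand[OF w v])
  finally have "(nrm D (\<lambda>x. w x - v x))\<^sup>2 = (\<Sum>i=1..N. ip D w (psi i) * ip D w (psi i))
      - 2 * (\<Sum>i=1..N. ip D w (psi i) * ip D (psi i) v) + (nrm D v)\<^sup>2" by (simp add: nrm_sq)
  moreover have "sqs {1..N} (\<lambda>i. x i - y i) = (\<Sum>i=1..N. x i * x i) - 2 * (\<Sum>i=1..N. x i * y i) + sqs {1..N} y"
    for x y :: "nat \<Rightarrow> real"
  proof -
    have "(x i - y i)\<^sup>2 = x i * x i - 2 * (x i * y i) + (y i)\<^sup>2" for i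
      by (simp add: power2_eq_square algebra_simps)
    then show ?thesis unfolding sqs_def by (simp only: sum.distrib sum_subtractf sum_distrib_left)
  qed
  ultimately show ?thesis by simp
qed

definition m :: "nat \<Rightarrow> nat \<Rightarrow> real" where "m i j = ip D (psi i) (phi j)"

lemma ip_psi_phi_sum:
  "i \<le> N \<Longrightarrow> ip D (psi i) (\<lambda>x. \<Sum>j\<in>J. a j * phi j x) = (\<Sum>j\<in>J. m i j * a j)"
  by (subst ip_sum_right) (auto simp: m_def mult.commute)

lemma grad_ip_diff_self:
  assumes "f \<in> sobolev D 1" "g \<in> sobolev D 1"
  shows "grad_ip D f f - 2 * grad_ip D f g + grad_ip D g g \<ge> 0"
proof -
  define F where "F x = f x - g x" for x
  define c :: "bool \<Rightarrow> real" where "c b = (if b then 1 else - 1)" for b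
  define k where "k b = (if b then f else g)" for b
  have FL: "F \<in> L2 D" unfolding F_def[abs_def] using assms by (auto dest: H1_L2)
  have kH: "k b \<in> sobolev D 1" for b using assms by (simp only: k_def split: if_splits) simp
  have ae: "ae_eq D F (\<lambda>x. \<Sum>b\<in>UNIV. c b * k b x)"
    by (simp add: ae_eq_def UNIV_bool c_def k_def F_def)
  have FH: "F \<in> sobolev D 1" by (rule H1_lincomb[OF kH FL ae])
  have "grad_ip D F e = grad_ip D f e - grad_ip D g e" if "e \<in> sobolev D 1" for e
    using grad_ip_lincomb_left[OF kH FL ae that] by (simp add: UNIV_bool c_def k_def)
  from this[OF FH] this[OF assms(1)] this[OF assms(2)] grad_ip_self_nonneg[of F]
  show ?thesis by (simp add: grad_ip_commute)
qed

lemma galerkin_bessel: "sqs {1..N} (\<lambda>i. \<Sum>j\<in>{1..<n}. m i j * a j) \<le> sqs {1..<n} a"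
proof -
  let ?v = "\<lambda>x. \<Sum>j\<in>{1..<n}. a j * phi j x"
  let ?w = "\<lambda>x. \<Sum>i\<in>{1..N}. ip D (psi i) ?v * psi i x"
  have w: "?w \<in> zero_mean D V"
    unfolding zero_mean_iff using V_lincomb[of "{1..N}"] ip_lincomb_psi[of "{1..N}" 0] by auto
  have v: "?v \<in> L2 D" by (intro L2_sum L2_scale) simp
  have "sqs {1..N} (\<lambda>i. ip D ?w (psi i) - ip D (psi i) ?v) = 0"
    unfolding sqs_def by (intro sum.neutral ballI) (subst ip_lincomb_psi, auto)
  then have "0 \<le> (nrm D ?v)\<^sup>2 - sqs {1..N} (\<lambda>i. ip D (psi i) ?v)"
    using dist_to_V[OF w v] zero_le_power2[of "nrm D (\<lambda>x. ?w x - ?v x)"] by linarith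
  moreover have "sqs {1..N} (\<lambda>i. ip D (psi i) ?v) = sqs {1..N} (\<lambda>i. \<Sum>j\<in>{1..<n}. m i j * a j)"
    unfolding sqs_def by (intro sum.cong refl) (simp add: ip_psi_phi_sum)
  ultimately show ?thesis by (simp add: nrm_phi_sum)
qed

lemma phi_sum_H1: "(\<lambda>x. \<Sum>j\<in>J. a j * phi j x) \<in> sobolev D 1"
  by (rule H1_lincomb[where f = phi and A = J and c = a])
    (auto simp: ae_eq_def phi_H1[simplified] intro!: L2_sum L2_scale)

lemma grad_ip_phi_sum:
  assumes "\<eta> \<in> sobolev D 1"
  shows "grad_ip D (\<lambda>x. \<Sum>j\<in>J. a j * phi j x) \<eta> = (\<Sum>j\<in>J. a j * (lam j * ip D (phi j) \<eta>))"
proof -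
  have "grad_ip D (\<lambda>x. \<Sum>j\<in>J. a j * phi j x) \<eta> = (\<Sum>j\<in>J. a j * grad_ip D (phi j) \<eta>)"
    by (rule grad_ip_lincomb_left[OF _ _ _ assms]) (auto simp: ae_eq_def phi_H1[simplified] intro!: L2_sum L2_scale)
  then show ?thesis by (simp only: grad_ip_phi[OF assms])
qed

text \<open>
  Bessel's inequality in the energy space for the projection of \<open>\<xi>\<close> onto the span of the eigenfunctions.
\<close>

lemma galerkin_energy:
  "(\<Sum>j\<in>{1..<n}. lam j * (\<Sum>i\<in>{1..N}. m i j * x i)\<^sup>2) \<le> (\<Sum>i\<in>{1..N}. mu i * (x i)\<^sup>2)"
proof -
  let ?\<xi> = "\<lambda>y. \<Sum>i\<in>{1..N}. x i * psi i y"
  have \<xi>: "?\<xi> \<in> zero_mean D V"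
    unfolding zero_mean_iff using V_lincomb[of "{1..N}"] ip_lincomb_psi[of "{1..N}" 0] by auto
  then have \<xi>H: "?\<xi> \<in> sobolev D 1" using V_H1 by (auto simp: zero_mean_def)
  define c where "c j = (\<Sum>i\<in>{1..N}. m i j * x i)" for j
  let ?\<eta> = "\<lambda>y. \<Sum>j\<in>{1..<n}. c j * phi j y"
  have c: "ip D (phi j) ?\<xi> = c j" for j
    by (subst ip_sum_right) (auto simp: c_def m_def ip_commute mult.commute)
  have \<eta>H: "?\<eta> \<in> sobolev D 1" by (rule phi_sum_H1)
  have 1: "grad_ip D ?\<eta> ?\<xi> = (\<Sum>j\<in>{1..<n}. lam j * (c j)\<^sup>2)"
    unfolding grad_ip_phi_sum[OF \<xi>H] c by (simp add: power2_eq_square ac_simps)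
  have 2: "grad_ip D ?\<eta> ?\<eta> = (\<Sum>j\<in>{1..<n}. lam j * (c j)\<^sup>2)"
    unfolding grad_ip_phi_sum[OF \<eta>H]
    by (intro sum.cong refl) (simp add: ip_commute[of "phi _"] ip_phi_sum power2_eq_square)
  have 3: "grad_ip D ?\<xi> ?\<xi> = (\<Sum>i\<in>{1..N}. mu i * (x i)\<^sup>2)"
  proof -
    have "grad_ip D ?\<xi> ?\<xi> = (\<Sum>i=1..N. ip D ?\<xi> (psi i) * grad_ip D ?\<xi> (psi i))"
      by (rule grad_ip_V_expand[OF \<xi>H \<xi>])
    also have "\<dots> = (\<Sum>i\<in>{1..N}. mu i * (x i)\<^sup>2)"
    proof (intro sum.cong refl)
      fix i assume i: "i \<in> {1..N}"
      have "ip D ?\<xi> (psi i) = x i" using i by (subst ip_lincomb_psi) auto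
      moreover have "grad_ip D ?\<xi> (psi i) = mu i * ip D ?\<xi> (psi i)"
        using grad_ip_psi[OF _ \<xi>, of i] i by (simp add: grad_ip_commute ip_commute)
      ultimately show "ip D ?\<xi> (psi i) * grad_ip D ?\<xi> (psi i) = mu i * (x i)\<^sup>2"
        by (simp add: power2_eq_square)
    qed
    finally show ?thesis .
  qed
  have "0 \<le> grad_ip D ?\<xi> ?\<xi> - 2 * grad_ip D ?\<xi> ?\<eta> + grad_ip D ?\<eta> ?\<eta>"
    by (rule grad_ip_diff_self[OF \<xi>H \<eta>H])
  then show ?thesis
    using 1 2 3 grad_ip_commute[of ?\<xi> ?\<eta>] unfolding c_def by linarith
qed

lemma ritz_props:
  assumes "v \<in> sobolev D 1"
  shows "ritz D V v \<in> zero_mean D V"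
    and "1 \<le> i \<Longrightarrow> i \<le> N \<Longrightarrow> ip D (ritz D V v) (psi i) = grad_ip D v (psi i) / mu i"
proof -
  have ritz: "ritz D V v \<in> zero_mean D V \<and> (\<forall>\<xi>\<in>zero_mean D V. grad_ip D (ritz D V v) \<xi> = grad_ip D v \<xi>)"
  proof -
    define y where "y i = grad_ip D v (psi i) / mu i" for i
    let ?w = "\<lambda>x. \<Sum>i=1..N. y i * psi i x"
    have w: "?w \<in> zero_mean D V"
      unfolding zero_mean_iff using V_lincomb[of "{1..N}"] ip_lincomb_psi[of "{1..N}" 0] by auto
    have wH: "?w \<in> sobolev D 1" using w V_H1 by (auto simp: zero_mean_def)
    have "grad_ip D ?w \<xi> = grad_ip D v \<xi>" if \<xi>: "\<xi> \<in> zero_mean D V" for \<xi>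
    proof -
      have "grad_ip D ?w (psi i) = grad_ip D v (psi i)" if i: "i \<in> {1..N}" for i
      proof -
        have "grad_ip D ?w (psi i) = mu i * ip D ?w (psi i)"
          using grad_ip_psi[OF _ w, of i] i by (simp add: grad_ip_commute ip_commute)
        also have "ip D ?w (psi i) = y i" using i by (subst ip_lincomb_psi) auto
        finally show ?thesis using mu_pos[of i] i by (simp add: y_def)
      qed
      then show ?thesis
        unfolding grad_ip_V_expand[OF wH \<xi>] grad_ip_V_expand[OF assms \<xi>] by simp
    qed
    then have "\<exists>w. w \<in> zero_mean D V \<and> (\<forall>\<xi>\<in>zero_mean D V. grad_ip D w \<xi> = grad_ip D v \<xi>)"
      using w by blast
    from someI_ex[OF this] show ?thesis unfolding ritz_def .
  qed
  then show r: "ritz D V v \<in> zero_mean D V" by simp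
  assume i: "1 \<le> i" "i \<le> N"
  have "mu i * ip D (ritz D V v) (psi i) = grad_ip D v (psi i)"
    using grad_ip_psi[OF i(2) r] ritz psi_zero_mean[OF i] by (simp add: grad_ip_commute ip_commute)
  then show "ip D (ritz D V v) (psi i) = grad_ip D v (psi i) / mu i"
    using mu_pos[OF i] by (simp add: field_simps)
qed

lemma sum_Suc_shift: "(\<Sum>k<n. f (Suc k)) = (\<Sum>j\<in>{1..<Suc n}. f j :: real)"
  by (simp add: sum.shift_bounds_Suc_ivl[of f 0 n, symmetric] lessThan_atLeast0)

lemma phi_sum_Hdot:
  fixes a :: "nat \<Rightarrow> real" and n :: nat
  defines "v \<equiv> \<lambda>x. \<Sum>j\<in>{1..<n}. a j * phi j x"
  shows "v \<in> Hdot D lam phi s" and "(snorm D lam phi s v)\<^sup>2 = (\<Sum>j\<in>{1..<n}. lam j powr s * (a j)\<^sup>2)"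
proof -
  have coef: "ip D v (phi k) = (if k \<in> {1..<n} then a k else 0)" for k
    unfolding v_def by (rule ip_phi_sum) simp
  have vL: "v \<in> L2 D" unfolding v_def by (intro L2_sum L2_scale) simp
  have "ip D v (\<lambda>x. 1) = 0"
    by (rule psi_0_const) (use coef[of 0] vL in auto)
  moreover have sums: "(\<lambda>j. lam (Suc j) powr s * (ip D v (phi (Suc j)))\<^sup>2) sums
      (\<Sum>j<n. lam (Suc j) powr s * (ip D v (phi (Suc j)))\<^sup>2)"
    by (rule sums_finite) (auto simp: coef)
  ultimately show "v \<in> Hdot D lam phi s"
    using vL by (auto simp: Hdot_def L2_zero_mean_def sums_iff)
  have "(\<Sum>j<n. lam (Suc j) powr s * (ip D v (phi (Suc j)))\<^sup>2) = (\<Sum>j\<in>{1..<Suc n}. lam j powr s * (ip D v (phi j))\<^sup>2)"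
    by (rule sum_Suc_shift)
  also have "\<dots> = (\<Sum>j\<in>{1..<n}. lam j powr s * (a j)\<^sup>2)"
    by (rule sum.mono_neutral_cong_right) (auto simp: coef)
  finally show "(snorm D lam phi s v)\<^sup>2 = (\<Sum>j\<in>{1..<n}. lam j powr s * (a j)\<^sup>2)"
    unfolding snorm_def sums_unique[OF sums, symmetric] by (simp add: sum_nonneg)
qed

text \<open>
  For a finite expansion the Ritz projection is determined by its coordinates, so the estimate
  for \<open>R\<^sub>h\<close> becomes one for the matrix \<open>m\<close>.
\<close>

lemma galerkin_ritz:
  assumes \<beta>: "1 \<le> \<beta>" "\<beta> \<le> R"
  shows "sqs {1..N} (\<lambda>i. (\<Sum>j\<in>{1..<n}. m i j * (lam j * a j)) / mu i - (\<Sum>j\<in>{1..<n}. m i j * a j))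
        + (sqs {1..<n} a - sqs {1..N} (\<lambda>i. \<Sum>j\<in>{1..<n}. m i j * a j))
      \<le> (K * h powr \<beta>)\<^sup>2 * (\<Sum>j\<in>{1..<n}. lam j powr \<beta> * (a j)\<^sup>2)"
proof -
  let ?v = "\<lambda>x. \<Sum>j\<in>{1..<n}. a j * phi j x"
  have vH: "?v \<in> sobolev D 1" by (rule phi_sum_H1)
  have vL: "?v \<in> L2 D" by (rule H1_L2[OF vH])
  have 1: "ip D (ritz D V ?v) (psi i) = (\<Sum>j\<in>{1..<n}. m i j * (lam j * a j)) / mu i" if "i \<in> {1..N}" for i
  proof -
    have "grad_ip D ?v (psi i) = (\<Sum>j\<in>{1..<n}. m i j * (lam j * a j))"
      using grad_ip_phi_sum[OF psi_H1[of i], where J = "{1..<n}" and a = a] that by (simp add: m_def ip_commute ac_simps)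
    then show ?thesis using ritz_props(2)[OF vH, of i] that by simp
  qed
  have "(nrm D (\<lambda>x. ritz D V ?v x - ?v x))\<^sup>2 \<le> (K * h powr \<beta> * snorm D lam phi \<beta> ?v)\<^sup>2"
    by (intro power_mono ritz_bound \<beta> phi_sum_Hdot) simp
  also have "\<dots> = (K * h powr \<beta>)\<^sup>2 * (\<Sum>j\<in>{1..<n}. lam j powr \<beta> * (a j)\<^sup>2)"
    unfolding power_mult_distrib[of "K * h powr \<beta>"] phi_sum_Hdot(2) ..
  finally have "(nrm D (\<lambda>x. ritz D V ?v x - ?v x))\<^sup>2 \<le> (K * h powr \<beta>)\<^sup>2 * (\<Sum>j\<in>{1..<n}. lam j powr \<beta> * (a j)\<^sup>2)" .
  moreover have "sqs {1..N} (\<lambda>i. ip D (ritz D V ?v) (psi i) - ip D (psi i) ?v)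
     = sqs {1..N} (\<lambda>i. (\<Sum>j\<in>{1..<n}. m i j * (lam j * a j)) / mu i - (\<Sum>j\<in>{1..<n}. m i j * a j))"
    unfolding sqs_def by (intro sum.cong refl, subst 1, assumption, subst ip_psi_phi_sum, simp, rule refl)
  moreover have "sqs {1..N} (\<lambda>i. ip D (psi i) ?v) = sqs {1..N} (\<lambda>i. \<Sum>j\<in>{1..<n}. m i j * a j)"
    unfolding sqs_def by (intro sum.cong refl) (simp add: ip_psi_phi_sum)
  ultimately show ?thesis
    using dist_to_V[OF ritz_props(1)[OF vH] vL] nrm_phi_sum[of "{1..<n}" a] by simp
qed

sublocale gal: galerkin "{1..N}" "{1..<n}" lam mu m K h R "lam 1" for n
proof
  show "\<And>x. (\<Sum>j\<in>{1..<n}. lam j * (\<Sum>i\<in>{1..N}. m i j * x i)\<^sup>2) \<le> (\<Sum>i\<in>{1..N}. mu i * (x i)\<^sup>2)"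
    by (rule galerkin_energy)
qed (use lam_1 lam_ge mu_pos h_pos K_nonneg R2 galerkin_bessel galerkin_ritz in auto)

section \<open>Passage to general data\<close>

abbreviation F :: "real \<Rightarrow> (('a \<Rightarrow> real) \<Rightarrow> real) \<Rightarrow> 'a \<Rightarrow> real" where
  "F \<equiv> error_F D lam phi V N mu psi"

lemma sqs_tendsto:
  assumes "\<And>i. i \<in> A \<Longrightarrow> (\<lambda>n. f n i) \<longlonglongrightarrow> g i"
  shows "(\<lambda>n. sqs A (f n)) \<longlonglongrightarrow> sqs A g"
  unfolding sqs_def by (intro tendsto_sum tendsto_power assms)

lemma phi_series_converges:
  assumes "summable (\<lambda>j. (c j)\<^sup>2)"
  shows "\<exists>w. w \<in> L2 D \<and> (\<lambda>n. nrm D (\<lambda>x. w x - (\<Sum>j<n. c j * phi j x))) \<longlonglongrightarrow> 0"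
proof (rule L2_complete)
  show "(\<lambda>x. \<Sum>j<n. c j * phi j x) \<in> L2 D" for n by (rule phi_sum_L2)
  fix e :: real assume e: "e > 0"
  then have "e\<^sup>2 > 0" by simp
  with assms obtain M where M: "\<And>m n. m \<ge> M \<Longrightarrow> norm (\<Sum>j\<in>{m..<n}. (c j)\<^sup>2) < e\<^sup>2"
    unfolding summable_Cauchy by metis
  have *: "nrm D (\<lambda>x. (\<Sum>j<n. c j * phi j x) - (\<Sum>j<m. c j * phi j x)) < e" if "M \<le> m" "m \<le> n" for m n
  proof -
    have "(\<Sum>j<n. c j * phi j x) - (\<Sum>j<m. c j * phi j x) = (\<Sum>j\<in>{m..<n}. c j * phi j x)" for x
      using sum_diff[of "{..<n}" "{..<m}" "\<lambda>j. c j * phi j x"] that by (simp add: ivl_disj_un_one lessThan_minus_lessThan)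
    then have "(nrm D (\<lambda>x. (\<Sum>j<n. c j * phi j x) - (\<Sum>j<m. c j * phi j x)))\<^sup>2 = sqs {m..<n} c"
      using nrm_phi_sum[of "{m..<n}" c] by simp
    also have "\<dots> < e\<^sup>2" using M[OF that(1), of n] unfolding sqs_def by (simp add: sum_nonneg)
    finally show ?thesis using e by (simp add: power_less_imp_less_base less_imp_le)
  qed
  show "\<exists>M. \<forall>m\<ge>M. \<forall>n\<ge>M. nrm D (\<lambda>x. (\<Sum>j<m. c j * phi j x) - (\<Sum>j<n. c j * phi j x)) < e"
  proof (intro exI allI impI)
    fix m n assume "m \<ge> M" "n \<ge> M"
    then show "nrm D (\<lambda>x. (\<Sum>j<m. c j * phi j x) - (\<Sum>j<n. c j * phi j x)) < e"
      using *[of n m] *[of m n] by (cases "n \<le> m") (auto simp: nrm_minus_commute[of "\<lambda>x. \<Sum>j<m. c j * phi j x"])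
  qed
qed

text \<open>
  What is used of the data: they have mean zero, are linear on the discrete space, and act on each discrete
  eigenfunction through its expansion in the \<open>\<phi>\<^sub>j\<close>. Both the inner product with a function of mean zero and
  the pairing with an element of a completion have these properties.
\<close>

definition good_functional :: "(('a \<Rightarrow> real) \<Rightarrow> real) \<Rightarrow> bool" where
  "good_functional l \<longleftrightarrow> l (phi 0) = 0 \<and> l (psi 0) = 0 \<and>
     (\<forall>\<xi>\<in>V. l \<xi> = (\<Sum>i\<le>N. ip D \<xi> (psi i) * l (psi i))) \<and>
     (\<forall>i\<in>{1..N}. (\<lambda>n. \<Sum>j\<in>{1..<n}. m i j * l (phi j)) \<longlonglongrightarrow> l (psi i))"

lemma proj_props:
  assumes "good_functional l"
  shows "proj D V l \<in> V" and "\<xi> \<in> V \<Longrightarrow> ip D (proj D V l) \<xi> = l \<xi>"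
proof -
  let ?w = "\<lambda>x. \<Sum>i\<le>N. l (psi i) * psi i x"
  have "?w \<in> V" by (rule V_lincomb) simp
  moreover have "ip D ?w \<xi> = l \<xi>" if \<xi>: "\<xi> \<in> V" for \<xi>
  proof -
    have "ip D ?w \<xi> = (\<Sum>i\<le>N. l (psi i) * ip D (psi i) \<xi>)"
      by (rule ip_sum_left[OF _ V_L2[OF \<xi>]]) simp
    also have "\<dots> = l \<xi>" using assms \<xi> by (simp add: good_functional_def ip_commute mult.commute)
    finally show ?thesis .
  qed
  ultimately have "\<exists>w. w \<in> V \<and> (\<forall>\<xi>\<in>V. ip D w \<xi> = l \<xi>)" by blast
  from someI_ex[OF this] have "proj D V l \<in> V \<and> (\<forall>\<xi>\<in>V. ip D (proj D V l) \<xi> = l \<xi>)"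
    unfolding proj_def .
  then show "proj D V l \<in> V" "\<xi> \<in> V \<Longrightarrow> ip D (proj D V l) \<xi> = l \<xi>" by auto
qed

text \<open>
  The distance from the discrete solution to the truncated exact one tends to the norm of the error. It
  differs from the finite-dimensional quantity only in that the discrete solution starts from the full data, and the
  finitely many discrete coordinates of the truncated data converge.
\<close>

theorem galerkin_err_tendsto:
  assumes l: "good_functional l"
    and summ: "summable (\<lambda>j. (exp (- t * (lam j)\<^sup>2) * l (phi j))\<^sup>2)"
  shows "(\<lambda>n. gal.err n (\<lambda>j. l (phi j)) t) \<longlonglongrightarrow> (nrm D (F t l))\<^sup>2"
proof -
  define a where "a j = l (phi j)" for j
  define e where "e j = exp (- t * (lam j)\<^sup>2) * a j" for j
  define p where "p i = l (psi i)" for i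
  define S where "S n x = (\<Sum>j<n. e j * phi j x)" for n x
  define q where "q i = exp (- t * (mu i)\<^sup>2) * p i" for i
  define uh where "uh = disc_E D N mu psi t (proj D V l)"
  define u where "u = semigroup_E D lam phi t l"
  have e0: "e 0 = 0" using l by (simp add: e_def a_def good_functional_def)
  have SL: "S n \<in> L2 D" for n unfolding S_def[abs_def] by (rule phi_sum_L2)
  have S_eq: "S n = (\<lambda>x. \<Sum>j\<in>{1..<n}. e j * phi j x)" for n
  proof
    fix x
    show "S n x = (\<Sum>j\<in>{1..<n}. e j * phi j x)"
      unfolding S_def by (rule sum.mono_neutral_right) (auto simp: e0 not_less_eq_eq Suc_le_eq intro: ccontr)
  qed
  have "\<exists>w. w \<in> L2 D \<and> (\<lambda>n. nrm D (\<lambda>x. w x - (\<Sum>j<n. exp (- t * (lam j)\<^sup>2) * l (phi j) * phi j x))) \<longlonglongrightarrow> 0"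
    by (rule phi_series_converges[OF summ])
  from someI_ex[OF this] have u: "u \<in> L2 D" "(\<lambda>n. nrm D (\<lambda>x. u x - S n x)) \<longlonglongrightarrow> 0"
    unfolding u_def semigroup_E_def S_def e_def a_def by auto
  have uh_eq: "uh = (\<lambda>x. \<Sum>i\<le>N. q i * psi i x)"
    unfolding uh_def disc_E_def q_def p_def
    by (intro ext sum.cong refl) (simp add: proj_props(2)[OF l] psi_V)
  have uhV: "uh \<in> V" unfolding uh_eq by (rule V_lincomb) simp
  have uh_coef: "ip D uh (psi i) = q i" if "i \<le> N" for i
    unfolding uh_eq using ip_lincomb_psi[of "{..N}" i q] that by simp
  have q0: "q 0 = 0" using l by (simp add: q_def p_def good_functional_def)
  have uh0: "uh \<in> zero_mean D V" by (simp add: zero_mean_iff uhV uh_coef q0)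
  have uhL: "uh \<in> L2 D" by (rule V_L2[OF uhV])
  have Feq: "F t l = (\<lambda>x. uh x - u x)" by (auto simp: error_F_def uh_def u_def)
  have "(\<lambda>n. nrm D (\<lambda>x. uh x - S n x)) \<longlonglongrightarrow> nrm D (\<lambda>x. uh x - u x)"
  proof -
    have "(\<lambda>n. nrm D (\<lambda>x. uh x - S n x) - nrm D (\<lambda>x. uh x - u x)) \<longlonglongrightarrow> 0"
    proof (rule Lim_null_comparison[OF _ u(2)])
      show "\<forall>\<^sub>F n in sequentially. norm (nrm D (\<lambda>x. uh x - S n x) - nrm D (\<lambda>x. uh x - u x)) \<le> nrm D (\<lambda>x. u x - S n x)"
        using nrm_diff_le[of "\<lambda>x. uh x - S n x" "\<lambda>x. uh x - u x" for n] uhL SL u(1) by (simp add: L2_diff)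
    qed
    then show ?thesis by (simp add: LIM_zero_iff)
  qed
  then have lim1: "(\<lambda>n. (nrm D (\<lambda>x. uh x - S n x))\<^sup>2) \<longlonglongrightarrow> (nrm D (F t l))\<^sup>2"
    unfolding Feq by (rule tendsto_power)
  have PS: "ip D (psi i) (S n) = gal.P n (gal.evolve t a) i" if "i \<in> {1..N}" for i n
    unfolding S_eq gal.P_def using that by (subst ip_psi_phi_sum) (auto simp: e_def gal.evolve_def)
  have evS: "(nrm D (S n))\<^sup>2 = sqs {1..<n} (gal.evolve t a)" for n
  proof -
    have "gal.evolve t a = e" by (auto simp: gal.evolve_def e_def)
    then show ?thesis unfolding S_eq by (simp add: nrm_phi_sum del: One_nat_def)
  qed
  have dist: "(nrm D (\<lambda>x. uh x - S n x))\<^sup>2 = sqs {1..N} (\<lambda>i. q i - gal.P n (gal.evolve t a) i) + gal.defect n (gal.evolve t a)" for n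
  proof -
    have "sqs {1..N} (\<lambda>i. ip D uh (psi i) - ip D (psi i) (S n)) = sqs {1..N} (\<lambda>i. q i - gal.P n (gal.evolve t a) i)"
      unfolding sqs_def by (intro sum.cong refl) (use PS uh_coef in auto)
    moreover have "sqs {1..N} (\<lambda>i. ip D (psi i) (S n)) = sqs {1..N} (gal.P n (gal.evolve t a))"
      unfolding sqs_def by (intro sum.cong refl) (simp only: PS)
    ultimately show ?thesis unfolding dist_to_V[OF uh0 SL] gal.defect_def evS by simp
  qed
  have P_lim: "(\<lambda>n. gal.P n a i) \<longlonglongrightarrow> p i" if "i \<in> {1..N}" for i
    using l that unfolding good_functional_def gal.P_def a_def p_def by blast
  have Pev_lim: "(\<lambda>n. gal.P n (gal.evolve t a) i) \<longlonglongrightarrow> ip D u (psi i)" if "i \<in> {1..N}" for i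
  proof -
    have "(\<lambda>n. ip D (S n) (psi i)) \<longlonglongrightarrow> ip D u (psi i)"
      using that by (intro ip_tendsto_left SL u) simp
    then show ?thesis using PS[OF that] by (simp add: ip_commute)
  qed
  define b where "b i = q i - ip D u (psi i)" for i
  have A: "(\<lambda>n. sqs {1..N} (\<lambda>i. q i - gal.P n (gal.evolve t a) i)) \<longlonglongrightarrow> sqs {1..N} b"
    unfolding b_def by (intro sqs_tendsto tendsto_diff tendsto_const Pev_lim)
  have B: "(\<lambda>n. sqs {1..N} (gal.w n a t)) \<longlonglongrightarrow> sqs {1..N} b"
    unfolding b_def gal.w_def[abs_def] q_def
    by (intro sqs_tendsto tendsto_diff tendsto_mult tendsto_const Pev_lim P_lim)
  have "(\<lambda>n. (nrm D (\<lambda>x. uh x - S n x))\<^sup>2 - sqs {1..N} (\<lambda>i. q i - gal.P n (gal.evolve t a) i) + sqs {1..N} (gal.w n a t))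
      \<longlonglongrightarrow> (nrm D (F t l))\<^sup>2 - sqs {1..N} b + sqs {1..N} b"
    by (intro tendsto_add tendsto_diff lim1 A B)
  then show ?thesis
    unfolding dist a_def[symmetric] gal.err_def by (simp add: a_def[abs_def] add.commute)
qed

definition rate :: real where
  "rate = 4 * (26 + (279 + 125 * (1 + 1 / (lam 1)\<^sup>2)\<^sup>2) * K\<^sup>2) + K\<^sup>2"

text \<open>
  At \<open>\<tau> = 0\<close> the semigroup may be undefined for data in a completion, so the convergence is used only for
  \<open>\<tau> > 0\<close>, where the smoothing makes the coefficients square summable; one time is negligible. Fatou's
  lemma then gives both integrability and the bound.
\<close>

theorem error_integral_bound:
  assumes l: "good_functional l" and \<beta>: "1 \<le> \<beta>" "\<beta> \<le> R" and h: "h \<le> exp (- 1)" and T: "0 \<le> T"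
    and A: "\<And>n. (\<Sum>j\<in>{1..<n}. lam j powr (\<beta> - 2) * (l (phi j))\<^sup>2) \<le> A"
  shows "set_integrable lborel {0..T} (\<lambda>\<tau>. (nrm D (F \<tau> l))\<^sup>2)"
    and "(LINT \<tau>:{0..T}|lborel. (nrm D (F \<tau> l))\<^sup>2) \<le> rate * ((h powr \<beta> * ln h)\<^sup>2 * A)"
proof -
  let ?a = "\<lambda>j. l (phi j)"
  let ?E = "\<lambda>\<tau>. (nrm D (F \<tau> l))\<^sup>2"
  define C where "C = rate * ((h powr \<beta> * ln h)\<^sup>2 * A)"
  have rate0: "0 \<le> rate" by (simp add: rate_def)
  have A0: "0 \<le> A" using A[of 0] by simp
  have C0: "0 \<le> C" using rate0 A0 by (simp add: C_def)
  have lim: "(\<lambda>n. gal.err n ?a \<tau>) \<longlonglongrightarrow> ?E \<tau>" if \<tau>: "\<tau> > 0" for \<tau>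
  proof (rule galerkin_err_tendsto[OF l])
    \<comment> \<open>absorbs \<open>\<lambda>\<^sup>2\<^sup>-\<^sup>\<beta>\<close>: by \<open>1 + \<lambda>\<^sup>2\<close> if \<open>\<beta> \<le> 2\<close>, by its value at the spectral gap otherwise\<close>
    define c where "c = 1 + lam 1 powr (2 - \<beta>)"
    have c0: "c \<ge> 0" by (simp add: c_def)
    let ?g = "\<lambda>j. (exp (- \<tau> * (lam j)\<^sup>2) * l (phi j))\<^sup>2"
    have le: "?g j \<le> (c + 1 / \<tau>) * (lam j powr (\<beta> - 2) * (l (phi j))\<^sup>2)" if j: "1 \<le> j" for j
    proof -
      have lp: "lam j > 0" using lam_pos[OF j] .
      define x where "x = \<tau> * (lam j)\<^sup>2"
      have x: "x > 0" using \<tau> lp by (simp add: x_def)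
      have "lam j powr (2 - \<beta>) \<le> c + (lam j)\<^sup>2"
      proof (cases "\<beta> \<le> 2")
        case True
        have "lam j powr (2 - \<beta>) \<le> 1 + (lam j)\<^sup>2"
        proof (cases "lam j \<le> 1")
          case True
          then have "lam j powr (2 - \<beta>) \<le> 1" using lp \<open>\<beta> \<le> 2\<close> by (intro powr_le1) auto
          then show ?thesis using zero_le_power2[of "lam j"] by linarith
        next
          case False
          then have "lam j powr (2 - \<beta>) \<le> lam j powr 2" using \<beta> by (intro powr_mono) auto
          then show ?thesis using lp by simp
        qed
        moreover have "0 \<le> lam 1 powr (2 - \<beta>)" by simp
        ultimately show ?thesis unfolding c_def by linarith
      next
        case False
        then have "lam j powr (2 - \<beta>) \<le> lam 1 powr (2 - \<beta>)"
          using lam_ge[OF j] lam_1 by (intro powr_mono2') auto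
        then show ?thesis using zero_le_power2[of "lam j"] unfolding c_def by linarith
      qed
      then have "(exp (- x))\<^sup>2 * lam j powr (2 - \<beta>) \<le> (exp (- x))\<^sup>2 * (c + (lam j)\<^sup>2)"
        by (rule mult_left_mono) simp
      also have "\<dots> = c * (exp (- x))\<^sup>2 + x * exp (- x) * exp (- x) / \<tau>"
        using \<tau> by (simp add: x_def power2_eq_square field_simps)
      also have "\<dots> \<le> c * 1 + 1 * 1 / \<tau>"
        using mult_exp_neg_le_1[of x] x \<tau> c0
        by (intro add_mono mult_left_mono divide_right_mono mult_mono) (auto intro: power_le_one)
      finally have "(exp (- x))\<^sup>2 * lam j powr (2 - \<beta>) * lam j powr (\<beta> - 2) \<le> (c + 1 / \<tau>) * lam j powr (\<beta> - 2)"
        by (intro mult_right_mono) auto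
      moreover have "lam j powr (2 - \<beta>) * lam j powr (\<beta> - 2) = 1"
        using lp by (simp flip: powr_add)
      ultimately have "(exp (- x))\<^sup>2 \<le> (c + 1 / \<tau>) * lam j powr (\<beta> - 2)" by (simp add: mult.assoc)
      then have "(exp (- x))\<^sup>2 * (l (phi j))\<^sup>2 \<le> (c + 1 / \<tau>) * lam j powr (\<beta> - 2) * (l (phi j))\<^sup>2"
        by (rule mult_right_mono) simp
      then show ?thesis by (simp add: power_mult_distrib x_def mult.assoc)
    qed
    show "summable ?g"
    proof (rule summableI_nonneg_bounded)
      fix n
      have "(\<Sum>j<n. ?g j) = (\<Sum>j\<in>{1..<n}. ?g j)"
        by (rule sum.mono_neutral_right)
          (use l in \<open>auto simp: good_functional_def not_less_eq_eq Suc_le_eq intro: ccontr\<close>)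
      also have "\<dots> \<le> (\<Sum>j\<in>{1..<n}. (c + 1 / \<tau>) * (lam j powr (\<beta> - 2) * (l (phi j))\<^sup>2))"
        by (intro sum_mono le) simp
      also have "\<dots> \<le> (c + 1 / \<tau>) * A"
        unfolding sum_distrib_left[symmetric] using \<tau> c0 by (intro mult_left_mono A) simp
      finally show "(\<Sum>j<n. ?g j) \<le> (c + 1 / \<tau>) * A" .
    qed simp
  qed
  have err_int: "integral {0..T} (gal.err n ?a) \<le> C" for n
  proof -
    have "integral {0..T} (gal.err n ?a) \<le> rate * ((h powr \<beta> * ln h)\<^sup>2 * gal.seminorm_sq n (\<beta> - 2) ?a)"
      unfolding rate_def gal.stab_def[symmetric] by (rule gal.rough_data_bound[OF \<beta> h T])
    also have "\<dots> \<le> C"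
      unfolding C_def gal.seminorm_sq_def using rate0 A by (intro mult_left_mono) auto
    finally show ?thesis .
  qed
  define G where "G n \<tau> = indicat_real {0..T} \<tau> * gal.err n ?a \<tau>" for n \<tau>
  define E where "E \<tau> = indicat_real {0..T} \<tau> * ?E \<tau>" for \<tau>
  have [measurable]: "G n \<in> borel_measurable borel" for n
  proof -
    have "gal.err n ?a \<in> borel_measurable borel"
      by (intro borel_measurable_continuous_onI gal.err_cont)
    then show ?thesis unfolding G_def[abs_def] by measurable
  qed
  have G0: "0 \<le> G n \<tau>" for n \<tau> unfolding G_def by (intro mult_nonneg_nonneg gal.err_nonneg) simp
  have G_lim: "(\<lambda>n. G n \<tau>) \<longlonglongrightarrow> E \<tau>" if "\<tau> \<noteq> 0" for \<tau>
  proof (cases "\<tau> \<in> {0..T}")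
    case True
    then show ?thesis unfolding G_def E_def using that by (intro tendsto_mult tendsto_const lim) auto
  qed (simp add: G_def E_def)
  have "E \<in> borel_measurable lborel"
  proof -
    have "(\<lambda>\<tau>. if \<tau> = 0 then E 0 else lim (\<lambda>n. G n \<tau>)) \<in> borel_measurable lborel" by measurable
    moreover have "(\<lambda>\<tau>. if \<tau> = 0 then E 0 else lim (\<lambda>n. G n \<tau>)) = E"
      using G_lim by (auto simp: limI)
    ultimately show ?thesis by simp
  qed
  note this[measurable]
  have "(\<integral>\<^sup>+\<tau>. ennreal (E \<tau>) \<partial>lborel) = (\<integral>\<^sup>+\<tau>. liminf (\<lambda>n. ennreal (G n \<tau>)) \<partial>lborel)"
  proof (rule nn_integral_cong_AE)
    show "AE \<tau> in lborel. ennreal (E \<tau>) = liminf (\<lambda>n. ennreal (G n \<tau>))"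
      using AE_lborel_singleton[of "0::real"]
    proof eventually_elim
      case (elim \<tau>)
      have "(\<lambda>n. ennreal (G n \<tau>)) \<longlonglongrightarrow> ennreal (E \<tau>)" by (intro tendsto_ennrealI G_lim elim)
      then show ?case by (intro lim_imp_Liminf[symmetric]) simp
    qed
  qed
  also have "\<dots> \<le> liminf (\<lambda>n. \<integral>\<^sup>+\<tau>. ennreal (G n \<tau>) \<partial>lborel)"
    by (rule nn_integral_liminf) measurable
  also have "\<dots> \<le> ennreal C"
  proof (rule Liminf_le)
    have "(\<integral>\<^sup>+\<tau>. ennreal (G n \<tau>) \<partial>lborel) \<le> ennreal C" for n
    proof -
      have "(gal.err n ?a has_integral integral {0..T} (gal.err n ?a)) {0..T}"
        by (intro integrable_integral integrable_continuous_real gal.err_cont)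
      then have "(G n has_integral integral {0..T} (gal.err n ?a)) UNIV"
      proof -
        have "G n = (\<lambda>\<tau>. if \<tau> \<in> {0..T} then gal.err n ?a \<tau> else 0)"
          by (intro ext) (simp only: G_def indicator_def of_bool_def mult_1_left mult_zero_left split: if_splits, auto)
        then show ?thesis
          using \<open>(gal.err n ?a has_integral integral {0..T} (gal.err n ?a)) {0..T}\<close>
          by (simp only: has_integral_restrict_UNIV)
      qed
      then have "(\<integral>\<^sup>+\<tau>. ennreal (G n \<tau>) \<partial>lborel) = ennreal (integral {0..T} (gal.err n ?a))"
        by (intro nn_integral_has_integral_lborel G0) auto
      then show ?thesis using err_int by (simp add: ennreal_leI)
    qed
    then show "\<forall>\<^sub>F n in sequentially. (\<integral>\<^sup>+\<tau>. ennreal (G n \<tau>) \<partial>lborel) \<le> ennreal C" by simp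
  qed simp
  finally have le: "(\<integral>\<^sup>+\<tau>. ennreal (E \<tau>) \<partial>lborel) \<le> ennreal C" .
  have E0: "0 \<le> E \<tau>" for \<tau> by (simp add: E_def)
  have int: "integrable lborel E"
    using le E0 by (intro integrableI_nonneg) (auto intro: le_less_trans)
  then show "set_integrable lborel {0..T} ?E" by (simp add: set_integrable_def E_def[abs_def])
  have "ennreal (\<integral>\<tau>. E \<tau> \<partial>lborel) \<le> ennreal C"
    using le nn_integral_eq_integral[OF int] E0 by simp
  then have "(\<integral>\<tau>. E \<tau> \<partial>lborel) \<le> C" using C0 by simp
  then show "(LINT \<tau>:{0..T}|lborel. ?E \<tau>) \<le> rate * ((h powr \<beta> * ln h)\<^sup>2 * A)"
    by (simp add: set_lebesgue_integral_def E_def C_def)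
qed

lemma partial_sum_le_snorm:
  assumes "summable (\<lambda>j. lam (Suc j) powr s * (ip D v (phi (Suc j)))\<^sup>2)"
  shows "(\<Sum>j\<in>{1..<n}. lam j powr s * (ip D v (phi j))\<^sup>2) \<le> (snorm D lam phi s v)\<^sup>2"
proof -
  have "(\<Sum>j\<in>{1..<n}. lam j powr s * (ip D v (phi j))\<^sup>2) \<le> (\<Sum>j\<in>{1..<Suc n}. lam j powr s * (ip D v (phi j))\<^sup>2)"
    by (intro sum_mono2) auto
  also have "\<dots> = (\<Sum>k<n. lam (Suc k) powr s * (ip D v (phi (Suc k)))\<^sup>2)" by (rule sum_Suc_shift[symmetric])
  also have "\<dots> \<le> (\<Sum>k. lam (Suc k) powr s * (ip D v (phi (Suc k)))\<^sup>2)"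
    by (rule sum_le_suminf[OF assms]) auto
  also have "\<dots> = (snorm D lam phi s v)\<^sup>2"
    unfolding snorm_def by (simp add: suminf_nonneg[OF assms])
  finally show ?thesis .
qed

lemma snorm_nonneg:
  "summable (\<lambda>j. lam (Suc j) powr s * (ip D v (phi (Suc j)))\<^sup>2) \<Longrightarrow> 0 \<le> snorm D lam phi s v"
  by (simp add: snorm_def suminf_nonneg)

lemma bessel_phi: "v \<in> L2 D \<Longrightarrow> summable (\<lambda>j. (ip D v (phi j))\<^sup>2)"
proof (rule summableI_nonneg_bounded)
  assume v: "v \<in> L2 D"
  fix n
  define S where "S x = (\<Sum>j<n. ip D v (phi j) * phi j x)" for x
  have SL: "S \<in> L2 D" unfolding S_def[abs_def] by (rule phi_sum_L2)
  have S2: "(nrm D S)\<^sup>2 = (\<Sum>j<n. (ip D v (phi j))\<^sup>2)"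
    using nrm_phi_sum[of "{..<n}" "\<lambda>j. ip D v (phi j)"] by (simp add: S_def[abs_def] sqs_def)
  have "ip D S v = (\<Sum>j<n. ip D v (phi j) * ip D (phi j) v)"
    unfolding S_def by (rule ip_sum_left[OF phi_L2 v])
  then have "ip D S v = (nrm D S)\<^sup>2" unfolding S2 by (simp add: ip_commute[of "phi _"] power2_eq_square)
  moreover have "0 \<le> (nrm D (\<lambda>x. S x - v x))\<^sup>2" by simp
  moreover have "(nrm D (\<lambda>x. S x - v x))\<^sup>2 = (nrm D S)\<^sup>2 - 2 * ip D S v + (nrm D v)\<^sup>2"
    using SL v by (simp add: nrm_sq ip_diff_left ip_diff_right L2_diff ip_commute)
  ultimately show "(\<Sum>j<n. (ip D v (phi j))\<^sup>2) \<le> (nrm D v)\<^sup>2" using S2 by linarith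
qed simp

lemma good_functional_ip:
  assumes "v \<in> L2_zero_mean D" shows "good_functional (ip D v)"
  unfolding good_functional_def
proof (intro conjI ballI zero_mean_phi_0 zero_mean_psi_0 assms)
  have v: "v \<in> L2 D" using assms by (simp add: L2_zero_mean_def)
  fix \<xi> assume "\<xi> \<in> V"
  from ip_V_expand[OF this v] show "ip D v \<xi> = (\<Sum>i\<le>N. ip D \<xi> (psi i) * ip D v (psi i))"
    by (simp add: ip_commute)
next
  have v: "v \<in> L2 D" using assms by (simp add: L2_zero_mean_def)
  fix i assume i: "i \<in> {1..N}"
  define S where "S n x = (\<Sum>j<n. ip D v (phi j) * phi j x)" for n x
  have "(\<lambda>n. ip D (S n) (psi i)) \<longlonglongrightarrow> ip D v (psi i)"
    using i phi_complete[OF v] unfolding S_def[abs_def]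
    by (intro ip_tendsto_left phi_sum_L2 v) auto
  moreover have "ip D (S n) (psi i) = (\<Sum>j\<in>{1..<n}. m i j * ip D v (phi j))" for n
  proof -
    have "ip D (S n) (psi i) = (\<Sum>j<n. m i j * ip D v (phi j))"
      unfolding S_def using i ip_psi_phi_sum[of i, where J = "{..<n}" and a = "\<lambda>j. ip D v (phi j)"] by (simp add: ip_commute)
    also have "\<dots> = (\<Sum>j\<in>{1..<n}. m i j * ip D v (phi j))"
      by (rule sum.mono_neutral_right)
        (auto simp: zero_mean_phi_0[OF assms] not_less_eq_eq Suc_le_eq intro: ccontr)
    finally show ?thesis .
  qed
  ultimately show "(\<lambda>n. \<Sum>j\<in>{1..<n}. m i j * ip D v (phi j)) \<longlonglongrightarrow> ip D v (psi i)" by simp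
qed

theorem smooth_data_error:
  assumes \<beta>: "1 \<le> \<beta>" "\<beta> \<le> R" and t: "0 \<le> t" and v: "v \<in> Hdot D lam phi \<beta>"
  shows "nrm D (F t (ip D v)) \<le> 7 * K * h powr \<beta> * snorm D lam phi \<beta> v"
proof -
  have v0: "v \<in> L2_zero_mean D" and vL: "v \<in> L2 D"
    and vs: "summable (\<lambda>j. lam (Suc j) powr \<beta> * (ip D v (phi (Suc j)))\<^sup>2)"
    using v by (auto simp: Hdot_def L2_zero_mean_def)
  have summ: "summable (\<lambda>j. (exp (- t * (lam j)\<^sup>2) * ip D v (phi j))\<^sup>2)"
    by (rule summable_comparison_test'[OF bessel_phi[OF vL], of 0])
      (use t in \<open>auto simp: power_mult_distrib intro!: mult_left_le_one_le power_le_one\<close>)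
  have "(nrm D (F t (ip D v)))\<^sup>2 \<le> 42 * ((K * h powr \<beta>)\<^sup>2 * (snorm D lam phi \<beta> v)\<^sup>2)"
  proof (rule LIMSEQ_le_const2[OF galerkin_err_tendsto[OF good_functional_ip[OF v0] summ]], intro exI allI impI)
    fix n
    have "gal.err n (\<lambda>j. ip D v (phi j)) t \<le> 42 * ((K * h powr \<beta>)\<^sup>2 * gal.seminorm_sq n \<beta> (\<lambda>j. ip D v (phi j)))"
      by (rule gal.smooth_data_bound[OF \<beta> t])
    also have "\<dots> \<le> 42 * ((K * h powr \<beta>)\<^sup>2 * (snorm D lam phi \<beta> v)\<^sup>2)"
      unfolding gal.seminorm_sq_def using partial_sum_le_snorm[OF vs] by (intro mult_left_mono) auto
    finally show "gal.err n (\<lambda>j. ip D v (phi j)) t \<le> 42 * ((K * h powr \<beta>)\<^sup>2 * (snorm D lam phi \<beta> v)\<^sup>2)" .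
  qed
  also have "\<dots> \<le> 49 * ((K * h powr \<beta>)\<^sup>2 * (snorm D lam phi \<beta> v)\<^sup>2)"
    by (rule mult_right_mono) auto
  also have "\<dots> = (7 * K * h powr \<beta> * snorm D lam phi \<beta> v)\<^sup>2" by (simp add: power_mult_distrib)
  finally show ?thesis
    by (rule power2_le_imp_le) (use K_nonneg snorm_nonneg[OF vs] in simp)
qed

lemma rough_data_error_aux:
  assumes l: "good_functional l" and \<beta>: "1 \<le> \<beta>" "\<beta> \<le> R" and h: "h \<le> exp (- 1)" and T: "0 \<le> T"
    and A: "0 \<le> A" "\<And>n. (\<Sum>j\<in>{1..<n}. lam j powr (\<beta> - 2) * (l (phi j))\<^sup>2) \<le> A\<^sup>2"
  shows "set_integrable lborel {0..T} (\<lambda>\<tau>. (nrm D (F \<tau> l))\<^sup>2) \<and>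
    sqrt (LINT \<tau>:{0..T}|lborel. (nrm D (F \<tau> l))\<^sup>2) \<le> sqrt rate * \<bar>ln h\<bar> * h powr \<beta> * A"
proof
  show "set_integrable lborel {0..T} (\<lambda>\<tau>. (nrm D (F \<tau> l))\<^sup>2)"
    by (rule error_integral_bound(1)[OF l \<beta> h T A(2)])
  have "sqrt (LINT \<tau>:{0..T}|lborel. (nrm D (F \<tau> l))\<^sup>2) \<le> sqrt (rate * ((h powr \<beta> * ln h)\<^sup>2 * A\<^sup>2))"
    by (rule real_sqrt_le_mono[OF error_integral_bound(2)[OF l \<beta> h T A(2)]])
  also have "\<dots> = sqrt rate * \<bar>ln h\<bar> * h powr \<beta> * A"
    using A(1) by (simp add: real_sqrt_mult abs_mult)
  finally show "sqrt (LINT \<tau>:{0..T}|lborel. (nrm D (F \<tau> l))\<^sup>2) \<le> sqrt rate * \<bar>ln h\<bar> * h powr \<beta> * A" .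
qed

theorem rough_data_error:
  assumes "1 \<le> \<beta>" "\<beta> \<le> R" "h \<le> exp (- 1)" "0 \<le> T" and v: "v \<in> Hdot D lam phi (\<beta> - 2)"
  shows "set_integrable lborel {0..T} (\<lambda>\<tau>. (nrm D (F \<tau> (ip D v)))\<^sup>2) \<and>
    sqrt (LINT \<tau>:{0..T}|lborel. (nrm D (F \<tau> (ip D v)))\<^sup>2)
      \<le> sqrt rate * \<bar>ln h\<bar> * h powr \<beta> * snorm D lam phi (\<beta> - 2) v"
  using v partial_sum_le_snorm[of "\<beta> - 2" v]
  by (intro rough_data_error_aux assms good_functional_ip snorm_nonneg) (auto simp: Hdot_def)

lemma summable_neg:
  assumes "v \<in> L2 D" "s \<le> 0"
  shows "summable (\<lambda>j. lam (Suc j) powr s * (ip D v (phi (Suc j)))\<^sup>2)"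
proof (rule summable_comparison_test'[where N = 0])
  show "summable (\<lambda>j. lam 1 powr s * (ip D v (phi (Suc j)))\<^sup>2)"
    using bessel_phi[OF assms(1)] by (intro summable_mult) (simp add: summable_Suc_iff[of "\<lambda>j. (ip D v (phi j))\<^sup>2"])
  fix j
  have "lam (Suc j) powr s \<le> lam 1 powr s"
    using lam_ge[of "Suc j"] lam_1 assms(2) by (intro powr_mono2') auto
  then show "norm (lam (Suc j) powr s * (ip D v (phi (Suc j)))\<^sup>2) \<le> lam 1 powr s * (ip D v (phi (Suc j)))\<^sup>2"
    by (simp add: mult_right_mono)
qed

lemma snorm_nonneg': "v \<in> L2 D \<Longrightarrow> s \<le> 0 \<Longrightarrow> 0 \<le> snorm D lam phi s v"
  by (intro snorm_nonneg summable_neg)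

lemma snorm_as_limit:
  assumes "summable (\<lambda>j. lam (Suc j) powr s * (ip D v (phi (Suc j)))\<^sup>2)"
  shows "(\<lambda>n. L2_set (\<lambda>j. lam (Suc j) powr (s / 2) * ip D v (phi (Suc j))) {..<n}) \<longlonglongrightarrow> snorm D lam phi s v"
proof -
  have "(lam (Suc j) powr (s / 2) * c)\<^sup>2 = lam (Suc j) powr s * c\<^sup>2" for j c
    by (simp add: power_mult_distrib power2_eq_square flip: powr_add)
  then show ?thesis
    unfolding L2_set_def snorm_def using summable_LIMSEQ[OF assms] by (simp add: tendsto_real_sqrt)
qed

lemma snorm_triangle:
  assumes "v \<in> L2 D" "w \<in> L2 D" "s \<le> 0"
  shows "snorm D lam phi s v \<le> snorm D lam phi s w + snorm D lam phi s (\<lambda>x. v x - w x)"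
proof (rule LIMSEQ_le[OF snorm_as_limit tendsto_add[OF snorm_as_limit snorm_as_limit]])
  let ?f = "\<lambda>v j. lam (Suc j) powr (s / 2) * ip D v (phi (Suc j))"
  have "L2_set (?f v) {..<n} \<le> L2_set (?f w) {..<n} + L2_set (?f (\<lambda>x. v x - w x)) {..<n}" for n
  proof -
    have "?f v = (\<lambda>j. ?f w j + ?f (\<lambda>x. v x - w x) j)"
      using assms by (simp add: ip_diff_left algebra_simps)
    then show ?thesis using L2_set_triangle_ineq[of "?f w" "?f (\<lambda>x. v x - w x)" "{..<n}"] by simp
  qed
  then show "\<exists>n0. \<forall>n\<ge>n0. L2_set (?f v) {..<n} \<le> L2_set (?f w) {..<n} + L2_set (?f (\<lambda>x. v x - w x)) {..<n}"
    by blast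
qed (use assms in \<open>auto intro: summable_neg\<close>)

text \<open>
  The tail of the series for the energy of a discrete eigenfunction \<open>\<psi>\<^sub>i\<close>, which by Bessel's inequality is at
  most \<open>\<mu>\<^sub>i\<close>.
\<close>

definition tail :: "nat \<Rightarrow> nat \<Rightarrow> real" where
  "tail i n = (\<Sum>k. lam (Suc (k + n)) * (m i (Suc (k + n)))\<^sup>2)"

lemma tail_props:
  assumes i: "i \<in> {1..N}"
  shows "summable (\<lambda>k. lam (Suc k) * (m i (Suc k))\<^sup>2)" and "tail i \<longlonglongrightarrow> 0" and "0 \<le> tail i n"
    and "(\<Sum>j\<in>{Suc n..<k}. lam j * (m i j)\<^sup>2) \<le> tail i n"
proof -
  let ?d = "\<lambda>k. lam (Suc k) * (m i (Suc k))\<^sup>2"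
  have d0: "0 \<le> ?d k" for k using lam_pos[of "Suc k"] by simp
  show summ: "summable ?d"
  proof (rule summableI_nonneg_bounded[OF d0])
    fix n
    \<comment> \<open>the energy inequality for \<open>\<psi>\<^sub>i\<close> itself bounds the partial sums by \<open>\<mu>\<^sub>i\<close>\<close>
    define x where "x k = (if k = i then 1 else 0 :: real)" for k
    have "(\<Sum>k<n. ?d k) = (\<Sum>j\<in>{1..<Suc n}. lam j * (m i j)\<^sup>2)" by (rule sum_Suc_shift)
    also have "\<dots> = (\<Sum>j\<in>{1..<Suc n}. lam j * (\<Sum>k\<in>{1..N}. m k j * x k)\<^sup>2)"
      using i by (simp add: x_def if_distrib cong: if_cong)
    also have "\<dots> \<le> (\<Sum>k\<in>{1..N}. mu k * (x k)\<^sup>2)" by (rule galerkin_energy)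
    finally show "(\<Sum>k<n. ?d k) \<le> (\<Sum>k\<in>{1..N}. mu k * (x k)\<^sup>2)" .
  qed
  show "tail i \<longlonglongrightarrow> 0" unfolding tail_def[abs_def] using suminf_exist_split2[OF summ] by simp
  have summ': "summable (\<lambda>k. ?d (k + n))" using summ summable_iff_shift[of ?d n] by blast
  show "0 \<le> tail i n" unfolding tail_def by (intro suminf_nonneg summ' d0)
  have "(\<Sum>j\<in>{Suc n..<k}. lam j * (m i j)\<^sup>2) \<le> (\<Sum>j\<in>{Suc n..<Suc n + k}. lam j * (m i j)\<^sup>2)"
    using lam_pos by (intro sum_mono2) (auto simp: less_imp_le)
  also have "\<dots> = (\<Sum>j<k. ?d (j + n))"
    using sum.shift_bounds_nat_ivl[of "\<lambda>j. lam j * (m i j)\<^sup>2" 0 "Suc n" k] by (simp add: lessThan_atLeast0 add.commute)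
  also have "\<dots> \<le> tail i n" unfolding tail_def by (intro sum_le_suminf summ') (auto simp: d0)
  finally show "(\<Sum>j\<in>{Suc n..<k}. lam j * (m i j)\<^sup>2) \<le> tail i n" .
qed

text \<open>
  The expansion of \<open>(v, \<psi>\<^sub>i)\<close> converges at a rate depending on \<open>v\<close> only through a negative seminorm:
  \<open>|v|\<^sub>-\<^sub>1\<close> is paired with the energy tail of \<open>\<psi>\<^sub>i\<close>, and it is dominated by \<open>|v|\<^sub>s\<close> for \<open>s \<ge> -1\<close> because of the spectral
  gap. This uniformity allows limits in \<open>v\<close> and in the truncation index to be exchanged.
\<close>

lemma tail_bound:
  assumes v: "v \<in> L2_zero_mean D" and s: "- 1 \<le> s" "s \<le> 0" and i: "i \<in> {1..N}"
  shows "\<bar>ip D v (psi i) - (\<Sum>j\<in>{1..<Suc n}. m i j * ip D v (phi j))\<bar>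
    \<le> lam 1 powr ((- 1 - s) / 2) * snorm D lam phi s v * sqrt (tail i n)"
proof -
  have vL: "v \<in> L2 D" using v by (simp add: L2_zero_mean_def)
  let ?a = "\<lambda>j. ip D v (phi j)"
  let ?B = "lam 1 powr ((- 1 - s) / 2) * snorm D lam phi s v * sqrt (tail i n)"
  have bound: "\<bar>\<Sum>j\<in>{Suc n..<k}. m i j * ?a j\<bar> \<le> ?B" for k
  proof -
    have *: "(\<Sum>j\<in>{Suc n..<k}. m i j * b j) \<le> ?B" if b: "\<And>j. (b j)\<^sup>2 = (?a j)\<^sup>2" for b
    proof -
      have "(\<Sum>j\<in>{Suc n..<k}. m i j * b j) = (\<Sum>j\<in>{Suc n..<k}. (b j / sqrt (lam j)) * (sqrt (lam j) * m i j))"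
        by (intro sum.cong refl) (use lam_pos in \<open>auto simp: less_imp_neq[symmetric]\<close>)
      also have "\<dots> \<le> sqrt (sqs {Suc n..<k} (\<lambda>j. b j / sqrt (lam j))) * sqrt (sqs {Suc n..<k} (\<lambda>j. sqrt (lam j) * m i j))"
        by (rule sum_mult_le_sqrt_sqs)
      also have "\<dots> \<le> (lam 1 powr ((- 1 - s) / 2) * snorm D lam phi s v) * sqrt (tail i n)"
      proof (rule mult_mono)
        have "sqs {Suc n..<k} (\<lambda>j. sqrt (lam j) * m i j) = (\<Sum>j\<in>{Suc n..<k}. lam j * (m i j)\<^sup>2)"
          unfolding sqs_def by (intro sum.cong refl) (use lam_pos in \<open>auto simp: power_mult_distrib less_imp_le\<close>)
        then show "sqrt (sqs {Suc n..<k} (\<lambda>j. sqrt (lam j) * m i j)) \<le> sqrt (tail i n)"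
          using tail_props(4)[OF i] by simp
        have "sqs {Suc n..<k} (\<lambda>j. b j / sqrt (lam j)) \<le> (\<Sum>j\<in>{Suc n..<k}. lam 1 powr (- 1 - s) * (lam j powr s * (?a j)\<^sup>2))"
          unfolding sqs_def
        proof (rule sum_mono)
          fix j assume "j \<in> {Suc n..<k}"
          then have j: "1 \<le> j" by simp
          have lp: "lam j > 0" by (rule lam_pos[OF j])
          have "lam j powr (- 1 - s) \<le> lam 1 powr (- 1 - s)"
            using lam_ge[OF j] lam_1 s by (intro powr_mono2') auto
          then have "lam j powr (- 1 - s) * (lam j powr s * (?a j)\<^sup>2) \<le> lam 1 powr (- 1 - s) * (lam j powr s * (?a j)\<^sup>2)"
            by (rule mult_right_mono) simp
          moreover have "lam j powr (- 1 - s) * lam j powr s = 1 / lam j"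
            using lp by (simp add: powr_minus_divide flip: powr_add)
          ultimately show "(b j / sqrt (lam j))\<^sup>2 \<le> lam 1 powr (- 1 - s) * (lam j powr s * (?a j)\<^sup>2)"
            using lp by (simp add: power_divide b flip: mult.assoc)
        qed
        also have "\<dots> \<le> lam 1 powr (- 1 - s) * (snorm D lam phi s v)\<^sup>2"
          unfolding sum_distrib_left[symmetric]
        proof (rule mult_left_mono)
          have "(\<Sum>j\<in>{Suc n..<k}. lam j powr s * (?a j)\<^sup>2) \<le> (\<Sum>j\<in>{1..<k}. lam j powr s * (?a j)\<^sup>2)"
            by (intro sum_mono2) auto
          also have "\<dots> \<le> (snorm D lam phi s v)\<^sup>2" by (rule partial_sum_le_snorm[OF summable_neg[OF vL s(2)]])
          finally show "(\<Sum>j\<in>{Suc n..<k}. lam j powr s * (?a j)\<^sup>2) \<le> (snorm D lam phi s v)\<^sup>2" .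
        qed simp
        also have "\<dots> = (lam 1 powr ((- 1 - s) / 2) * snorm D lam phi s v)\<^sup>2"
          by (simp add: power_mult_distrib power2_eq_square flip: powr_add)
        finally show "sqrt (sqs {Suc n..<k} (\<lambda>j. b j / sqrt (lam j))) \<le> lam 1 powr ((- 1 - s) / 2) * snorm D lam phi s v"
          by (rule real_le_lsqrt[rotated -1]) (auto simp: snorm_nonneg'[OF vL s(2)])
      qed (auto simp: snorm_nonneg'[OF vL s(2)])
      finally show ?thesis .
    qed
    from *[of ?a] *[of "\<lambda>j. - ?a j"] show ?thesis by (simp add: sum_negf abs_le_iff)
  qed
  have lim: "(\<lambda>k. \<Sum>j\<in>{1..<k}. m i j * ?a j) \<longlonglongrightarrow> ip D v (psi i)"
    using good_functional_ip[OF v] i by (simp add: good_functional_def)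
  have "(\<lambda>k. \<bar>(\<Sum>j\<in>{1..<k}. m i j * ?a j) - (\<Sum>j\<in>{1..<Suc n}. m i j * ?a j)\<bar>)
      \<longlonglongrightarrow> \<bar>ip D v (psi i) - (\<Sum>j\<in>{1..<Suc n}. m i j * ?a j)\<bar>"
    by (intro tendsto_intros lim)
  then show ?thesis
  proof (rule LIMSEQ_le_const2, intro exI allI impI)
    fix k assume k: "Suc n \<le> k"
    have "(\<Sum>j\<in>{1..<k}. m i j * ?a j) = (\<Sum>j\<in>{1..<Suc n}. m i j * ?a j) + (\<Sum>j\<in>{Suc n..<k}. m i j * ?a j)"
      using k by (intro sum.atLeastLessThan_concat[symmetric]) auto
    then show "\<bar>(\<Sum>j\<in>{1..<k}. m i j * ?a j) - (\<Sum>j\<in>{1..<Suc n}. m i j * ?a j)\<bar> \<le> ?B"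
      using bound[of k] by simp
  qed
qed

text \<open>
  All quantities attached to a Cauchy sequence are limits. Coordinates with respect to \<open>\<phi>\<^sub>j\<close> converge
  because a single weighted coordinate is at most the seminorm, those with respect to \<open>\<psi>\<^sub>i\<close> by the tail
  estimate without leading terms.
\<close>

theorem completion_functional:
  assumes s: "- 1 \<le> s" "s \<le> 0" and x: "x \<in> Hdot_compl D lam phi s"
  shows "good_functional (pairing D x)" and "0 \<le> snorm_compl D lam phi s x"
    and "(\<Sum>j\<in>{1..<n}. lam j powr s * (pairing D x (phi j))\<^sup>2) \<le> (snorm_compl D lam phi s x)\<^sup>2"
proof -
  let ?S = "snorm D lam phi s"
  have x0: "x n \<in> L2_zero_mean D" for n using x by (simp add: Hdot_compl_def)
  then have xL: "x n \<in> L2 D" for n by (simp add: L2_zero_mean_def)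
  have xd0: "(\<lambda>y. x p y - x q y) \<in> L2_zero_mean D" for p q
    using x0[of p] x0[of q] by (auto simp: L2_zero_mean_def ip_diff_left)
  have Cau: "\<exists>M. \<forall>p\<ge>M. \<forall>q\<ge>M. ?S (\<lambda>y. x p y - x q y) < e" if "e > 0" for e
    using x that by (simp add: Hdot_compl_def)
  have conv_of_bound: "convergent z" if z: "\<And>p q. \<bar>z p - z q\<bar> \<le> C * ?S (\<lambda>y. x p y - x q y)" and C: "C \<ge> 0"
    for z :: "nat \<Rightarrow> real" and C
  proof (rule Cauchy_convergent, rule CauchyI)
    fix e :: real assume e: "e > 0"
    then have "e / (C + 1) > 0" using C by simp
    from Cau[OF this] obtain M where M: "\<And>p q. p \<ge> M \<Longrightarrow> q \<ge> M \<Longrightarrow> ?S (\<lambda>y. x p y - x q y) < e / (C + 1)" by blast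
    have "\<bar>z p - z q\<bar> < e" if "p \<ge> M" "q \<ge> M" for p q
    proof -
      have "\<bar>z p - z q\<bar> \<le> (C + 1) * ?S (\<lambda>y. x p y - x q y)"
        using z[of p q] snorm_nonneg'[of "\<lambda>y. x p y - x q y" s] xL s(2) by (simp add: distrib_right L2_diff)
      also have "\<dots> < e" using M[OF that] C by (simp add: field_simps)
      finally show ?thesis .
    qed
    then show "\<exists>M. \<forall>p\<ge>M. \<forall>q\<ge>M. norm (z p - z q) < e" by auto
  qed
  have S_lim: "(\<lambda>p. ?S (x p)) \<longlonglongrightarrow> snorm_compl D lam phi s x"
  proof -
    have "convergent (\<lambda>p. ?S (x p))"
    proof (rule conv_of_bound[where C = 1])
      fix p q
      have "?S (\<lambda>y. x q y - x p y) = ?S (\<lambda>y. x p y - x q y)"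
        unfolding snorm_def using xL by (simp add: ip_diff_left power2_commute)
      then show "\<bar>?S (x p) - ?S (x q)\<bar> \<le> 1 * ?S (\<lambda>y. x p y - x q y)"
        using snorm_triangle[OF xL[of p] xL[of q] s(2)] snorm_triangle[OF xL[of q] xL[of p] s(2)] by simp
    qed simp
    then show ?thesis by (simp add: convergent_LIMSEQ_iff snorm_compl_def)
  qed
  show S0: "0 \<le> snorm_compl D lam phi s x"
    by (rule LIMSEQ_le_const[OF S_lim]) (simp add: snorm_nonneg'[OF xL s(2)])
  have phi_lim: "(\<lambda>p. ip D (x p) (phi j)) \<longlonglongrightarrow> pairing D x (phi j)" if j: "1 \<le> j" for j
  proof -
    have "convergent (\<lambda>p. ip D (x p) (phi j))"
    proof (rule conv_of_bound)
      fix p q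
      define d where "d y = x p y - x q y" for y
      have dL: "d \<in> L2 D" unfolding d_def[abs_def] using xL by auto
      have lp: "lam j powr (s / 2) > 0" using lam_pos[OF j] by simp
      have "lam j powr s * (ip D d (phi j))\<^sup>2 \<le> (\<Sum>j\<in>{1..<Suc j}. lam j powr s * (ip D d (phi j))\<^sup>2)"
        using j by (intro member_le_sum) auto
      also have "\<dots> \<le> (?S d)\<^sup>2" by (rule partial_sum_le_snorm[OF summable_neg[OF dL s(2)]])
      finally have "(lam j powr (s / 2) * \<bar>ip D d (phi j)\<bar>)\<^sup>2 \<le> (?S d)\<^sup>2"
        by (simp add: power_mult_distrib power2_eq_square[of "lam j powr _"] flip: powr_add)
      then have "lam j powr (s / 2) * \<bar>ip D d (phi j)\<bar> \<le> ?S d"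
        by (rule power2_le_imp_le) (rule snorm_nonneg'[OF dL s(2)])
      then have "\<bar>ip D d (phi j)\<bar> \<le> inverse (lam j powr (s / 2)) * ?S d"
        using lp by (simp add: field_simps)
      then show "\<bar>ip D (x p) (phi j) - ip D (x q) (phi j)\<bar> \<le> inverse (lam j powr (s / 2)) * ?S (\<lambda>y. x p y - x q y)"
        unfolding d_def[abs_def] using xL by (simp add: ip_diff_left)
    qed simp
    then show ?thesis by (simp add: convergent_LIMSEQ_iff pairing_def)
  qed
  have psi_lim: "(\<lambda>p. ip D (x p) (psi i)) \<longlonglongrightarrow> pairing D x (psi i)" if i: "i \<in> {1..N}" for i
  proof -
    have "convergent (\<lambda>p. ip D (x p) (psi i))"
    proof (rule conv_of_bound[where C = "lam 1 powr ((- 1 - s) / 2) * sqrt (tail i 0)"])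
      fix p q
      show "\<bar>ip D (x p) (psi i) - ip D (x q) (psi i)\<bar>
          \<le> lam 1 powr ((- 1 - s) / 2) * sqrt (tail i 0) * ?S (\<lambda>y. x p y - x q y)"
        using tail_bound[OF xd0[of p q] s i, of 0] xL i by (simp add: ip_diff_left ac_simps)
    qed (use tail_props(3)[OF i] in simp)
    then show ?thesis by (simp add: convergent_LIMSEQ_iff pairing_def)
  qed
  show "(\<Sum>j\<in>{1..<n}. lam j powr s * (pairing D x (phi j))\<^sup>2) \<le> (snorm_compl D lam phi s x)\<^sup>2"
  proof (rule LIMSEQ_le)
    show "(\<lambda>p. \<Sum>j\<in>{1..<n}. lam j powr s * (ip D (x p) (phi j))\<^sup>2)
        \<longlonglongrightarrow> (\<Sum>j\<in>{1..<n}. lam j powr s * (pairing D x (phi j))\<^sup>2)"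
      by (intro tendsto_intros phi_lim) auto
    show "(\<lambda>p. (?S (x p))\<^sup>2) \<longlonglongrightarrow> (snorm_compl D lam phi s x)\<^sup>2"
      by (intro tendsto_intros S_lim)
    show "\<exists>M. \<forall>p\<ge>M. (\<Sum>j\<in>{1..<n}. lam j powr s * (ip D (x p) (phi j))\<^sup>2) \<le> (?S (x p))\<^sup>2"
      using partial_sum_le_snorm[OF summable_neg[OF xL s(2)]] by blast
  qed
  have pair0: "pairing D x (phi 0) = 0" "pairing D x (psi 0) = 0"
    unfolding pairing_def by (simp_all add: zero_mean_phi_0[OF x0] zero_mean_psi_0[OF x0])
  have psi_lim': "(\<lambda>p. ip D (x p) (psi i)) \<longlonglongrightarrow> pairing D x (psi i)" if "i \<le> N" for i
    using psi_lim[of i] that by (cases "i = 0") (simp_all add: pair0 zero_mean_psi_0[OF x0])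
  show "good_functional (pairing D x)"
    unfolding good_functional_def
  proof (intro conjI ballI pair0)
    fix \<xi> assume \<xi>: "\<xi> \<in> V"
    have "(\<lambda>p. \<Sum>i\<le>N. ip D \<xi> (psi i) * ip D (x p) (psi i)) \<longlonglongrightarrow> (\<Sum>i\<le>N. ip D \<xi> (psi i) * pairing D x (psi i))"
      by (intro tendsto_sum tendsto_mult tendsto_const psi_lim') simp
    moreover have "(\<Sum>i\<le>N. ip D \<xi> (psi i) * ip D (x p) (psi i)) = ip D (x p) \<xi>" for p
      using ip_V_expand[OF \<xi> xL[of p]] by (simp add: ip_commute)
    ultimately show "pairing D x \<xi> = (\<Sum>i\<le>N. ip D \<xi> (psi i) * pairing D x (psi i))"
      unfolding pairing_def[of D x \<xi>] by (simp add: limI)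
  next
    fix i assume i: "i \<in> {1..N}"
    define c where "c = lam 1 powr ((- 1 - s) / 2) * snorm_compl D lam phi s x"
    have le: "\<bar>pairing D x (psi i) - (\<Sum>j\<in>{1..<Suc n}. m i j * pairing D x (phi j))\<bar> \<le> c * sqrt (tail i n)" for n
    proof (rule LIMSEQ_le)
      show "(\<lambda>p. \<bar>ip D (x p) (psi i) - (\<Sum>j\<in>{1..<Suc n}. m i j * ip D (x p) (phi j))\<bar>)
          \<longlonglongrightarrow> \<bar>pairing D x (psi i) - (\<Sum>j\<in>{1..<Suc n}. m i j * pairing D x (phi j))\<bar>"
        by (intro tendsto_intros phi_lim psi_lim i) auto
      show "(\<lambda>p. lam 1 powr ((- 1 - s) / 2) * ?S (x p) * sqrt (tail i n)) \<longlonglongrightarrow> c * sqrt (tail i n)"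
        unfolding c_def by (intro tendsto_intros S_lim)
    qed (use tail_bound[OF x0 s i] in blast)
    have "(\<lambda>n. c * sqrt (tail i n)) \<longlonglongrightarrow> c * sqrt 0" by (intro tendsto_intros tail_props(2)[OF i])
    then have "(\<lambda>n. c * sqrt (tail i n)) \<longlonglongrightarrow> 0" by simp
    then have "(\<lambda>n. pairing D x (psi i) - (\<Sum>j\<in>{1..<Suc n}. m i j * pairing D x (phi j))) \<longlonglongrightarrow> 0"
      by (rule Lim_null_comparison[rotated]) (intro always_eventually allI, simp only: real_norm_def le)
    from tendsto_diff[OF tendsto_const[of "pairing D x (psi i)"] this]
    have "(\<lambda>n. \<Sum>j\<in>{1..<Suc n}. m i j * pairing D x (phi j)) \<longlonglongrightarrow> pairing D x (psi i)"
      by (simp only: diff_diff_eq2 add_diff_cancel_left' diff_zero)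
    then show "(\<lambda>n. \<Sum>j\<in>{1..<n}. m i j * pairing D x (phi j)) \<longlonglongrightarrow> pairing D x (psi i)"
      by (rule LIMSEQ_imp_Suc)
  qed
qed

theorem completion_data_error:
  assumes "1 \<le> \<beta>" "\<beta> \<le> 2" "h \<le> exp (- 1)" "0 \<le> T" and x: "x \<in> Hdot_compl D lam phi (\<beta> - 2)"
  shows "set_integrable lborel {0..T} (\<lambda>\<tau>. (nrm D (F \<tau> (pairing D x)))\<^sup>2) \<and>
    sqrt (LINT \<tau>:{0..T}|lborel. (nrm D (F \<tau> (pairing D x)))\<^sup>2)
      \<le> sqrt rate * \<bar>ln h\<bar> * h powr \<beta> * snorm_compl D lam phi (\<beta> - 2) x"
  using assms R2 by (intro rough_data_error_aux completion_functional) auto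

end

section \<open>The error estimates\<close>

theorem theorem2p1:
  fixes D :: "'a::euclidean_space set"
    and lam :: "nat \<Rightarrow> real" and phi :: "nat \<Rightarrow> 'a \<Rightarrow> real"
    and S :: "real \<Rightarrow> ('a \<Rightarrow> real) set"
    and N :: "real \<Rightarrow> nat" and lamh :: "real \<Rightarrow> nat \<Rightarrow> real" and phih :: "real \<Rightarrow> nat \<Rightarrow> 'a \<Rightarrow> real"
    and r :: nat
  assumes dim: "DIM('a) \<le> 3"
    and domain: "open D" "connected D" "D \<noteq> {}" "bounded D" "Ck_boundary 2 D"
    and eigenbasis: "neumann_eigenbasis D lam phi"
    and S_subspace: "\<And>h. h > 0 \<Longrightarrow> fin_dim_subspace D (S h)"
    and S_H1: "\<And>h. h > 0 \<Longrightarrow> S h \<subseteq> sobolev D 1"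
    and S_const: "\<And>h c. h > 0 \<Longrightarrow> (\<lambda>x. c) \<in> S h"
    and disc_eigenbasis: "\<And>h. h > 0 \<Longrightarrow> disc_eigenbasis D (S h) (N h) (lamh h) (phih h)"
    and phih_0: "\<And>h. h > 0 \<Longrightarrow> ae_eq D (phih h 0) (phi 0)"
    and r: "2 \<le> r"
    and ritz: "\<exists>C. \<forall>h>0. \<forall>\<beta>. 1 \<le> \<beta> \<and> \<beta> \<le> real r \<longrightarrow>
                 (\<forall>v\<in>Hdot D lam phi \<beta>.
                    nrm D (\<lambda>x. ritz D (S h) v x - v x) \<le> C * h powr \<beta> * snorm D lam phi \<beta> v)"
  shows "\<exists>h0>0. \<exists>C>0. \<forall>h \<beta> t. 0 < h \<and> h \<le> h0 \<and> 1 \<le> \<beta> \<and> \<beta> \<le> real r \<and> 0 \<le> t \<longrightarrow>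
     (let F = error_F D lam phi (S h) (N h) (lamh h) (phih h) in
       (\<forall>v\<in>Hdot D lam phi \<beta>.
          nrm D (F t (ip D v)) \<le> C * h powr \<beta> * snorm D lam phi \<beta> v) \<and>
       (2 \<le> \<beta> \<longrightarrow> (\<forall>v\<in>Hdot D lam phi (\<beta> - 2).
          set_integrable lborel {0..t} (\<lambda>\<tau>. (nrm D (F \<tau> (ip D v)))\<^sup>2) \<and>
          sqrt (LINT \<tau>:{0..t}|lborel. (nrm D (F \<tau> (ip D v)))\<^sup>2)
            \<le> C * \<bar>ln h\<bar> * h powr \<beta> * snorm D lam phi (\<beta> - 2) v)) \<and>
       (\<beta> < 2 \<longrightarrow> (\<forall>v\<in>Hdot_compl D lam phi (\<beta> - 2).
          set_integrable lborel {0..t} (\<lambda>\<tau>. (nrm D (F \<tau> (pairing D v)))\<^sup>2) \<and>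
          sqrt (LINT \<tau>:{0..t}|lborel. (nrm D (F \<tau> (pairing D v)))\<^sup>2)
            \<le> C * \<bar>ln h\<bar> * h powr \<beta> * snorm_compl D lam phi (\<beta> - 2) v)))"
proof -
  have open_D: "bounded_open D" using domain by unfold_locales auto
  from ritz obtain C where C: "\<And>h \<beta> v. h > 0 \<Longrightarrow> 1 \<le> \<beta> \<Longrightarrow> \<beta> \<le> real r \<Longrightarrow> v \<in> Hdot D lam phi \<beta> \<Longrightarrow>
      nrm D (\<lambda>x. ritz D (S h) v x - v x) \<le> C * h powr \<beta> * snorm D lam phi \<beta> v"
    by blast
  define K where "K = \<bar>C\<bar>"
  define \<rho> where "\<rho> = 4 * (26 + (279 + 125 * (1 + 1 / (lam 1)\<^sup>2)\<^sup>2) * K\<^sup>2) + K\<^sup>2"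
  have semi: "semidiscretization D lam phi (S h) (N h) (lamh h) (phih h) K h (real r)" if h: "h > 0" for h
  proof (intro semidiscretization.intro open_D semidiscretization_axioms.intro)
    fix \<beta> :: real and v assume \<beta>: "1 \<le> \<beta>" "\<beta> \<le> real r" and v: "v \<in> Hdot D lam phi \<beta>"
    then have "0 \<le> snorm D lam phi \<beta> v" by (simp add: Hdot_def snorm_def suminf_nonneg)
    then have "C * h powr \<beta> * snorm D lam phi \<beta> v \<le> K * h powr \<beta> * snorm D lam phi \<beta> v"
      by (intro mult_right_mono) (auto simp: K_def)
    with C[OF h \<beta> v] show "nrm D (\<lambda>x. ritz D (S h) v x - v x) \<le> K * h powr \<beta> * snorm D lam phi \<beta> v"
      by linarith
  qed (use h eigenbasis S_subspace S_H1 disc_eigenbasis phih_0 r in \<open>auto simp: K_def\<close>)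
  have \<rho>0: "0 \<le> \<rho>" by (simp add: \<rho>_def)
  have K0: "0 \<le> K" by (simp add: K_def)
  define Cst where "Cst = 7 * K + sqrt \<rho> + 1"
  have Cst: "Cst > 0" "7 * K \<le> Cst" "sqrt \<rho> \<le> Cst"
    using K0 real_sqrt_ge_zero[OF \<rho>0] unfolding Cst_def by linarith+
  show ?thesis
  proof (rule exI[of _ "exp (- 1)"], rule conjI, simp, rule exI[of _ Cst], intro conjI allI impI)
    fix h \<beta> t :: real
    assume "0 < h \<and> h \<le> exp (- 1) \<and> 1 \<le> \<beta> \<and> \<beta> \<le> real r \<and> 0 \<le> t"
    then have h: "0 < h" "h \<le> exp (- 1)" and \<beta>: "1 \<le> \<beta>" "\<beta> \<le> real r" and t: "0 \<le> t" by auto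
    interpret semidiscretization D lam phi "S h" "N h" "lamh h" "phih h" K h "real r"
      by (rule semi[OF h(1)])
    have weaken: "X \<le> Cst * a * b * c"
      if "X \<le> sqrt \<rho> * a * b * c" "0 \<le> a" "0 \<le> b" "0 \<le> c" for X a b c :: real
    proof -
      have "sqrt \<rho> * a * b * c \<le> Cst * a * b * c"
        using that Cst(3) by (intro mult_right_mono) auto
      then show ?thesis using that(1) by linarith
    qed
    have rate_eq: "semidiscretization.rate lam K = \<rho>"
      unfolding rate_def \<rho>_def ..
    show "let F = error_F D lam phi (S h) (N h) (lamh h) (phih h) in
       (\<forall>v\<in>Hdot D lam phi \<beta>.
          nrm D (F t (ip D v)) \<le> Cst * h powr \<beta> * snorm D lam phi \<beta> v) \<and>
       (2 \<le> \<beta> \<longrightarrow> (\<forall>v\<in>Hdot D lam phi (\<beta> - 2).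
          set_integrable lborel {0..t} (\<lambda>\<tau>. (nrm D (F \<tau> (ip D v)))\<^sup>2) \<and>
          sqrt (LINT \<tau>:{0..t}|lborel. (nrm D (F \<tau> (ip D v)))\<^sup>2)
            \<le> Cst * \<bar>ln h\<bar> * h powr \<beta> * snorm D lam phi (\<beta> - 2) v)) \<and>
       (\<beta> < 2 \<longrightarrow> (\<forall>v\<in>Hdot_compl D lam phi (\<beta> - 2).
          set_integrable lborel {0..t} (\<lambda>\<tau>. (nrm D (F \<tau> (pairing D v)))\<^sup>2) \<and>
          sqrt (LINT \<tau>:{0..t}|lborel. (nrm D (F \<tau> (pairing D v)))\<^sup>2)
            \<le> Cst * \<bar>ln h\<bar> * h powr \<beta> * snorm_compl D lam phi (\<beta> - 2) v))"
      unfolding Let_def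
    proof (intro conjI ballI impI)
      fix v assume v: "v \<in> Hdot D lam phi \<beta>"
      then have s0: "0 \<le> snorm D lam phi \<beta> v" by (intro snorm_nonneg) (simp add: Hdot_def)
      have "7 * K * h powr \<beta> * snorm D lam phi \<beta> v \<le> Cst * h powr \<beta> * snorm D lam phi \<beta> v"
        using Cst(2) s0 by (intro mult_right_mono) auto
      then show "nrm D (F t (ip D v)) \<le> Cst * h powr \<beta> * snorm D lam phi \<beta> v"
        using smooth_data_error[OF \<beta> t v] by linarith
    next
      fix v assume v: "v \<in> Hdot D lam phi (\<beta> - 2)"
      then have s0: "0 \<le> snorm D lam phi (\<beta> - 2) v" by (intro snorm_nonneg) (simp add: Hdot_def)
      note E = rough_data_error[OF \<beta> h(2) t v, unfolded rate_eq]
      show "set_integrable lborel {0..t} (\<lambda>\<tau>. (nrm D (F \<tau> (ip D v)))\<^sup>2)" using E by blast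
      show "sqrt (LINT \<tau>:{0..t}|lborel. (nrm D (F \<tau> (ip D v)))\<^sup>2)
            \<le> Cst * \<bar>ln h\<bar> * h powr \<beta> * snorm D lam phi (\<beta> - 2) v"
        by (rule weaken[OF conjunct2[OF E] _ _ s0]) auto
    next
      fix v assume \<beta>2: "\<beta> < 2" and v: "v \<in> Hdot_compl D lam phi (\<beta> - 2)"
      have s0: "0 \<le> snorm_compl D lam phi (\<beta> - 2) v"
        by (rule completion_functional(2)[OF _ _ v]) (use \<beta> \<beta>2 in auto)
      note E = completion_data_error[OF \<beta>(1) less_imp_le[OF \<beta>2] h(2) t v, unfolded rate_eq]
      show "set_integrable lborel {0..t} (\<lambda>\<tau>. (nrm D (F \<tau> (pairing D v)))\<^sup>2)" using E by blast
      show "sqrt (LINT \<tau>:{0..t}|lborel. (nrm D (F \<tau> (pairing D v)))\<^sup>2)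
            \<le> Cst * \<bar>ln h\<bar> * h powr \<beta> * snorm_compl D lam phi (\<beta> - 2) v"
        by (rule weaken[OF conjunct2[OF E] _ _ s0]) auto
    qed
  qed (use Cst in auto)
qed

end
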